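(* Let $\xi\in\mathrm{IS}$, $X\in\mathbb P$ and $F\in\mathbf C$. Then: (1) if $i,j\in I$ and $i<j$, there exists $X'\in\mathbb P$, $X'\subseteq X$, such that the coordinate function $C_j(x)=x(j)$ on $\mathcal D^I$ captures $i$ on $X'$; (2) if $i\in I\setminus\xi$ and $F$ is reducible to $\xi$ on $X$, then $F$ does not capture $i$ on $X$; (3) if for all $X'\in\mathbb P$ with $X'\subseteq X$ and all $i\in\xi$ there exists $X''\in\mathbb P$, $X''\subseteq X'$, such that $F$ captures $i$ on $X''$, then there exists $Y\in\mathbb P$, $Y\subseteq X$, such that $F$ captures each $i\in\xi$ on $Y$; (4) there exists $X'\in\mathbb P$, $X'\subseteq X$, satisfying exactly one of: (a) $F$ is reducible to $\xi$ on $X'$; (b) $F$ captures some $i\in I\setminus\xi$ on $X'$.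
   Context: Fix a countable partially ordered set $I$. $\mathcal D=2^\omega$. For $\xi\subseteq I$, $\mathcal D^\xi$ is the product of $\xi$ copies of $\mathcal D$ (product topology); points are functions $x:\xi\to\mathcal D$. For $\xi\subseteq\eta$, $x\restriction\xi$ is restriction and $X\restriction\xi=\{x\restriction\xi:x\in X\}$. $\mathrm{IS}$ is the set of initial (downward closed) subsets of $I$. $[<i]=\{j:j<i\}$, $[\le i]$, $[\not\ge i]=\{j\in I:\neg(j\ge i)\}$; $X\restriction_{<i}=X\restriction[<i]$. For $i\in\xi\in\mathrm{IS}$, $X\subseteq\mathcal D^\xi$, $z\in X\restriction_{<i}$: $D_{Xz}(i)=\{x(i):x\in X,x\restriction_{<i}=z\}$. For $\zeta\in\mathrm{IS}$, $\mathbb P'_\zeta$ is the set of $X\subseteq\mathcal D^\zeta$ with: (P1) $X$ closed nonempty; (P2) each $D_{Xz}(i)$ ($i\in\zeta$, $z\in X\restriction_{<i}$) is perfect; (P3) for $i\in\zeta$ and open $G\subseteq\mathcal D$, $\{x\restriction_{<i}:x\in X,x(i)\in G\}$ is open in $X\restriction_{<i}$; (P4) if $\xi,\eta\in\mathrm{IS}$, $\xi\cup\eta\subseteq\zeta$, $x\in X\restriction\xi$, $y\in X\restriction\eta$, $x\restriction(\xi\cap\eta)=y\restriction(\xi\cap\eta)$, then $x\cup y\in X\restriction(\xi\cup\eta)$. For $A\subseteq\mathcal D$ with at least two points, $l$ = length of the longest finite binary sequence that is an initial segment of all $a\in A$, $\mathrm{Spl}(A,e)=\{a\in A:a(l)=e\}$.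 For $X\in\mathbb P'_\zeta$, $i\in\zeta$: $\mathrm{Spl}(X,i,e)=\{x\in X:x(i)\in\mathrm{Spl}(D_{X,x\restriction_{<i}}(i),e)\}$. A $\zeta$-admissible function is $\Phi:\omega\to\zeta$ taking each value infinitely often; $X_\Phi[\Lambda]=X$, $X_\Phi[u^\frown e]=\mathrm{Spl}(X_\Phi[u],\Phi(m),e)$ for $u\in2^m$, $X_\Phi[a]=\bigcap_mX_\Phi[a\restriction m]$. $X$ is shrinkable if all $X_\Phi[a]$ are singletons; $\mathbb P_\zeta$ = shrinkable members of $\mathbb P'_\zeta$; $\mathbb P=\mathbb P_I$. $\mathbf C$ is the set of continuous functions $F:\mathcal D^I\to\omega^\omega$. $F$ is reducible to $\xi\in\mathrm{IS}$ on $X\subseteq\mathcal D^I$ if $F(x)=F(y)$ for all $x,y\in X$ with $x\restriction\xi=y\restriction\xi$. A function $F$ on $\mathcal D^I$ captures $i\in I$ on $X$ if $x(i)=y(i)$ for all $x,y\in X$ with $F(x)=F(y)$. *)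

theory Defs
  imports "HOL-Analysis.Analysis" "HOL-Library.Countable_Set"
begin

text \<open>
  The space \<open>nat \<Rightarrow> bool\<close> carries the product topology of the discrete topology on \<open>bool\<close>.
  Points of the power indexed by \<open>A\<close> are extensional functions
  (value \<open>undefined\<close> outside \<open>A\<close>), so restriction is the library's \<open>restrict\<close>.
  A partially ordered set is a subset \<open>I\<close> of an ordered type with the induced order;
  this includes the empty one.
\<close>

type_synonym cantor = "nat \<Rightarrow> bool"

definition cantor_power :: "'i set \<Rightarrow> ('i \<Rightarrow> cantor) topology" where
  "cantor_power A = product_topology (\<lambda>_. euclidean) A"

definition proj_set :: "('i \<Rightarrow> cantor) set \<Rightarrow> 'i set \<Rightarrow> ('i \<Rightarrow> cantor) set" where
  "proj_set X A = (\<lambda>x. restrict x A) ` X"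

definition initial_sets :: "'i::order set \<Rightarrow> 'i set set" where
  "initial_sets I = {\<xi>. \<xi> \<subseteq> I \<and> (\<forall>i\<in>\<xi>. \<forall>j\<in>I. j \<le> i \<longrightarrow> j \<in> \<xi>)}"

definition below :: "'i::order set \<Rightarrow> 'i \<Rightarrow> 'i set" where
  "below I i = {j \<in> I. j < i}"

definition fibre :: "'i::order set \<Rightarrow> ('i \<Rightarrow> cantor) set \<Rightarrow> ('i \<Rightarrow> cantor) \<Rightarrow> 'i \<Rightarrow> cantor set" where
  "fibre I X z i = {x i | x. x \<in> X \<and> restrict x (below I i) = z}"

definition perfect_set :: "'a::topological_space set \<Rightarrow> bool" where
  "perfect_set A \<longleftrightarrow> closed A \<and> A \<noteq> {} \<and> (\<forall>a\<in>A. a islimpt A)"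

text \<open>
  In the last condition, \<open>merge \<xi> \<eta> (x, y)\<close> is the union \<open>x \<union> y\<close> of the two
  functions, as they agree on \<open>\<xi> \<inter> \<eta>\<close>.
\<close>

definition iter_perfect' :: "'i::order set \<Rightarrow> 'i set \<Rightarrow> ('i \<Rightarrow> cantor) set set" where
  "iter_perfect' I \<zeta> = {X.
     closedin (cantor_power \<zeta>) X \<and> X \<noteq> {} \<and>
     (\<forall>i\<in>\<zeta>. \<forall>z\<in>proj_set X (below I i). perfect_set (fibre I X z i)) \<and>
     (\<forall>i\<in>\<zeta>. \<forall>G. open G \<longrightarrow>
        openin (subtopology (cantor_power (below I i)) (proj_set X (below I i)))
               {restrict x (below I i) | x. x \<in> X \<and> x i \<in> G}) \<and>
     (\<forall>\<xi>\<in>initial_sets I. \<forall>\<eta>\<in>initial_sets I. \<xi> \<union> \<eta> \<subseteq> \<zeta> \<longrightarrow>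
        (\<forall>x\<in>proj_set X \<xi>. \<forall>y\<in>proj_set X \<eta>.
           restrict x (\<xi> \<inter> \<eta>) = restrict y (\<xi> \<inter> \<eta>) \<longrightarrow>
           merge \<xi> \<eta> (x, y) \<in> proj_set X (\<xi> \<union> \<eta>)))}"

text \<open>
  Bits are booleans, and \<open>map a [0..<l]\<close> is the initial segment of \<open>a\<close> of length \<open>l\<close>.
  The value of \<open>stem_length\<close> is meaningful only for sets with at least two points.
\<close>

definition stem_length :: "cantor set \<Rightarrow> nat" where
  "stem_length A = (GREATEST l. \<exists>s :: bool list. length s = l \<and> (\<forall>a\<in>A. map a [0..<l] = s))"

definition split_half :: "cantor set \<Rightarrow> bool \<Rightarrow> cantor set" where
  "split_half A e = {a \<in> A. a (stem_length A) = e}"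

definition split_at :: "'i::order set \<Rightarrow> ('i \<Rightarrow> cantor) set \<Rightarrow> 'i \<Rightarrow> bool \<Rightarrow> ('i \<Rightarrow> cantor) set" where
  "split_at I X i e = {x \<in> X. x i \<in> split_half (fibre I X (restrict x (below I i)) i) e}"

definition admissible :: "'i set \<Rightarrow> (nat \<Rightarrow> 'i) \<Rightarrow> bool" where
  "admissible \<zeta> \<Phi> \<longleftrightarrow> range \<Phi> \<subseteq> \<zeta> \<and> (\<forall>i\<in>\<zeta>. infinite {m. \<Phi> m = i})"

definition split_node ::
    "'i::order set \<Rightarrow> ('i \<Rightarrow> cantor) set \<Rightarrow> (nat \<Rightarrow> 'i) \<Rightarrow> bool list \<Rightarrow> ('i \<Rightarrow> cantor) set" where
  "split_node I X \<Phi> u = foldl (\<lambda>Y (m, e). split_at I Y (\<Phi> m) e) X (zip [0..<length u] u)"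

lemma split_node_Nil: "split_node I X \<Phi> [] = X"
  by (simp add: split_node_def)

lemma split_node_snoc:
  "split_node I X \<Phi> (u @ [e]) = split_at I (split_node I X \<Phi> u) (\<Phi> (length u)) e"
  by (simp add: split_node_def)

definition split_branch ::
    "'i::order set \<Rightarrow> ('i \<Rightarrow> cantor) set \<Rightarrow> (nat \<Rightarrow> 'i) \<Rightarrow> cantor \<Rightarrow> ('i \<Rightarrow> cantor) set" where
  "split_branch I X \<Phi> a = (\<Inter>m. split_node I X \<Phi> (map a [0..<m]))"

definition shrinkable :: "'i::order set \<Rightarrow> 'i set \<Rightarrow> ('i \<Rightarrow> cantor) set \<Rightarrow> bool" where
  "shrinkable I \<zeta> X \<longleftrightarrow>
     (\<forall>\<Phi>. admissible \<zeta> \<Phi> \<longrightarrow> (\<forall>a. \<exists>x. split_branch I X \<Phi> a = {x}))"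

definition iter_perfect :: "'i::order set \<Rightarrow> 'i set \<Rightarrow> ('i \<Rightarrow> cantor) set set" where
  "iter_perfect I \<zeta> = {X \<in> iter_perfect' I \<zeta>. shrinkable I \<zeta> X}"

definition reducible_to :: "(('i \<Rightarrow> cantor) \<Rightarrow> 'b) \<Rightarrow> 'i set \<Rightarrow> ('i \<Rightarrow> cantor) set \<Rightarrow> bool" where
  "reducible_to F \<xi> X \<longleftrightarrow>
     (\<forall>x\<in>X. \<forall>y\<in>X. restrict x \<xi> = restrict y \<xi> \<longrightarrow> F x = F y)"

definition captures :: "(('i \<Rightarrow> cantor) \<Rightarrow> 'b) \<Rightarrow> 'i \<Rightarrow> ('i \<Rightarrow> cantor) set \<Rightarrow> bool" where
  "captures F i X \<longleftrightarrow> (\<forall>x\<in>X. \<forall>y\<in>X. F x = F y \<longrightarrow> x i = y i)"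

end

theory Submission
  imports Defs "HOL-Library.Diagonal_Subsequence"
begin

text \<open>
  The members of \<open>iter_perfect I I\<close> are exactly the images of continuous maps \<open>H\<close> such that
  \<open>H x\<close> up to \<open>i\<close> determines and is determined by \<open>x\<close> up to \<open>i\<close>, and such that each fibre
  map \<open>t \<mapsto> H (x(i := t)) i\<close> embeds the binary tree, preserving branching nodes and
  the direction of branching. Given such an image \<open>X\<close>, the inverse of \<open>H\<close> reads off the
  bits of \<open>x i\<close> at the branching levels of its fibre. In these coordinates every splitting step
  just prescribes one more bit, whatever \<open>\<Phi>\<close> is, so that shrinkability says precisely that the
  coordinate map is injective.

  These maps are closed under composition, so subsets of \<open>X\<close> are found by composing \<open>H\<close> with further
  maps, and infinitely many requirements are met by a fusion argument: the \<open>m\<close>-th map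
  leaves alone the first \<open>m\<close> bits of the first \<open>m\<close> coordinates. Capturing is achieved by separating
  the values of \<open>F\<close> on any two patterns of such bits that differ below a coordinate in question;
  this needs only two points that agree off the cone above that coordinate and have different values.
  For the dichotomy, if no such points exist on some smaller set for any \<open>i \<notin> \<xi>\<close>, then a fusion makes
  \<open>F\<close> reducible to the complement of the cone above \<open>i\<close> for one \<open>i \<notin> \<xi>\<close> after another, each before
  any bit of \<open>i\<close> is decided, and by continuity \<open>F\<close> becomes reducible to the intersection \<open>\<xi>\<close>.
\<close>

section \<open>Embeddings of the power and their localization\<close>

text \<open>\<open>I\<close> need not be well-founded. Hence nothing is built by recursion along the
  order, and injectivity on the fibres does not make the whole map injective: along a descending
  sequence of coordinates, let \<open>H x i\<close> be \<open>x i\<close> with the bit 1 put in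
  front if the next lower coordinate starts with 0, and \<open>x i\<close> itself otherwise; then
  all coordinates 000... and all coordinates 100... give the same image. So injectivity is a
  separate clause of \<open>emb\<close>, the counterpart of shrinkability, and infinitely many
  coordinates are handled through finite sets and compactness. Fusion meets the obstacle that
  patterns share coordinates: squeezing the points with pattern p also moves points with another
  pattern q wherever q cannot be told apart from p. So two patterns are separated only towards
  points that agree at these coordinates. This is where cones come from: if p and q differ at i,
  they can be told apart on the whole cone above i, so two points with pattern p that agree off the
  cone can both be matched by one point with pattern q.\<close>

definition agree_on :: "'i set \<Rightarrow> nat \<Rightarrow> ('i \<Rightarrow> cantor) \<Rightarrow> ('i \<Rightarrow> cantor) \<Rightarrow> bool" where
  "agree_on J n x y \<longleftrightarrow> (\<forall>i\<in>J. \<forall>k<n. x i k = y i k)"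

lemma agree_onI: "(\<And>i k. i \<in> J \<Longrightarrow> k < n \<Longrightarrow> x i k = y i k) \<Longrightarrow> agree_on J n x y"
  by (simp add: agree_on_def)

lemma agree_onD: "agree_on J n x y \<Longrightarrow> i \<in> J \<Longrightarrow> k < n \<Longrightarrow> x i k = y i k"
  by (simp add: agree_on_def)

lemma agree_on_refl [simp]: "agree_on J n x x"
  by (simp add: agree_on_def)

lemma agree_on_sym: "agree_on J n x y \<Longrightarrow> agree_on J n y x"
  by (simp add: agree_on_def)

lemma agree_on_trans: "agree_on J n x y \<Longrightarrow> agree_on J n y z \<Longrightarrow> agree_on J n x z"
  by (simp add: agree_on_def)

text \<open>\<open>l\<close> is the level at which the range branches once the first
  \<open>n\<close> bits of \<open>t\<close> are given. The bit found there is \<open>t' n\<close>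
  itself and not a renaming, because \<open>split_half\<close> selects by the actual bit.\<close>

definition tree_embedding :: "(cantor \<Rightarrow> cantor) \<Rightarrow> bool" where
  "tree_embedding f \<longleftrightarrow>
     (\<forall>t n. \<exists>l. \<forall>t'. (\<forall>k<n. t' k = t k) \<longrightarrow> (\<forall>k<l. f t' k = f t k) \<and> f t' l = t' n)"

lemma tree_embedding_id: "tree_embedding (\<lambda>t. t)"
  unfolding tree_embedding_def by blast

lemma tree_embeddingE:
  assumes "tree_embedding f"
  obtains l where "\<And>t' k. \<forall>k<n. t' k = t k \<Longrightarrow> k < l \<Longrightarrow> f t' k = f t k"
    and "\<And>t'. \<forall>k<n. t' k = t k \<Longrightarrow> f t' l = t' n"
proof -
  from assms have "\<exists>l. \<forall>t'. (\<forall>k<n. t' k = t k) \<longrightarrow> (\<forall>k<l. f t' k = f t k) \<and> f t' l = t' n"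
    unfolding tree_embedding_def by (elim allE)
  then obtain l where l: "\<forall>t'. (\<forall>k<n. t' k = t k) \<longrightarrow> (\<forall>k<l. f t' k = f t k) \<and> f t' l = t' n" ..
  show thesis
  proof (rule that)
    fix t' :: cantor and k assume *: "\<forall>k<n. t' k = t k"
    show "f t' l = t' n" using l * by blast
    show "f t' k = f t k" if "k < l" using l * that by blast
  qed
qed

lemma tree_embeddingI:
  assumes "\<And>t n. \<exists>l. \<forall>t'. (\<forall>k<n. t' k = t k) \<longrightarrow> (\<forall>k<l. f t' k = f t k) \<and> f t' l = t' n"
  shows "tree_embedding f"
  unfolding tree_embedding_def by (intro allI assms)

lemma tree_embedding_comp:
  assumes "tree_embedding f" "tree_embedding g"
  shows "tree_embedding (\<lambda>t. f (g t))"
proof (rule tree_embeddingI)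
  fix t n
  obtain l where l: "\<And>t' k. \<forall>k<n. t' k = t k \<Longrightarrow> k < l \<Longrightarrow> g t' k = g t k"
      "\<And>t'. \<forall>k<n. t' k = t k \<Longrightarrow> g t' l = t' n"
    by (rule tree_embeddingE[OF assms(2), of n t]) blast
  obtain l2 where l2: "\<And>t' k. \<forall>k<l. t' k = g t k \<Longrightarrow> k < l2 \<Longrightarrow> f t' k = f (g t) k"
      "\<And>t'. \<forall>k<l. t' k = g t k \<Longrightarrow> f t' l2 = t' l"
    by (rule tree_embeddingE[OF assms(1), of l "g t"]) blast
  show "\<exists>l2. \<forall>t'. (\<forall>k<n. t' k = t k) \<longrightarrow>
      (\<forall>k<l2. f (g t') k = f (g t) k) \<and> f (g t') l2 = t' n"
  proof (intro exI allI impI conjI)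
    fix t' :: cantor and k assume *: "\<forall>k<n. t' k = t k"
    have g: "\<forall>k<l. g t' k = g t k" using l(1)[OF *] by blast
    show "f (g t') k = f (g t) k" if "k < l2" using l2(1)[OF g that] .
    show "f (g t') l2 = t' n" using l2(2)[OF g] l(2)[OF *] by (simp only:)
  qed
qed

lemma first_difference:
  fixes s t :: cantor
  assumes "s \<noteq> t"
  obtains n where "s n \<noteq> t n" "\<forall>k<n. s k = t k"
proof
  obtain n0 where "s n0 \<noteq> t n0" using assms by auto
  then show "s (LEAST n. s n \<noteq> t n) \<noteq> t (LEAST n. s n \<noteq> t n)" by (rule LeastI)
  show "\<forall>k<(LEAST n. s n \<noteq> t n). s k = t k"
    using not_less_Least by blast
qed

section \<open>Prescribing finitely many leading bits\<close>

definition shift :: "'i set \<Rightarrow> nat \<Rightarrow> ('i \<Rightarrow> cantor) \<Rightarrow> ('i \<Rightarrow> cantor)" where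
  "shift J m x i = (if i \<in> J then (\<lambda>k. x i (k + m)) else x i)"

text \<open>Parametrizes the points that have the first \<open>m\<close> bits of \<open>p\<close> on
  \<open>J\<close>; on these points \<open>shift J m\<close> is the inverse.\<close>

definition unshift :: "'i set \<Rightarrow> nat \<Rightarrow> ('i \<Rightarrow> cantor) \<Rightarrow> ('i \<Rightarrow> cantor) \<Rightarrow> ('i \<Rightarrow> cantor)" where
  "unshift J m p x i = (if i \<in> J then (\<lambda>k. if k < m then p i k else x i (k - m)) else x i)"

lemma agree_on_unshift: "agree_on J m (unshift J m p x) p"
  by (simp add: agree_on_def unshift_def)

lemma unshift_outside: "i \<notin> J \<Longrightarrow> unshift J m p x i = x i"
  by (simp add: unshift_def)

lemma unshift_cong: "x i = y i \<Longrightarrow> unshift J m p x i = unshift J m p y i"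
  by (simp add: unshift_def)

lemma shift_cong: "x i = y i \<Longrightarrow> shift J m x i = shift J m y i"
  by (simp add: shift_def)

lemma unshift_inject: "unshift J m p x i = unshift J m p y i \<Longrightarrow> x i = y i"
  by (auto simp: unshift_def fun_eq_iff split: if_splits)

text \<open>The effect of \<open>localize\<close> on one coordinate: the identity off the cylinder
  of \<open>p\<close>, a copy of \<open>f\<close> inside it. The first \<open>m\<close> bits are
  \<open>t k\<close> in both branches; the conditional keeps the shape in which
  \<open>localize\<close> unfolds. Bit \<open>n\<close> stays at level \<open>n\<close> unless
  \<open>n \<ge> m\<close> and \<open>t\<close> lies in the cylinder; then it moves to the level of
  bit \<open>n - m\<close> under \<open>f\<close>, plus \<open>m\<close>.\<close>

lemma tree_embedding_prefix:
  assumes "tree_embedding f"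
  shows "tree_embedding (\<lambda>t k. if k < m then if \<forall>k<m. t k = p k then p k else t k
                           else if \<forall>k<m. t k = p k then f (\<lambda>k. t (k + m)) (k - m) else t k)"
    (is "tree_embedding ?g")
proof (rule tree_embeddingI)
  fix t :: cantor and n
  show "\<exists>l. \<forall>t'. (\<forall>k<n. t' k = t k) \<longrightarrow> (\<forall>k<l. ?g t' k = ?g t k) \<and> ?g t' l = t' n"
  proof (cases "n \<ge> m \<and> (\<forall>k<m. t k = p k)")
    case False
    have "(\<forall>k<n. ?g t' k = ?g t k) \<and> ?g t' n = t' n" if "\<forall>k<n. t' k = t k" for t'
    proof (cases "n < m")
      case True
      then show ?thesis using that by auto
    next
      case nm: False
      then have "\<not> (\<forall>k<m. t k = p k)" using False by auto
      moreover have "\<not> (\<forall>k<m. t' k = p k)" using nm that calculation by (metis leI order_less_le_trans)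
      ultimately show ?thesis using that by (simp only: if_False if_cancel)
    qed
    then show ?thesis by blast
  next
    case True
    obtain l where l: "\<And>t' k. \<forall>k<n-m. t' k = t (k + m) \<Longrightarrow> k < l \<Longrightarrow> f t' k = f (\<lambda>k. t (k + m)) k"
        "\<And>t'. \<forall>k<n-m. t' k = t (k + m) \<Longrightarrow> f t' l = t' (n - m)"
      by (rule tree_embeddingE[OF assms, of "n - m" "\<lambda>k. t (k + m)"]) blast
    have "(\<forall>k<l+m. ?g t' k = ?g t k) \<and> ?g t' (l + m) = t' n" if "\<forall>k<n. t' k = t k" for t'
    proof -
      have p: "\<forall>k<m. t' k = p k" using that True by auto
      have *: "\<forall>k<n-m. t' (k + m) = t (k + m)" using that by auto
      have "f (\<lambda>k. t' (k + m)) k = f (\<lambda>k. t (k + m)) k" if "k < l" for k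
        using l(1)[OF * that] .
      moreover have "f (\<lambda>k. t' (k + m)) l = t' n"
        using l(2)[OF *] True by simp
      ultimately show ?thesis using p True by (auto simp: less_diff_conv2)
    qed
    then show ?thesis by blast
  qed
qed

section \<open>Finite windows of bits and sequential compactness\<close>

locale countable_order =
  fixes I :: "'i::order set"
  assumes countable_I: "countable I"
begin

text \<open>One number bounds both the coordinates and the bits, so that the relations
  \<open>near n\<close> generate the product uniformity and every modulus of continuity is a natural
  number.\<close>

definition lvl :: "nat \<Rightarrow> 'i set" where
  "lvl n = {i \<in> I. to_nat_on I i < n}"

abbreviation near :: "nat \<Rightarrow> ('i \<Rightarrow> cantor) \<Rightarrow> ('i \<Rightarrow> cantor) \<Rightarrow> bool" where
  "near n \<equiv> agree_on (lvl n) n"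

lemma finite_lvl: "finite (lvl n)"
proof (rule finite_imageD)
  show "finite (to_nat_on I ` lvl n)"
    by (rule finite_subset[of _ "{..<n}"]) (auto simp: lvl_def)
  show "inj_on (to_nat_on I) (lvl n)"
    using inj_on_to_nat_on[OF countable_I] by (rule inj_on_subset) (auto simp: lvl_def)
qed

lemma lvl_subset: "lvl n \<subseteq> I"
  by (auto simp: lvl_def)

lemma lvl_mono: "m \<le> n \<Longrightarrow> lvl m \<subseteq> lvl n"
  by (auto simp: lvl_def)

lemma near_mono: "m \<le> n \<Longrightarrow> near n x y \<Longrightarrow> near m x y"
  using lvl_mono by (fastforce simp: agree_on_def)

lemma finite_subset_lvl:
  assumes "finite J" "J \<subseteq> I"
  shows "\<exists>n. J \<subseteq> lvl n"
proof -
  obtain n where "\<forall>i\<in>J. to_nat_on I i < n"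
    using assms(1) finite_nat_set_iff_bounded[of "to_nat_on I ` J"] by auto
  then show ?thesis using assms(2) by (auto simp: lvl_def)
qed

lemma near_agree_on:
  assumes "finite J" "J \<subseteq> I"
  shows "\<exists>n\<ge>m. \<forall>x y. near n x y \<longrightarrow> agree_on J m x y"
proof -
  obtain n where n: "J \<subseteq> lvl n" using finite_subset_lvl[OF assms] by blast
  have "J \<subseteq> lvl (max m n)" using n lvl_mono[of n "max m n"] by auto
  then show ?thesis
    by (intro exI[of _ "max m n"]) (force simp: agree_on_def)
qed

lemma near_all_eq: "(\<And>n. near n x y) \<Longrightarrow> i \<in> I \<Longrightarrow> x i = y i"
proof
  fix k assume n: "\<And>n. near n x y" and i: "i \<in> I"
  have "i \<in> lvl (Suc (max k (to_nat_on I i)))" using i by (auto simp: lvl_def)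
  then show "x i k = y i k"
    using n[of "Suc (max k (to_nat_on I i))"] by (auto simp: agree_on_def)
qed

lemma near_eq: "(\<And>i. i \<in> I \<Longrightarrow> x i = y i) \<Longrightarrow> near n x y"
  by (auto simp: agree_on_def lvl_def)

text \<open>Sequential compactness by a diagonal argument: each single bit takes some value
  infinitely often, hence is constant along a subsequence, and there are only countably many
  bits.\<close>

lemma convergent_subseq:
  fixes y :: "nat \<Rightarrow> 'i \<Rightarrow> cantor"
  shows "\<exists>y0 r. strict_mono (r :: nat \<Rightarrow> nat) \<and> (\<forall>m. \<exists>N. \<forall>n\<ge>N. near m (y (r n)) y0)"
proof -
  \<comment> \<open>The code \<open>c\<close> stands for one bit: bit \<open>k\<close> of the
    coordinate with number \<open>p\<close>.\<close>
  define b where "b c n = (case prod_decode c of (p, k) \<Rightarrow> y n (from_nat_into I p) k)" for c n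
  interpret subseqs "\<lambda>c s. \<exists>v. \<forall>p. b c (s p) = v"
  proof
    fix c and s :: "nat \<Rightarrow> nat" assume "strict_mono s"
    have "\<exists>v. infinite {n. b c (s n) = v}"
    proof (rule ccontr)
      assume "\<not> ?thesis"
      then have "finite (\<Union>v. {n. b c (s n) = v})" by (intro finite_UN_I) auto
      moreover have "(\<Union>v. {n. b c (s n) = v}) = UNIV" by auto
      ultimately show False by (simp only: infinite_UNIV_nat)
    qed
    then obtain v where v: "infinite {n. b c (s n) = v}" by blast
    obtain r :: "nat \<Rightarrow> nat" where "strict_mono r" "\<forall>n. r n \<in> {n. b c (s n) = v}"
      using infinite_enumerate[OF v] by blast
    then have "\<forall>p. b c ((s \<circ> r) p) = v" by simp
    then show "\<exists>r'::nat \<Rightarrow> nat. strict_mono r' \<and> (\<exists>v. \<forall>p. b c ((s \<circ> r') p) = v)"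
      using \<open>strict_mono r\<close> by blast
  qed
  have const: "b c (diagseq n) = b c (diagseq (Suc c))" if "n \<ge> Suc c" for c n
  proof -
    have "\<exists>v. \<forall>p. b c ((diagseq \<circ> (+) (Suc c)) p) = v"
    proof (rule diagseq_holds)
      fix c and r s :: "nat \<Rightarrow> nat"
      assume "\<exists>v. \<forall>p. b c (s p) = v"
      then obtain v where "\<forall>p. b c (s p) = v" ..
      then have "\<forall>p. b c ((s \<circ> r) p) = v" by simp
      then show "\<exists>v. \<forall>p. b c ((s \<circ> r) p) = v" ..
    qed
    then obtain v where "\<forall>p. b c ((diagseq \<circ> (+) (Suc c)) p) = v" ..
    then have v: "b c (diagseq (Suc c + p)) = v" for p by simp
    show ?thesis using v[of "n - Suc c"] v[of 0] that by simp
  qed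
  define y0 where "y0 i k = b (prod_encode (to_nat_on I i, k))
      (diagseq (Suc (prod_encode (to_nat_on I i, k))))" for i k
  have "\<exists>N. \<forall>n\<ge>N. near m (y (diagseq n)) y0" for m
  proof -
    \<comment> \<open>The added 0 keeps \<open>Max\<close> meaningful when the window is
      empty.\<close>
    define N where "N = Suc (Max ((\<lambda>(i, k). prod_encode (to_nat_on I i, k)) ` (lvl m \<times> {..<m}) \<union> {0}))"
    have fin: "finite ((\<lambda>(i, k). prod_encode (to_nat_on I i, k)) ` (lvl m \<times> {..<m}) \<union> {0})"
      using finite_lvl by auto
    have "y (diagseq n) i k = y0 i k" if "n \<ge> N" "i \<in> lvl m" "k < m" for n i k
    proof -
      have "prod_encode (to_nat_on I i, k) \<le> Max ((\<lambda>(i, k). prod_encode (to_nat_on I i, k)) ` (lvl m \<times> {..<m}) \<union> {0})"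
        by (rule Max_ge[OF fin]) (use that in force)
      then have "n \<ge> Suc (prod_encode (to_nat_on I i, k))" using that unfolding N_def by linarith
      from const[OF this] show ?thesis
        using that lvl_subset countable_I unfolding y0_def b_def by (auto simp: subset_iff)
    qed
    then show ?thesis by (auto simp: agree_on_def)
  qed
  then show ?thesis using subseq_diagseq by blast
qed

text \<open>
  The maps whose images are the members of \<open>iter_perfect I I\<close>, see \<open>iter_perfect_iff\<close>. They are
  total functions; values outside \<open>I\<close> are irrelevant.
\<close>

definition emb :: "(('i \<Rightarrow> cantor) \<Rightarrow> ('i \<Rightarrow> cantor)) \<Rightarrow> bool" where
  "emb H \<longleftrightarrow>
     (\<forall>m. \<exists>n. \<forall>x y. near n x y \<longrightarrow> near m (H x) (H y)) \<and>
     (\<forall>i\<in>I. \<forall>x y. (\<forall>j\<in>I. j \<le> i \<longrightarrow> x j = y j) \<longrightarrow> H x i = H y i) \<and>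
     (\<forall>i\<in>I. \<forall>x y. (\<forall>j\<in>I. j \<le> i \<longrightarrow> H x j = H y j) \<longrightarrow> x i = y i) \<and>
     (\<forall>i\<in>I. \<forall>x. tree_embedding (\<lambda>t. H (x(i := t)) i))"

lemma emb_cont: "emb H \<Longrightarrow> \<exists>n. \<forall>x y. near n x y \<longrightarrow> near m (H x) (H y)"
  by (elim emb_def[THEN iffD1, THEN conjunct1, rule_format])

lemma emb_cong:
  assumes "emb H" "i \<in> I" "\<And>j. j \<in> I \<Longrightarrow> j \<le> i \<Longrightarrow> x j = y j"
  shows "H x i = H y i"
  by (rule assms(1)[unfolded emb_def, THEN conjunct2, THEN conjunct1, rule_format, OF assms(2)])
    (rule assms(3))

lemma emb_inj:
  assumes "emb H" "i \<in> I" "\<And>j. j \<in> I \<Longrightarrow> j \<le> i \<Longrightarrow> H x j = H y j"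
  shows "x i = y i"
  by (rule assms(1)[unfolded emb_def, THEN conjunct2, THEN conjunct2, THEN conjunct1, rule_format,
        OF assms(2)])
    (rule assms(3))

lemma emb_tree: "emb H \<Longrightarrow> i \<in> I \<Longrightarrow> tree_embedding (\<lambda>t. H (x(i := t)) i)"
  by (elim emb_def[THEN iffD1, THEN conjunct2, THEN conjunct2, THEN conjunct2, rule_format])

lemma embI:
  assumes "\<And>m. \<exists>n. \<forall>x y. near n x y \<longrightarrow> near m (H x) (H y)"
    and "\<And>i x y. i \<in> I \<Longrightarrow> (\<And>j. j \<in> I \<Longrightarrow> j \<le> i \<Longrightarrow> x j = y j) \<Longrightarrow> H x i = H y i"
    and "\<And>i x y. i \<in> I \<Longrightarrow> (\<And>j. j \<in> I \<Longrightarrow> j \<le> i \<Longrightarrow> H x j = H y j) \<Longrightarrow> x i = y i"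
    and "\<And>i x. i \<in> I \<Longrightarrow> tree_embedding (\<lambda>t. H (x(i := t)) i)"
  shows "emb H"
  unfolding emb_def
proof (intro conjI ballI allI impI)
  show "\<exists>n. \<forall>x y. near n x y \<longrightarrow> near m (H x) (H y)" for m
    by (rule assms(1))
  show "H x i = H y i" if "i \<in> I" "\<forall>j\<in>I. j \<le> i \<longrightarrow> x j = y j" for i x y
    by (rule assms(2)) (use that in auto)
  show "x i = y i" if "i \<in> I" "\<forall>j\<in>I. j \<le> i \<longrightarrow> H x j = H y j" for i x y
    by (rule assms(3)) (use that in auto)
  show "tree_embedding (\<lambda>t. H (x(i := t)) i)" if "i \<in> I" for i x
    using that by (rule assms(4))
qed

lemma emb_id: "emb (\<lambda>x. x)"
  by (rule embI) (auto simp: tree_embedding_id)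

lemma emb_comp:
  assumes H: "emb H" and G: "emb G"
  shows "emb (\<lambda>x. H (G x))"
proof (rule embI)
  fix m
  show "\<exists>n. \<forall>x y. near n x y \<longrightarrow> near m (H (G x)) (H (G y))"
  proof -
    obtain n where n: "\<And>x y. near n x y \<Longrightarrow> near m (H x) (H y)"
      using emb_cont[OF H, of m] by blast
    obtain n' where "\<And>x y. near n' x y \<Longrightarrow> near n (G x) (G y)"
      using emb_cont[OF G, of n] by blast
    then show ?thesis using n by blast
  qed
next
  fix i and x y :: "'i \<Rightarrow> cantor" assume i: "i \<in> I" and eq: "\<And>j. j \<in> I \<Longrightarrow> j \<le> i \<Longrightarrow> x j = y j"
  have "G x j = G y j" if "j \<in> I" "j \<le> i" for j
    by (rule emb_cong[OF G that(1)]) (use eq that(2) order_trans in blast)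
  then show "H (G x) i = H (G y) i"
    by (rule emb_cong[OF H i])
next
  fix i and x y :: "'i \<Rightarrow> cantor" assume i: "i \<in> I" and eq: "\<And>j. j \<in> I \<Longrightarrow> j \<le> i \<Longrightarrow> H (G x) j = H (G y) j"
  have "G x j = G y j" if "j \<in> I" "j \<le> i" for j
    by (rule emb_inj[OF H that(1)]) (use eq that(2) order_trans in blast)
  then show "x i = y i"
    by (rule emb_inj[OF G i])
next
  fix i and x :: "'i \<Rightarrow> cantor" assume i: "i \<in> I"
  \<comment> \<open>Among the coordinates up to \<open>i\<close>, changing \<open>x i\<close>
    affects \<open>G x\<close> only at \<open>i\<close>. So the fibre map of the composition is a
    composition of fibre maps.\<close>
  have "G (x(i := t)) j = G x j" if "j \<in> I" "j < i" for j t
    by (rule emb_cong[OF G that(1)]) (use that(2) in auto)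
  then have "H (G (x(i := t))) i = H ((G x)(i := G (x(i := t)) i)) i" for t
    by (intro emb_cong[OF H i]) auto
  then show "tree_embedding (\<lambda>t. H (G (x(i := t))) i)"
    using tree_embedding_comp[OF emb_tree[OF H i] emb_tree[OF G i]] by simp
qed

text \<open>
  \<open>localize J m p G\<close> is \<open>G\<close> transported to the set of points whose first \<open>m\<close> bits on \<open>J\<close> are
  those of \<open>p\<close>. At a point outside this set it still acts on those coordinates below which the point
  cannot be told apart from \<open>p\<close>, as it must in order to respect restrictions.
\<close>

definition follows :: "'i set \<Rightarrow> nat \<Rightarrow> ('i \<Rightarrow> cantor) \<Rightarrow> ('i \<Rightarrow> cantor) \<Rightarrow> 'i \<Rightarrow> bool" where
  "follows J m p x i \<longleftrightarrow> agree_on {j\<in>J. j \<le> i} m x p"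

definition localize ::
    "'i set \<Rightarrow> nat \<Rightarrow> ('i \<Rightarrow> cantor) \<Rightarrow> (('i \<Rightarrow> cantor) \<Rightarrow> ('i \<Rightarrow> cantor)) \<Rightarrow> ('i \<Rightarrow> cantor) \<Rightarrow> ('i \<Rightarrow> cantor)" where
  "localize J m p G x i = (if follows J m p x i then unshift J m p (G (shift J m x)) i else x i)"

lemma follows_down: "follows J m p x i \<Longrightarrow> j \<le> i \<Longrightarrow> follows J m p x j"
  by (auto simp: follows_def agree_on_def)

lemma localize_fixes: "agree_on J m (localize J m p G x) x"
  by (auto simp: agree_on_def localize_def follows_def unshift_def)

lemma localize_pattern:
  assumes "agree_on J m x p"
  shows "localize J m p G x = unshift J m p (G (shift J m x))"
proof
  fix i
  have "follows J m p x i" 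
    unfolding follows_def by (rule agree_onI, rule agree_onD[OF assms]) simp_all
  then show "localize J m p G x i = unshift J m p (G (shift J m x)) i" by (simp add: localize_def)
qed

text \<open>The guard reads only bits that \<open>localize\<close> leaves alone, so the image of a
  point tells at which coordinates \<open>G\<close> was applied. Injectivity of
  \<open>localize\<close> rests on this.\<close>

lemma follows_localize: "follows J m p (localize J m p G x) i \<longleftrightarrow> follows J m p x i"
proof -
  have "localize J m p G x j k = x j k" if "j \<in> J" "k < m" for j k
    using agree_onD[OF localize_fixes that] .
  then show ?thesis by (auto simp: follows_def agree_on_def)
qed

lemma shift_near: "\<exists>n. \<forall>x y. near n x y \<longrightarrow> near k (shift J m x) (shift J m y)"
proof (intro exI allI impI agree_onI)
  fix x y i l assume xy: "near (k + m) x y" and "i \<in> lvl k" and l: "l < k"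
  then have "i \<in> lvl (k + m)" using lvl_mono[of k "k + m"] by auto
  from agree_onD[OF xy this] show "shift J m x i l = shift J m y i l"
    using l by (simp add: shift_def)
qed

lemma unshift_near: "near n x y \<Longrightarrow> near n (unshift J m p x) (unshift J m p y)"
  by (auto simp: agree_on_def unshift_def)

text \<open>The guard at \<open>i\<close> looks only at coordinates up to \<open>i\<close> and is
  inherited by smaller coordinates. So either everything up to \<open>i\<close> is transported from
  \<open>G\<close>, or the value at \<open>i\<close> is unchanged.\<close>

lemma emb_localize:
  assumes J: "finite J" "J \<subseteq> I" and G: "emb G"
  shows "emb (localize J m p G)"
proof (rule embI)
  fix k
  obtain n1 where n1: "\<And>x y. near n1 x y \<Longrightarrow> near k (G x) (G y)"
    using emb_cont[OF G, of k] by blast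
  obtain n2 where n2: "\<And>x y. near n2 x y \<Longrightarrow> near n1 (shift J m x) (shift J m y)"
    using shift_near[of n1 J m] by blast
  obtain n3 where n3: "\<And>x y. near n3 x y \<Longrightarrow> agree_on J m x y"
    using near_agree_on[OF J, of m] by blast
  define n where "n = max k (max n2 n3)"
  have "near k (localize J m p G x) (localize J m p G y)" if "near n x y" for x y
  proof -
    have nr: "near n2 x y" "near n3 x y" "near k x y"
      using near_mono[OF _ that] unfolding n_def by auto
    have u: "near k (unshift J m p (G (shift J m x))) (unshift J m p (G (shift J m y)))"
      using n1 n2 nr unshift_near by blast
    have "follows J m p x i = follows J m p y i" for i
      using n3[OF nr(2)] by (auto simp: follows_def agree_on_def)
    then show ?thesis
      using u nr(3) by (auto simp: agree_on_def localize_def)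
  qed
  then show "\<exists>n. \<forall>x y. near n x y \<longrightarrow> near k (localize J m p G x) (localize J m p G y)" by blast
next
  fix i and x y :: "'i \<Rightarrow> cantor" assume i: "i \<in> I" and eq: "\<And>j. j \<in> I \<Longrightarrow> j \<le> i \<Longrightarrow> x j = y j"
  have "follows J m p x i = follows J m p y i"
    using eq J(2) by (auto simp: follows_def agree_on_def subset_iff)
  moreover have "G (shift J m x) i = G (shift J m y) i"
    by (rule emb_cong[OF G i]) (auto intro: shift_cong eq)
  ultimately show "localize J m p G x i = localize J m p G y i"
    using eq[OF i] by (simp add: localize_def unshift_def)
next
  fix i and x y :: "'i \<Rightarrow> cantor" assume i: "i \<in> I" and eq: "\<And>j. j \<in> I \<Longrightarrow> j \<le> i \<Longrightarrow> localize J m p G x j = localize J m p G y j"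
  have g: "follows J m p x i = follows J m p y i"
  proof -
    have "follows J m p (localize J m p G x) i = follows J m p (localize J m p G y) i"
      using eq J(2) by (auto simp: follows_def agree_on_def subset_iff)
    then show ?thesis by (simp only: follows_localize)
  qed
  show "x i = y i"
  proof (cases "follows J m p x i")
    case False
    then show ?thesis using g eq[OF i] by (simp add: localize_def)
  next
    case True
    have "G (shift J m x) j = G (shift J m y) j" if "j \<in> I" "j \<le> i" for j
    proof -
      have "follows J m p x j" "follows J m p y j" using True g follows_down that by blast+
      then show ?thesis using eq[OF that] unshift_inject[of J m p] by (metis localize_def)
    qed
    then have "shift J m x i = shift J m y i" by (rule emb_inj[OF G i])
    then have s: "unshift J m p (shift J m x) i = unshift J m p (shift J m y) i" by (rule unshift_cong)
    have "unshift J m p (shift J m x) i = x i" if "follows J m p x i" for x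
      using that by (auto simp: unshift_def shift_def follows_def agree_on_def fun_eq_iff)
    then show ?thesis using s True g by metis
  qed
next
  fix i and x :: "'i \<Rightarrow> cantor" assume i: "i \<in> I"
  let ?x = "\<lambda>t. x(i := t)"
  \<comment> \<open>Three kinds of fibre map: the identity if \<open>p\<close> is already violated
    strictly below \<open>i\<close>; otherwise a localized fibre map of \<open>G\<close> if
    \<open>i \<in> J\<close>, and a plain one if not.\<close>
  show "tree_embedding (\<lambda>t. localize J m p G (?x t) i)"
  proof (cases "agree_on {j\<in>J. j < i} m x p")
    case False
    then have "\<not> follows J m p (?x t) i" for t
      by (auto simp: follows_def agree_on_def)
    then have "localize J m p G (?x t) i = t" for t by (simp add: localize_def)
    then show ?thesis by (simp add: tree_embedding_id)
  next
    case below: True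
    show ?thesis
    proof (cases "i \<in> J")
      case True
      let ?f = "\<lambda>t. G ((shift J m x)(i := t)) i"
      have "follows J m p (?x t) i \<longleftrightarrow> (\<forall>k<m. t k = p i k)" for t
        using below True by (auto simp: follows_def agree_on_def)
      moreover have "shift J m (?x t) = (shift J m x)(i := (\<lambda>k. t (k + m)))" for t
        using True by (auto simp: shift_def fun_eq_iff)
      ultimately have "localize J m p G (?x t) i =
          (\<lambda>k. if k < m then if \<forall>k<m. t k = p i k then p i k else t k
                           else if \<forall>k<m. t k = p i k then ?f (\<lambda>k. t (k + m)) (k - m) else t k)" for t
        using True by (intro ext) (auto simp: localize_def unshift_def)
      then show ?thesis
        using tree_embedding_prefix[OF emb_tree[OF G i], of m "p i" "shift J m x"] by simp
    next
      case False
      have "follows J m p (?x t) i" for t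
        using below False by (auto simp: follows_def agree_on_def)
      moreover have "shift J m (?x t) = (shift J m x)(i := t)" for t
        using False by (auto simp: shift_def fun_eq_iff)
      ultimately have "localize J m p G (?x t) i = G ((shift J m x)(i := t)) i" for t
        using False by (simp add: localize_def unshift_def)
      then show ?thesis using emb_tree[OF G i] by simp
    qed
  qed
qed

lemma emb_unshift:
  assumes "finite J" "J \<subseteq> I"
  shows "emb (unshift J m p)"
proof (rule embI)
  show "\<exists>n. \<forall>x y. near n x y \<longrightarrow> near k (unshift J m p x) (unshift J m p y)" for k
    using unshift_near by blast
next
  fix i and x :: "'i \<Rightarrow> cantor"
  show "tree_embedding (\<lambda>t. unshift J m p (x(i := t)) i)"
  proof (cases "i \<in> J")
    case True
    show ?thesis
    proof (rule tree_embeddingI)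
      fix t :: cantor and n
      show "\<exists>l. \<forall>t'. (\<forall>k<n. t' k = t k) \<longrightarrow>
          (\<forall>k<l. unshift J m p (x(i := t')) i k = unshift J m p (x(i := t)) i k) \<and>
          unshift J m p (x(i := t')) i l = t' n"
        by (rule exI[of _ "n + m"]) (use True in \<open>auto simp: unshift_def\<close>)
    qed
  qed (simp add: unshift_outside tree_embedding_id)
qed (auto intro: unshift_cong unshift_inject)

definition on_coords :: "'i set \<Rightarrow> (('i \<Rightarrow> cantor) \<Rightarrow> ('i \<Rightarrow> cantor)) \<Rightarrow> ('i \<Rightarrow> cantor) \<Rightarrow> ('i \<Rightarrow> cantor)" where
  "on_coords \<eta> G x i = (if i \<in> \<eta> then G x i else x i)"

text \<open>As \<open>\<eta>\<close> is initial, all coordinates below one in \<open>\<eta>\<close>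
  are treated by \<open>G\<close> as well, so injectivity there is inherited from
  \<open>G\<close>.\<close>

lemma emb_on_coords:
  assumes \<eta>: "\<eta> \<in> initial_sets I" and G: "emb G"
  shows "emb (on_coords \<eta> G)"
proof (rule embI)
  fix m
  obtain n where n: "\<And>x y. near n x y \<Longrightarrow> near m (G x) (G y)"
    using emb_cont[OF G, of m] by blast
  have "near m (on_coords \<eta> G x) (on_coords \<eta> G y)" if "near (max m n) x y" for x y
    using n[of x y] near_mono[OF _ that, of m] near_mono[OF _ that, of n]
    by (auto simp: agree_on_def on_coords_def)
  then show "\<exists>n. \<forall>x y. near n x y \<longrightarrow> near m (on_coords \<eta> G x) (on_coords \<eta> G y)" by blast
next
  fix i and x y :: "'i \<Rightarrow> cantor" assume i: "i \<in> I" and eq: "\<And>j. j \<in> I \<Longrightarrow> j \<le> i \<Longrightarrow> x j = y j"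
  then show "on_coords \<eta> G x i = on_coords \<eta> G y i"
    using emb_cong[OF G i, of x y] by (auto simp: on_coords_def)
next
  fix i and x y :: "'i \<Rightarrow> cantor" assume i: "i \<in> I" and eq: "\<And>j. j \<in> I \<Longrightarrow> j \<le> i \<Longrightarrow> on_coords \<eta> G x j = on_coords \<eta> G y j"
  show "x i = y i"
  proof (cases "i \<in> \<eta>")
    case True
    have "G x j = G y j" if "j \<in> I" "j \<le> i" for j
      using eq[OF that] \<eta> that True by (auto simp: on_coords_def initial_sets_def)
    then show ?thesis by (rule emb_inj[OF G i])
  next
    case False
    then show ?thesis using eq[OF i] by (simp add: on_coords_def)
  qed
next
  fix i and x :: "'i \<Rightarrow> cantor" assume i: "i \<in> I"
  show "tree_embedding (\<lambda>t. on_coords \<eta> G (x(i := t)) i)"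
    using emb_tree[OF G i] by (cases "i \<in> \<eta>") (auto simp: on_coords_def tree_embedding_id)
qed

end

section \<open>Fusion\<close>

text \<open>All bits outside the window are \<open>False\<close>, so that each class of points
  agreeing on the window has exactly one representative and a finite \<open>J\<close> gives finitely
  many patterns.\<close>

definition patterns :: "'i set \<Rightarrow> nat \<Rightarrow> ('i \<Rightarrow> cantor) set" where
  "patterns J m = {p. \<forall>i k. p i k \<longrightarrow> i \<in> J \<and> k < m}"

lemma finite_patterns:
  assumes "finite J"
  shows "finite (patterns J m)"
proof (rule inj_on_finite)
  show "inj_on (\<lambda>p. {(i, k). p i k}) (patterns J m)"
    by (rule inj_onI) (auto simp: fun_eq_iff set_eq_iff)
  show "(\<lambda>p. {(i, k). p i k}) ` patterns J m \<subseteq> Pow (J \<times> {..<m})"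
    by (auto simp: patterns_def)
  show "finite (Pow (J \<times> {..<m}))" using assms by simp
qed

lemma pattern_of: "\<exists>p\<in>patterns J m. agree_on J m x p"
  by (rule bexI[of _ "\<lambda>i k. i \<in> J \<and> k < m \<and> x i k"]) (auto simp: patterns_def agree_on_def)

definition depends_on :: "'i set \<Rightarrow> (('i \<Rightarrow> cantor) \<Rightarrow> 'b) \<Rightarrow> bool" where
  "depends_on \<xi> g \<longleftrightarrow> (\<forall>x y. (\<forall>i\<in>\<xi>. x i = y i) \<longrightarrow> g x = g y)"

lemma depends_onD: "depends_on \<xi> g \<Longrightarrow> (\<And>i. i \<in> \<xi> \<Longrightarrow> x i = y i) \<Longrightarrow> g x = g y"
  by (simp add: depends_on_def)

lemma depends_on_Int:
  assumes "depends_on \<xi> g" "depends_on \<eta> g"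
  shows "depends_on (\<xi> \<inter> \<eta>) g"
  unfolding depends_on_def
proof (intro allI impI)
  fix x y :: "'a \<Rightarrow> cantor" assume eq: "\<forall>i\<in>\<xi> \<inter> \<eta>. x i = y i"
  \<comment> \<open>In the full power any two points can be combined: this hybrid agrees with
    \<open>x\<close> on \<open>\<xi>\<close> and with \<open>y\<close> on
    \<open>\<eta>\<close>.\<close>
  define w where "w i = (if i \<in> \<xi> then x i else y i)" for i
  have "g x = g w" by (rule depends_onD[OF assms(1)]) (simp add: w_def)
  also have "g w = g y" by (rule depends_onD[OF assms(2)]) (use eq in \<open>auto simp: w_def\<close>)
  finally show "g x = g y" .
qed

lemma depends_on_INT:
  assumes "finite S" "depends_on A g" "\<And>i. i \<in> S \<Longrightarrow> depends_on (B i) g"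
  shows "depends_on (A \<inter> (\<Inter>i\<in>S. B i)) g"
  using assms(1,3)
proof (induction S)
  case empty
  then show ?case using assms(2) by simp
next
  case (insert i S)
  then have "depends_on ((A \<inter> (\<Inter>i\<in>S. B i)) \<inter> B i) g"
    using depends_on_Int[OF insert.IH] by simp
  moreover have "(A \<inter> (\<Inter>i\<in>S. B i)) \<inter> B i = A \<inter> (\<Inter>i\<in>insert i S. B i)" by auto
  ultimately show ?case by simp
qed

context countable_order
begin

definition stable :: "nat \<Rightarrow> (('i \<Rightarrow> cantor) \<Rightarrow> ('i \<Rightarrow> cantor)) \<Rightarrow> bool" where
  "stable m G \<longleftrightarrow> (\<forall>x. near m (G x) x)"

lemma stableD: "stable m G \<Longrightarrow> near m (G x) x"
  by (simp add: stable_def)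

lemma stable_id: "stable m (\<lambda>x. x)"
  by (simp add: stable_def)

lemma stable_comp: "stable m G \<Longrightarrow> stable m G' \<Longrightarrow> stable m (\<lambda>x. G (G' x))"
  unfolding stable_def by (blast intro: agree_on_trans)

lemma stable_mono: "m \<le> n \<Longrightarrow> stable n G \<Longrightarrow> stable m G"
  unfolding stable_def by (blast intro: near_mono)

text \<open>Finitely many requirements \<open>Q r\<close> are met one after the other. The later
  maps are stable, so \<open>keep\<close> protects what has been achieved; \<open>C\<close> is the
  side condition that each step uses and restores.\<close>

lemma finite_stages:
  assumes "finite R" "emb H" "C H"
    and step: "\<And>r H. r \<in> R \<Longrightarrow> emb H \<Longrightarrow> C H \<Longrightarrow>
      \<exists>G. emb G \<and> stable m G \<and> C (\<lambda>x. H (G x)) \<and> Q r (\<lambda>x. H (G x))"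
    and keep: "\<And>r H G. Q r H \<Longrightarrow> emb G \<Longrightarrow> stable m G \<Longrightarrow> Q r (\<lambda>x. H (G x))"
  shows "\<exists>G. emb G \<and> stable m G \<and> C (\<lambda>x. H (G x)) \<and> (\<forall>r\<in>R. Q r (\<lambda>x. H (G x)))"
  using assms(1) step
proof (induction R)
  case empty
  then show ?case using assms(3) emb_id stable_id by (intro exI[of _ "\<lambda>x. x"]) auto
next
  case (insert r R)
  obtain G where G: "emb G" "stable m G" "C (\<lambda>x. H (G x))" "\<forall>r\<in>R. Q r (\<lambda>x. H (G x))"
    using insert by blast
  have "emb (\<lambda>x. H (G x))" using assms(2) G(1) by (rule emb_comp)
  then obtain G' where G': "emb G'" "stable m G'" "C (\<lambda>x. H (G (G' x)))" "Q r (\<lambda>x. H (G (G' x)))"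
    using insert.prems[of r "\<lambda>x. H (G x)"] G(3) by auto
  have "\<forall>r\<in>insert r R. Q r (\<lambda>x. H (G (G' x)))"
    using G(4) G'(4) keep[OF _ G'(1,2), of _ "\<lambda>x. H (G x)"] by simp
  then show ?case
    using G' emb_comp[OF G(1) G'(1)] stable_comp[OF G(2) G'(2)]
    by (intro exI[of _ "\<lambda>x. G (G' x)"]) simp
qed

text \<open>The coordinatewise form matters for \<open>separate_patterns\<close>: \<open>v\<close>
  need not have the whole pattern \<open>p\<close>, only its part up to \<open>i\<close>. The centre
  is \<open>shift J m x\<close> since the localized map acts behind the first \<open>m\<close>
  bits.\<close>

lemma target_follows:
  assumes "agree_on J m x p" "follows J m p v i" "i \<in> lvl N" "k < N"
  shows "localize J m p (unshift (lvl N) N (shift J m x)) v i k = x i k"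
proof (cases "i \<in> J \<and> k < m")
  case True
  then show ?thesis using assms agree_onD[OF assms(1), of i k] by (simp add: localize_def unshift_def)
next
  case False
  then show ?thesis using assms(2-) by (auto simp: localize_def unshift_def shift_def)
qed

lemma target:
  assumes "agree_on J m x p" "agree_on J m w p"
  shows "near N (localize J m p (unshift (lvl N) N (shift J m x)) w) x"
proof (rule agree_onI)
  fix i k assume "i \<in> lvl N" "k < N"
  moreover have "follows J m p w i"
    unfolding follows_def by (rule agree_onI, rule agree_onD[OF assms(2)]) simp_all
  ultimately show "localize J m p (unshift (lvl N) N (shift J m x)) w i k = x i k"
    using target_follows[OF assms(1)] by blast
qed

lemma emb_target: "finite J \<Longrightarrow> J \<subseteq> I \<Longrightarrow> emb (localize J m p (unshift (lvl N) N y))"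
  by (intro emb_localize emb_unshift finite_lvl lvl_subset)

text \<open>For each of the finitely many patterns \<open>p\<close>, its cylinder is squeezed into a
  neighbourhood of \<open>p\<close> on which the bits of \<open>H\<close> in the window are
  constant. This makes the stages of a fusion converge.\<close>

lemma shrink:
  assumes "emb H"
  shows "\<exists>G. emb G \<and> stable m G \<and> (\<forall>x y. near m x y \<longrightarrow> near m (H (G x)) (H (G y)))"
proof -
  let ?Q = "\<lambda>p H. \<forall>x y. near m x p \<longrightarrow> near m y p \<longrightarrow> near m (H x) (H y)"
  have "\<exists>G. emb G \<and> stable m G \<and> True \<and> (\<forall>p\<in>patterns (lvl m) m. ?Q p (\<lambda>x. H (G x)))"
  proof (rule finite_stages[where C="\<lambda>_. True"])
    show "finite (patterns (lvl m) m)" by (intro finite_patterns finite_lvl)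
  next
    fix p H assume "emb H"
    then obtain N where N: "\<And>x y. near N x y \<Longrightarrow> near m (H x) (H y)"
      using emb_cont[of H m] by blast
    let ?G = "localize (lvl m) m p (unshift (lvl N) N (shift (lvl m) m p))"
    have "near m (H (?G x)) (H (?G y))" if "near m x p" "near m y p" for x y
      using target[OF agree_on_refl that(1)] target[OF agree_on_refl that(2)] N
      by (meson agree_on_sym agree_on_trans)
    then show "\<exists>G. emb G \<and> stable m G \<and> True \<and> ?Q p (\<lambda>x. H (G x))"
      using emb_target[OF finite_lvl lvl_subset] localize_fixes
      by (intro exI[of _ ?G]) (auto simp: stable_def)
  next
    fix p and H G :: "('i \<Rightarrow> cantor) \<Rightarrow> 'i \<Rightarrow> cantor" assume "?Q p H" "stable m G"
    then show "?Q p (\<lambda>x. H (G x))"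
      by (meson agree_on_trans stableD)
  qed (use assms in auto)
  then obtain G where G: "emb G" "stable m G" "\<And>p. p \<in> patterns (lvl m) m \<Longrightarrow> ?Q p (\<lambda>x. H (G x))"
    by blast
  have "near m (H (G x)) (H (G y))" if xy: "near m x y" for x y
  proof -
    obtain p where p: "p \<in> patterns (lvl m) m" "near m y p"
      using pattern_of[of "lvl m" m y] by blast
    then show ?thesis using G(3)[OF p(1)] agree_on_trans[OF xy p(2)] by blast
  qed
  with G(1,2) show ?thesis by blast
qed

text \<open>The limit is not one of the stages, hence the last clause: each of its values is also a
  value of a map with \<open>Inv m\<close>, taken at a point that has moved only outside the window
  \<open>m\<close>. Statements comparing two values pass to the limit in this way.\<close>

lemma fusion:
  assumes "emb H0" "Inv 0 H0"
    and step: "\<And>m H. emb H \<Longrightarrow> Inv m H \<Longrightarrow>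
      \<exists>G. emb G \<and> stable m G \<and> Inv (Suc m) (\<lambda>x. H (G x))"
    and keep: "\<And>m H G. Inv (Suc m) H \<Longrightarrow> emb G \<Longrightarrow> stable m G \<Longrightarrow> Inv (Suc m) (\<lambda>x. H (G x))"
  shows "\<exists>H. emb H \<and>
    (\<forall>m. \<exists>K. emb K \<and> Inv m K \<and> (\<forall>x. \<exists>y. near m y x \<and> (\<forall>i\<in>I. H x i = K y i)))"
proof -
  let ?D = "\<lambda>m H. \<forall>x y. near m x y \<longrightarrow> near m (H x) (H y)"
  have "\<exists>Hs. \<forall>m. (emb (Hs m) \<and> Inv m (Hs m)) \<and>
      (\<exists>G. emb G \<and> stable m G \<and> Hs (Suc m) = (\<lambda>x. Hs m (G x)) \<and> ?D m (Hs (Suc m)))"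
  proof (rule dependent_nat_choice)
    show "\<exists>H. emb H \<and> Inv 0 H" using assms(1,2) by blast
  next
    fix H m assume H: "emb H \<and> Inv m H"
    obtain G where G: "emb G" "stable m G" "Inv (Suc m) (\<lambda>x. H (G x))"
      using step[of H m] H by blast
    have HG: "emb (\<lambda>x. H (G x))" using H G(1) emb_comp by blast
    obtain G' where G': "emb G'" "stable m G'" "?D m (\<lambda>x. H (G (G' x)))"
      using shrink[OF HG, of m] by blast
    have "Inv (Suc m) (\<lambda>x. H (G (G' x)))" "emb (\<lambda>x. H (G (G' x)))"
      using keep[OF G(3) G'(1,2)] emb_comp[OF HG G'(1)] by auto
    moreover have "emb (\<lambda>x. G (G' x))" "stable m (\<lambda>x. G (G' x))"
      using emb_comp[OF G(1) G'(1)] stable_comp[OF G(2) G'(2)] by auto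
    ultimately show "\<exists>H'. (emb H' \<and> Inv (Suc m) H') \<and>
        (\<exists>G. emb G \<and> stable m G \<and> H' = (\<lambda>x. H (G x)) \<and> ?D m H')"
      using G'(3) by (intro exI[of _ "\<lambda>x. H (G (G' x))"] conjI exI[of _ "\<lambda>x. G (G' x)"]) auto
  qed
  then obtain Hs where Hs: "\<And>m. emb (Hs m)" "\<And>m. Inv m (Hs m)"
    and next_stage: "\<And>m. \<exists>G. emb G \<and> stable m G \<and> Hs (Suc m) = (\<lambda>x. Hs m (G x))"
    and diam: "\<And>m x y. near m x y \<Longrightarrow> near m (Hs (Suc m) x) (Hs (Suc m) y)"
    by blast
  have chain: "\<exists>G. stable m G \<and> Hs n = (\<lambda>x. Hs m (G x))" if "m \<le> n" for m n
    using that
  proof (induction n rule: dec_induct)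
    case base
    then show ?case using stable_id by blast
  next
    case (step n)
    then obtain G where G: "stable m G" "Hs n = (\<lambda>x. Hs m (G x))" by blast
    obtain G' where "stable n G'" "Hs (Suc n) = (\<lambda>x. Hs n (G' x))" using next_stage by blast
    then have "stable m (\<lambda>x. G (G' x)) \<and> Hs (Suc n) = (\<lambda>x. Hs m (G (G' x)))"
      using G stable_mono[OF step.hyps(1)] stable_comp by auto
    then show ?case by (intro exI[of _ "\<lambda>x. G (G' x)"])
  qed
  \<comment> \<open>A later stage is \<open>Hs (Suc m)\<close> applied to a point that agrees with
    \<open>x\<close> on the window \<open>m\<close>; by \<open>diam\<close> this does not affect the
    bits of the value in the window.\<close>
  have cauchy: "near m (Hs n x) (Hs (Suc m) x)" if mn: "Suc m \<le> n" for m n x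
  proof -
    obtain G where "stable (Suc m) G" "Hs n = (\<lambda>x. Hs (Suc m) (G x))" using chain[OF mn] by blast
    then show ?thesis using diam near_mono[of m "Suc m"] stableD by auto
  qed
  \<comment> \<open>Bit \<open>k\<close> of coordinate \<open>i\<close> lies in the window of size
    \<open>Suc (max (to_nat_on I i) k)\<close>, which by \<open>cauchy\<close> is settled one stage
    later.\<close>
  define H where "H x i k = Hs (Suc (Suc (max (to_nat_on I i) k))) x i k" for x i k
  have lim: "near m (H x) (Hs n x)" if mn: "Suc m \<le> n" for m n x
  proof (rule agree_onI)
    fix i k assume i: "i \<in> lvl m" and k: "k < m"
    define M where "M = Suc (max (to_nat_on I i) k)"
    have M: "M \<le> m" "i \<in> lvl M" "k < M" using i k by (auto simp: M_def lvl_def)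
    show "H x i k = Hs n x i k"
      using agree_onD[OF cauchy M(2,3), of n x] M(1) mn by (simp add: H_def M_def)
  qed
  \<comment> \<open>The values of the later stages at \<open>x\<close> are values of
    \<open>Hs m\<close> at points near \<open>x\<close>; an accumulation point of these points
    yields the limit value.\<close>
  have point: "\<exists>y. near m y x \<and> (\<forall>i\<in>I. H x i = Hs m y i)" for m x
  proof -
    have "\<forall>n. \<exists>y. near m y x \<and> Hs (m + n) x = Hs m y"
      using chain[of m] stableD by (metis le_add1)
    then obtain ys where ys: "\<And>n. near m (ys n) x" "\<And>n. Hs (m + n) x = Hs m (ys n)" by metis
    obtain y and r :: "nat \<Rightarrow> nat" where r: "strict_mono r" and y: "\<And>l. \<exists>N. \<forall>n\<ge>N. near l (ys (r n)) y"
      using convergent_subseq[of ys] by blast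
    have "near m y x"
      using y[of m] ys(1) by (meson agree_on_sym agree_on_trans order_refl)
    moreover have "near l (H x) (Hs m y)" for l
    proof -
      obtain l' where l': "\<And>x y. near l' x y \<Longrightarrow> near l (Hs m x) (Hs m y)"
        using emb_cont[OF Hs(1), of l m] by blast
      obtain N where N: "\<And>n. n \<ge> N \<Longrightarrow> near l' (ys (r n)) y" using y[of l'] by blast
      define n where "n = max N (Suc l)"
      have "r n \<ge> n" using r by (rule seq_suble)
      then have "near l (H x) (Hs (m + r n) x)" by (intro lim) (simp add: n_def)
      moreover have "near l (Hs (m + r n) x) (Hs m y)"
        unfolding ys(2) by (intro l' N) (simp add: n_def)
      ultimately show ?thesis by (rule agree_on_trans)
    qed
    ultimately show ?thesis using near_all_eq by blast
  qed
  have cong: "H x i = H y i" if i: "i \<in> I" and eq: "\<And>j. j \<in> I \<Longrightarrow> j \<le> i \<Longrightarrow> x j = y j" for i x y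
  proof
    fix k
    show "H x i k = H y i k"
      unfolding H_def by (rule fun_cong, rule emb_cong[OF Hs(1) i], rule eq)
  qed
  have inj: "x i = y i" if i: "i \<in> I" and eq: "\<And>j. j \<in> I \<Longrightarrow> j \<le> i \<Longrightarrow> H x j = H y j" for i x y
  proof
    fix k
    define m where "m = Suc (max (to_nat_on I i) k)"
    have m: "i \<in> lvl m" "k < m" using i by (auto simp: m_def lvl_def)
    obtain x' where x': "near m x' x" "\<forall>i\<in>I. H x i = Hs m x' i" using point by blast
    obtain y' where y': "near m y' y" "\<forall>i\<in>I. H y i = Hs m y' i" using point by blast
    have "x' i = y' i"
      by (rule emb_inj[OF Hs(1) i, of m]) (use eq x'(2) y'(2) in metis)
    then show "x i k = y i k"
      using agree_onD[OF x'(1) m] agree_onD[OF y'(1) m] by metis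
  qed
  have "emb H"
  proof (rule embI)
    fix m
    have "near m (H x) (H y)" if "near m x y" for x y
      using lim[of m "Suc m" x] lim[of m "Suc m" y] diam[OF that]
      by (meson agree_on_sym agree_on_trans order_refl)
    then show "\<exists>n. \<forall>x y. near n x y \<longrightarrow> near m (H x) (H y)" by blast
  next
    fix i and x :: "'i \<Rightarrow> cantor" assume i: "i \<in> I"
    show "tree_embedding (\<lambda>t. H (x(i := t)) i)"
    proof (rule tree_embeddingI)
      fix t :: cantor and n
      let ?h = "\<lambda>K t. K (x(i := t)) i"
      \<comment> \<open>The levels of bit \<open>n\<close> could vary with the stage. So the level
        is taken from the limit: where the values for \<open>t\<close> and for \<open>t\<close> with
        bit \<open>n\<close> flipped first differ. A stage agreeing with \<open>H\<close> up to
        there must have the same level.\<close>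
      define t' where "t' = t(n := \<not> t n)"
      have "?h H t \<noteq> ?h H t'"
      proof
        assume eq: "?h H t = ?h H t'"
        have "H (x(i := t)) j = H (x(i := t')) j" if "j \<in> I" "j \<le> i" for j
        proof (cases "j = i")
          case False
          then show ?thesis using that by (intro cong) auto
        qed (simp add: eq)
        from inj[OF i this] have "t n = t' n" by simp
        then show False by (simp add: t'_def)
      qed
      then obtain l where l: "?h H t l \<noteq> ?h H t' l" "\<forall>k<l. ?h H t k = ?h H t' k"
        by (rule first_difference)
      define m where "m = Suc (max (to_nat_on I i) l)"
      have m: "i \<in> lvl m" using i by (simp add: m_def lvl_def)
      have same: "?h H s k = ?h (Hs (Suc m)) s k" if "k \<le> l" for s k
        using agree_onD[OF lim m, of "Suc m" k] that by (simp add: m_def)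
      obtain l' where l': "\<And>s k. \<forall>k<n. s k = t k \<Longrightarrow> k < l' \<Longrightarrow> ?h (Hs (Suc m)) s k = ?h (Hs (Suc m)) t k"
        "\<And>s. \<forall>k<n. s k = t k \<Longrightarrow> ?h (Hs (Suc m)) s l' = s n"
        using tree_embeddingE[OF emb_tree[OF Hs(1) i], of n t "Suc m" x] by blast
      have t': "\<forall>k<n. t' k = t k" by (simp add: t'_def)
      have "l' = l"
      proof (rule linorder_cases[of l' l])
        assume "l < l'"
        then show ?thesis using l'(1)[OF t', of l] l(1) same[of l] by simp
      next
        assume less: "l' < l"
        have "?h (Hs (Suc m)) t l' = t n" "?h (Hs (Suc m)) t' l' = t' n"
          using l'(2)[of t] l'(2)[OF t'] by simp_all
        then show ?thesis using less l(2) same[of l'] by (auto simp: t'_def)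
      qed simp
      show "\<exists>l. \<forall>s. (\<forall>k<n. s k = t k) \<longrightarrow> (\<forall>k<l. ?h H s k = ?h H t k) \<and> ?h H s l = s n"
      proof (intro exI allI impI conjI)
        fix s :: cantor and k assume s: "\<forall>k<n. s k = t k"
        show "?h H s l = s n" using same[of l s] l'(2)[OF s] \<open>l' = l\<close> by simp
        show "?h H s k = ?h H t k" if "k < l"
          using same[of k s] same[of k t] l'(1)[OF s, of k] that \<open>l' = l\<close> by simp
      qed
    qed
  qed (use cong inj in blast)+
  then show ?thesis
    using Hs point by blast
qed

text \<open>Continuity into a Hausdorff space, in the form in which it is used.\<close>

definition separating :: "(('i \<Rightarrow> cantor) \<Rightarrow> 'b) \<Rightarrow> bool" where
  "separating f \<longleftrightarrow> (\<forall>x y. f x \<noteq> f y \<longrightarrow> (\<exists>N. \<forall>x' y'. near N x' x \<longrightarrow> near N y' y \<longrightarrow> f x' \<noteq> f y'))"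

lemma separating_cong:
  assumes "separating f" "\<And>i. i \<in> I \<Longrightarrow> x i = y i"
  shows "f x = f y"
proof (rule ccontr)
  assume "f x \<noteq> f y"
  then obtain N where "\<And>x' y'. near N x' x \<Longrightarrow> near N y' y \<Longrightarrow> f x' \<noteq> f y'"
    using assms(1) unfolding separating_def by blast
  from this[of x x] near_eq[OF assms(2)] show False by simp
qed

lemma separating_comp:
  assumes f: "separating f" and H: "emb H"
  shows "separating (\<lambda>x. f (H x))"
  unfolding separating_def
proof (intro allI impI)
  fix x y assume "f (H x) \<noteq> f (H y)"
  then obtain N where N: "\<And>x' y'. near N x' (H x) \<Longrightarrow> near N y' (H y) \<Longrightarrow> f x' \<noteq> f y'"
    using f unfolding separating_def by blast
  obtain M where "\<And>x y. near M x y \<Longrightarrow> near N (H x) (H y)"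
    using emb_cont[OF H, of N] by blast
  with N show "\<exists>M. \<forall>x' y'. near M x' x \<longrightarrow> near M y' y \<longrightarrow> f (H x') \<noteq> f (H y')"
    by blast
qed

text \<open>\<open>G1\<close> squeezes the points with pattern \<open>p\<close> towards
  \<open>x\<close>, \<open>G2\<close> those with pattern \<open>q\<close> towards \<open>y\<close>.
  \<open>G1\<close> is applied last and still moves points near \<open>y\<close>, but only where
  \<open>q\<close> follows \<open>p\<close>, and there towards the value of \<open>x\<close>, which
  is that of \<open>y\<close>.\<close>

lemma separate_patterns:
  assumes f: "separating f" and x: "near m x p" and y: "near m y q"
    and eq: "\<And>i. i \<in> I \<Longrightarrow> follows (lvl m) m p q i \<Longrightarrow> x i = y i"
    and neq: "f x \<noteq> f y"
  shows "\<exists>G. emb G \<and> stable m G \<and> (\<forall>x y. near m x p \<longrightarrow> near m y q \<longrightarrow> f (G x) \<noteq> f (G y))"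
proof -
  obtain N where N: "\<And>x' y'. near N x' x \<Longrightarrow> near N y' y \<Longrightarrow> f x' \<noteq> f y'"
    using f neq unfolding separating_def by blast
  let ?J = "lvl m"
  define G1 where "G1 = localize ?J m p (unshift (lvl N) N (shift ?J m x))"
  define G2 where "G2 = localize ?J m q (unshift (lvl N) N (shift ?J m y))"
  have emb: "emb G1" "emb G2"
    unfolding G1_def G2_def by (intro emb_target finite_lvl lvl_subset)+
  have st: "stable m G1" "stable m G2"
    unfolding stable_def G1_def G2_def by (intro allI localize_fixes)+
  have "near N (G1 (G2 w)) x" if "near m w p" for w
  proof -
    have "near m (G2 w) p" using agree_on_trans[OF stableD[OF st(2)] that] .
    then show ?thesis unfolding G1_def by (rule target[OF x])
  qed
  moreover have "near N (G1 (G2 w)) y" if w: "near m w q" for w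
  proof -
    have G2w: "near N (G2 w) y" unfolding G2_def by (rule target[OF y w])
    have q: "near m (G2 w) q" using agree_on_trans[OF stableD[OF st(2)] w] .
    show ?thesis
    proof (rule agree_onI)
      fix i k assume ik: "i \<in> lvl N" "k < N"
      then have i: "i \<in> I" using lvl_subset by blast
      show "G1 (G2 w) i k = y i k"
      proof (cases "follows ?J m p (G2 w) i")
        case True
        then have "follows ?J m p q i"
          unfolding follows_def agree_on_def using agree_onD[OF q] by auto
        then show ?thesis
          using target_follows[OF x True ik] eq[OF i] by (simp add: G1_def)
      next
        case False
        then show ?thesis using agree_onD[OF G2w ik] by (simp add: G1_def localize_def)
      qed
    qed
  qed
  ultimately show ?thesis
    using N emb_comp[OF emb] stable_comp[OF st] by (intro exI[of _ "\<lambda>x. G1 (G2 x)"]) blast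
qed

text \<open>If patterns \<open>p\<close> and \<open>q\<close> differ at \<open>i\<close>, then
  \<open>q\<close> follows \<open>p\<close> nowhere on the cone above \<open>i\<close>, so the two
  points from \<open>hyp\<close> agree wherever \<open>q\<close> follows \<open>p\<close>, and
  \<open>separate_patterns\<close> applies to one of them. \<open>hyp\<close> ranges over all
  \<open>G\<close> because it is used behind the earlier stages and behind the restriction to a
  pattern.\<close>

lemma capturing:
  assumes H0: "emb H0" and f: "separating f" and \<zeta>: "\<zeta> \<subseteq> I"
    and hyp: "\<And>G i. emb G \<Longrightarrow> i \<in> \<zeta> \<Longrightarrow>
      \<exists>x y. (\<forall>j\<in>I. \<not> i \<le> j \<longrightarrow> x j = y j) \<and> f (H0 (G x)) \<noteq> f (H0 (G y))"
  shows "\<exists>H. emb H \<and> (\<forall>x. \<exists>y. \<forall>i\<in>I. H x i = H0 y i) \<and>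
    (\<forall>x y. f (H x) = f (H y) \<longrightarrow> (\<forall>i\<in>\<zeta>. x i = y i))"
proof -
  let ?C = "\<lambda>H. \<exists>G. emb G \<and> H = (\<lambda>x. H0 (G x))"
  \<comment> \<open>The index is shifted: \<open>Inv (Suc m')\<close> concerns the window of size
    \<open>m'\<close>, so that maps stable at \<open>m'\<close> preserve it, and
    \<open>Inv 0\<close> says only that \<open>H\<close> factors through \<open>H0\<close>.\<close>
  define Inv where "Inv m H \<longleftrightarrow> ?C H \<and>
    (\<forall>m' x y. m = Suc m' \<longrightarrow> \<not> agree_on (\<zeta> \<inter> lvl m') m' x y \<longrightarrow> f (H x) \<noteq> f (H y))" for m H
  have C_comp: "?C (\<lambda>x. H (G x))" if "?C H" "emb G" for H G
  proof -
    obtain G0 where "emb G0" "H = (\<lambda>x. H0 (G0 x))" using \<open>?C H\<close> by blast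
    then show ?thesis
      using emb_comp[of G0 G] \<open>emb G\<close> by (intro exI[of _ "\<lambda>x. G0 (G x)"]) simp
  qed
  have step: "\<exists>G. emb G \<and> stable m G \<and> Inv (Suc m) (\<lambda>x. H (G x))" if H: "emb H" "Inv m H" for m H
  proof -
    let ?P = "patterns (lvl m) m"
    let ?R = "{(p, q) \<in> ?P \<times> ?P. \<not> agree_on (\<zeta> \<inter> lvl m) m p q}"
    let ?Q = "\<lambda>(p, q) H. \<forall>x y. near m x p \<longrightarrow> near m y q \<longrightarrow> f (H x) \<noteq> f (H y)"
    have "\<exists>G. emb G \<and> stable m G \<and> ?C (\<lambda>x. H (G x)) \<and> (\<forall>r\<in>?R. ?Q r (\<lambda>x. H (G x)))"
    proof (rule finite_stages[where C="?C"])
      show "finite ?R"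
        by (rule finite_subset[of _ "?P \<times> ?P"]) (auto simp: finite_patterns finite_lvl)
      show "emb H" by fact
      show "?C H" using H(2) by (simp add: Inv_def)
    next
      fix r H assume r: "r \<in> ?R" and H: "emb H" "?C H"
      then obtain p q i k where pq: "r = (p, q)" and i: "i \<in> \<zeta>" "i \<in> lvl m" and k: "k < m" "p i k \<noteq> q i k"
        by (auto simp: agree_on_def)
      \<comment> \<open>Composing with this map gives both points obtained from \<open>hyp\<close>
        the pattern \<open>p\<close>.\<close>
      have un: "emb (unshift (lvl m) m p)" by (intro emb_unshift finite_lvl lvl_subset)
      obtain G where G: "emb G" "(\<lambda>x. H (unshift (lvl m) m p x)) = (\<lambda>x. H0 (G x))"
        using C_comp[OF H(2) un] by blast
      obtain u v where uv: "\<And>j. j \<in> I \<Longrightarrow> \<not> i \<le> j \<Longrightarrow> u j = v j" "f (H0 (G u)) \<noteq> f (H0 (G v))"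
        using hyp[OF G(1) i(1)] by blast
      define x where "x = unshift (lvl m) m p u"
      define x' where "x' = unshift (lvl m) m p v"
      have xp: "near m x p" "near m x' p" unfolding x_def x'_def by (rule agree_on_unshift)+
      have "x j = x' j" if "j \<in> I" "\<not> i \<le> j" for j
        unfolding x_def x'_def by (rule unshift_cong) (rule uv(1)[OF that])
      moreover have bad: "\<not> i \<le> j" if "follows (lvl m) m p q j" for j
        using that i(2) k agree_onD[of "{j' \<in> lvl m. j' \<le> j}" m q p i k] by (auto simp: follows_def)
      ultimately have xx': "x j = x' j" if "j \<in> I" "follows (lvl m) m p q j" for j
        using that by blast
      have fx: "f (H x) \<noteq> f (H x')" using uv(2) G(2) unfolding x_def x'_def by metis
      \<comment> \<open>\<open>y\<close> has the pattern \<open>q\<close> and copies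
        \<open>x\<close>, and thereby \<open>x'\<close>, wherever \<open>q\<close> follows
        \<open>p\<close>. As \<open>f (H x)\<close> and \<open>f (H x')\<close> differ, one of them
        differs from \<open>f (H y)\<close>.\<close>
      define y where "y j = (if follows (lvl m) m p q j then x j else q j)" for j
      have yq: "near m y q"
      proof (rule agree_onI)
        fix j l assume j: "j \<in> lvl m" "l < m"
        show "y j l = q j l"
        proof (cases "follows (lvl m) m p q j")
          case True
          then have "q j l = p j l" using j agree_onD[of "{j' \<in> lvl m. j' \<le> j}" m q p j l] by (auto simp: follows_def)
          then show ?thesis using agree_onD[OF xp(1) j] True by (simp add: y_def)
        qed (simp add: y_def)
      qed
      have "\<exists>x. near m x p \<and> (\<forall>i\<in>I. follows (lvl m) m p q i \<longrightarrow> x i = y i) \<and> f (H x) \<noteq> f (H y)"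
      proof (cases "f (H x) = f (H y)")
        case False
        then show ?thesis using xp(1) by (intro exI[of _ x]) (auto simp: y_def)
      next
        case True
        then show ?thesis using xp(2) xx' fx by (intro exI[of _ x']) (auto simp: y_def)
      qed
      then obtain w where w: "near m w p" "\<And>i. i \<in> I \<Longrightarrow> follows (lvl m) m p q i \<Longrightarrow> w i = y i" "f (H w) \<noteq> f (H y)"
        by blast
      obtain G' where G': "emb G'" "stable m G'"
        "\<forall>x y. near m x p \<longrightarrow> near m y q \<longrightarrow> f (H (G' x)) \<noteq> f (H (G' y))"
        using separate_patterns[OF separating_comp[OF f H(1)] w(1) yq w(2,3)] by blast
      show "\<exists>G. emb G \<and> stable m G \<and> ?C (\<lambda>x. H (G x)) \<and> ?Q r (\<lambda>x. H (G x))"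
        using G' C_comp[OF H(2) G'(1)] pq by (intro exI[of _ G']) simp
    next
      fix r and H G :: "('i \<Rightarrow> cantor) \<Rightarrow> 'i \<Rightarrow> cantor" assume "?Q r H" "stable m G"
      then show "?Q r (\<lambda>x. H (G x))"
        by (auto split: prod.splits intro: agree_on_trans dest: stableD)
    qed
    then obtain G where G: "emb G" "stable m G" "?C (\<lambda>x. H (G x))" "\<And>r. r \<in> ?R \<Longrightarrow> ?Q r (\<lambda>x. H (G x))"
      by blast
    have "f (H (G x)) \<noteq> f (H (G y))" if xy: "\<not> agree_on (\<zeta> \<inter> lvl m) m x y" for x y
    proof -
      obtain p where p: "p \<in> ?P" "near m x p" using pattern_of[of "lvl m" m x] by blast
      obtain q where q: "q \<in> ?P" "near m y q" using pattern_of[of "lvl m" m y] by blast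
      have "\<not> agree_on (\<zeta> \<inter> lvl m) m p q"
        using xy agree_onD[OF p(2)] agree_onD[OF q(2)] by (auto simp: agree_on_def)
      then show ?thesis using G(4)[of "(p, q)"] p q by auto
    qed
    then have "Inv (Suc m) (\<lambda>x. H (G x))" using G(3) unfolding Inv_def by auto
    then show ?thesis using G(1,2) by blast
  qed
  have keep: "Inv (Suc m) (\<lambda>x. H (G x))" if H: "Inv (Suc m) H" and G: "emb G" "stable m G" for m H G
  proof -
    have "f (H (G x)) \<noteq> f (H (G y))" if xy: "\<not> agree_on (\<zeta> \<inter> lvl m) m x y" for x y
    proof -
      have "\<not> agree_on (\<zeta> \<inter> lvl m) m (G x) (G y)"
        using xy agree_onD[OF stableD[OF G(2)]] by (auto simp: agree_on_def)
      then show ?thesis using H by (auto simp: Inv_def)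
    qed
    then show ?thesis using H C_comp[OF _ G(1)] by (auto simp: Inv_def)
  qed
  have "?C H0" using emb_id by (intro exI[of _ "\<lambda>x. x"]) simp
  then have Inv0: "Inv 0 H0" by (simp add: Inv_def)
  have "\<exists>H. emb H \<and>
    (\<forall>m. \<exists>K. emb K \<and> Inv m K \<and> (\<forall>x. \<exists>y. near m y x \<and> (\<forall>i\<in>I. H x i = K y i)))"
    by (rule fusion[where Inv=Inv]) (fact H0 Inv0 step keep)+
  then obtain H where H: "emb H"
    and K: "\<And>m. \<exists>K. emb K \<and> Inv m K \<and> (\<forall>x. \<exists>y. near m y x \<and> (\<forall>i\<in>I. H x i = K y i))"
    by blast
  have "\<exists>y. \<forall>i\<in>I. H x i = H0 y i" for x
  proof -
    obtain K y where "Inv 0 K" "\<forall>i\<in>I. H x i = K y i" using K[of 0] by blast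
    then show ?thesis unfolding Inv_def by metis
  qed
  moreover have "x i = y i" if fxy: "f (H x) = f (H y)" and i: "i \<in> \<zeta>" for x y i
  proof
    fix k
    define m where "m = Suc (max (to_nat_on I i) k)"
    have m: "i \<in> \<zeta> \<inter> lvl m" "i \<in> lvl (Suc m)" "k < m" "k < Suc m" using i \<zeta> by (auto simp: m_def lvl_def)
    obtain K where KH: "Inv (Suc m) K" "\<And>x. \<exists>y. near (Suc m) y x \<and> (\<forall>i\<in>I. H x i = K y i)"
      using K[of "Suc m"] by blast
    obtain x' where x': "near (Suc m) x' x" "\<forall>i\<in>I. H x i = K x' i" using KH(2) by blast
    obtain y' where y': "near (Suc m) y' y" "\<forall>i\<in>I. H y i = K y' i" using KH(2) by blast
    have "f (K x') = f (K y')"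
      using fxy separating_cong[OF f, of "H x" "K x'"] separating_cong[OF f, of "H y" "K y'"] x'(2) y'(2) by metis
    then have "agree_on (\<zeta> \<inter> lvl m) m x' y'" using KH(1) by (auto simp: Inv_def)
    from agree_onD[OF this m(1,3)] show "x i k = y i k"
      using agree_onD[OF x'(1) m(2,4)] agree_onD[OF y'(1) m(2,4)] by simp
  qed
  ultimately show ?thesis using H by blast
qed

section \<open>Making a map reducible to an initial set\<close>

definition not_above :: "'i \<Rightarrow> 'i set" where
  "not_above i = {j \<in> I. \<not> i \<le> j}"

text \<open>Stage \<open>m\<close> treats the element with number \<open>m\<close>, which is not in
  \<open>lvl m\<close>, so its bits are still free. The elements of \<open>lvl m\<close> outside
  \<open>\<xi>\<close> have been treated before; \<open>f\<close> no longer depends on them, so they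
  can stay fixed while other coordinates are thinned out.\<close>

lemma reducing:
  assumes H0: "emb H0" and f: "separating f" and \<xi>: "\<xi> \<in> initial_sets I"
    and hyp: "\<And>G i. emb G \<Longrightarrow> i \<in> I - \<xi> \<Longrightarrow>
      \<exists>G'. emb G' \<and> depends_on (not_above i) (\<lambda>x. f (H0 (G (G' x))))"
  shows "\<exists>H. emb H \<and> (\<forall>x. \<exists>y. \<forall>i\<in>I. H x i = H0 y i) \<and> depends_on \<xi> (\<lambda>x. f (H x))"
proof -
  let ?C = "\<lambda>H. \<exists>G. emb G \<and> H = (\<lambda>x. H0 (G x))"
  define Inv where "Inv m H \<longleftrightarrow> ?C H \<and>
    (\<forall>i\<in>lvl m - \<xi>. depends_on (not_above i) (\<lambda>x. f (H x)))" for m H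
  \<comment> \<open>The coordinates on which \<open>f\<close> may still depend at stage
    \<open>m\<close>. This set contains \<open>\<xi>\<close> and meets \<open>lvl m\<close> only
    inside \<open>\<xi>\<close>, so these sets shrink to \<open>\<xi>\<close>.\<close>
  define \<eta> where "\<eta> m = I \<inter> (\<Inter>i\<in>lvl m - \<xi>. not_above i)" for m
  have C_comp: "?C (\<lambda>x. H (G x))" if "?C H" "emb G" for H G
  proof -
    obtain G0 where "emb G0" "H = (\<lambda>x. H0 (G0 x))" using \<open>?C H\<close> by blast
    then show ?thesis
      using emb_comp[of G0 G] \<open>emb G\<close> by (intro exI[of _ "\<lambda>x. G0 (G x)"]) simp
  qed
  have dep_comp: "depends_on (not_above i) (\<lambda>x. g (G x))"
    if g: "depends_on (not_above i) g" and G: "emb G" for g :: "('i \<Rightarrow> cantor) \<Rightarrow> 'b" and G i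
    unfolding depends_on_def
  proof (intro allI impI)
    fix x y :: "'i \<Rightarrow> cantor" assume eq: "\<forall>j\<in>not_above i. x j = y j"
    show "g (G x) = g (G y)"
    proof (rule depends_onD[OF g])
      fix j assume j: "j \<in> not_above i"
      show "G x j = G y j"
      proof (rule emb_cong[OF G])
        show "j \<in> I" using j by (simp add: not_above_def)
        fix j' assume "j' \<in> I" "j' \<le> j"
        then have "j' \<in> not_above i" using j order_trans by (auto simp: not_above_def)
        then show "x j' = y j'" using eq by blast
      qed
    qed
  qed
  have Inv_comp: "Inv m (\<lambda>x. H (G x))" if "Inv m H" "emb G" for m H G
    using that C_comp dep_comp[of _ "\<lambda>x. f (H x)"] by (auto simp: Inv_def)
  have dep_\<eta>: "depends_on (\<eta> m) (\<lambda>x. f (H x))" if H: "emb H" "Inv m H" for m H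
    unfolding \<eta>_def
  proof (rule depends_on_INT)
    show "finite (lvl m - \<xi>)" using finite_lvl by simp
    show "depends_on I (\<lambda>x. f (H x))"
      unfolding depends_on_def using separating_cong[OF separating_comp[OF f H(1)]] by blast
    show "depends_on (not_above i) (\<lambda>x. f (H x))" if "i \<in> lvl m - \<xi>" for i
      using H(2) that by (auto simp: Inv_def)
  qed
  have \<xi>_above: "j \<in> not_above i" if "j \<in> \<xi>" "i \<in> I - \<xi>" for i j
    using that \<xi> by (auto simp: initial_sets_def not_above_def)
  have \<eta>_initial: "\<eta> m \<in> initial_sets I" for m
    by (auto simp: initial_sets_def \<eta>_def not_above_def intro: order_trans)
  have step: "\<exists>G. emb G \<and> stable m G \<and> Inv (Suc m) (\<lambda>x. H (G x))" if H: "emb H" "Inv m H" for m H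
  proof (cases "\<exists>i\<in>I - \<xi>. to_nat_on I i = m")
    case False
    then have "lvl (Suc m) - \<xi> = lvl m - \<xi>" by (auto simp: lvl_def less_Suc_eq)
    then have "Inv (Suc m) H" using H(2) by (simp add: Inv_def)
    then show ?thesis using emb_id stable_id by (intro exI[of _ "\<lambda>x. x"]) simp
  next
    case True
    then obtain i where i: "i \<in> I - \<xi>" "to_nat_on I i = m" by blast
    then have lvl_Suc: "lvl (Suc m) = insert i (lvl m)"
      using inj_on_to_nat_on[OF countable_I] by (auto simp: lvl_def less_Suc_eq inj_on_def)
    \<comment> \<open>Only these coordinates need a pattern, and they belong to
      \<open>not_above i\<close>. So points agreeing on \<open>not_above i\<close> have the same
      pattern, and the reductions on the single cylinders combine.\<close>
    define J where "J = lvl m \<inter> \<xi>"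
    have J: "finite J" "J \<subseteq> I" "J \<subseteq> \<eta> m"
      using finite_lvl lvl_subset[of m] \<xi>_above by (auto simp: J_def \<eta>_def)
    let ?Q = "\<lambda>p H. \<forall>x y. agree_on J m x p \<longrightarrow> agree_on J m y p \<longrightarrow>
        (\<forall>j\<in>not_above i. x j = y j) \<longrightarrow> f (H x) = f (H y)"
    have "\<exists>G. emb G \<and> stable m G \<and> Inv m (\<lambda>x. H (G x)) \<and> (\<forall>p\<in>patterns J m. ?Q p (\<lambda>x. H (G x)))"
    proof (rule finite_stages[where C="Inv m"])
      show "finite (patterns J m)" using J(1) by (rule finite_patterns)
      show "emb H" "Inv m H" by fact+
    next
      fix p H assume H: "emb H" "Inv m H"
      have un: "emb (unshift J m p)" using J(1,2) by (rule emb_unshift)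
      then obtain G0 where G0: "emb G0" "(\<lambda>x. H (unshift J m p x)) = (\<lambda>x. H0 (G0 x))"
        using C_comp[OF _ un] H(2) by (auto simp: Inv_def)
      obtain G' where G': "emb G'" "depends_on (not_above i) (\<lambda>x. f (H0 (G0 (G' x))))"
        using hyp[OF G0(1) i(1)] by blast
      have HG': "H0 (G0 x) = H (unshift J m p x)" for x using G0(2) by metis
      \<comment> \<open>\<open>G'\<close> may move coordinates of \<open>lvl m\<close> outside
        \<open>\<xi>\<close>, which would destroy stability. Confining it to \<open>\<eta> m\<close>
        prevents this without changing the values of \<open>f\<close>, which depend only on
        \<open>\<eta> m\<close>.\<close>
      let ?G = "localize J m p (on_coords (\<eta> m) G')"
      have embG: "emb ?G" using J(1,2) emb_on_coords[OF \<eta>_initial G'(1)] by (rule emb_localize)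
      have st: "stable m ?G"
        unfolding stable_def
      proof (intro allI agree_onI)
        fix x j k assume j: "j \<in> lvl m" "k < m"
        show "?G x j k = x j k"
        proof (cases "j \<in> \<xi>")
          case True
          then show ?thesis using agree_onD[OF localize_fixes, of j J k m] j by (simp add: J_def)
        next
          case False
          then have "j \<notin> J" "j \<notin> \<eta> m" using j lvl_subset by (auto simp: J_def \<eta>_def not_above_def)
          then show ?thesis by (simp add: localize_def unshift_def on_coords_def shift_def)
        qed
      qed
      have val: "f (H (?G x)) = f (H0 (G0 (G' (shift J m x))))" if "agree_on J m x p" for x
      proof -
        have "f (H (?G x)) = f (H (unshift J m p (on_coords (\<eta> m) G' (shift J m x))))"
          by (simp only: localize_pattern[OF that])
        also have "\<dots> = f (H (unshift J m p (G' (shift J m x))))"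
          by (rule depends_onD[OF dep_\<eta>[OF H]], rule unshift_cong) (simp add: on_coords_def)
        finally show ?thesis by (simp only: HG')
      qed
      have "?Q p (\<lambda>x. H (?G x))"
      proof (intro allI impI)
        fix x y :: "'i \<Rightarrow> cantor" assume xy: "agree_on J m x p" "agree_on J m y p" "\<forall>j\<in>not_above i. x j = y j"
        show "f (H (?G x)) = f (H (?G y))"
          unfolding val[OF xy(1)] val[OF xy(2)]
          by (rule depends_onD[OF G'(2)], rule shift_cong) (use xy(3) in blast)
      qed
      then show "\<exists>G. emb G \<and> stable m G \<and> Inv m (\<lambda>x. H (G x)) \<and> ?Q p (\<lambda>x. H (G x))"
        using embG st Inv_comp[OF H(2) embG] by (intro exI[of _ ?G] conjI)
    next
      fix p and H G :: "('i \<Rightarrow> cantor) \<Rightarrow> 'i \<Rightarrow> cantor"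
      assume Q: "?Q p H" and G: "emb G" "stable m G"
      have JG: "agree_on J m (G x) p" if "agree_on J m x p" for x
        using that agree_onD[OF stableD[OF G(2)]] by (auto simp: agree_on_def J_def)
      show "?Q p (\<lambda>x. H (G x))"
      proof (intro allI impI)
        fix x y :: "'i \<Rightarrow> cantor" assume xy: "agree_on J m x p" "agree_on J m y p" "\<forall>j\<in>not_above i. x j = y j"
        have "G x j = G y j" if j: "j \<in> not_above i" for j
        proof (rule emb_cong[OF G(1)])
          show "j \<in> I" using j by (simp add: not_above_def)
          fix j' assume "j' \<in> I" "j' \<le> j"
          then have "j' \<in> not_above i" using j order_trans by (auto simp: not_above_def)
          then show "x j' = y j'" using xy(3) by blast
        qed
        then show "f (H (G x)) = f (H (G y))" using Q JG xy(1,2) by blast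
      qed
    qed
    then obtain G where G: "emb G" "stable m G" "Inv m (\<lambda>x. H (G x))"
      "\<And>p. p \<in> patterns J m \<Longrightarrow> ?Q p (\<lambda>x. H (G x))"
      by blast
    have "depends_on (not_above i) (\<lambda>x. f (H (G x)))"
      unfolding depends_on_def
    proof (intro allI impI)
      fix x y :: "'i \<Rightarrow> cantor" assume xy: "\<forall>j\<in>not_above i. x j = y j"
      obtain p where p: "p \<in> patterns J m" "agree_on J m x p" using pattern_of[of J m x] by blast
      have "x j = y j" if "j \<in> J" for j
        using that xy \<xi>_above[OF _ i(1)] by (auto simp: J_def)
      then have "agree_on J m y p" using p(2) by (auto simp: agree_on_def)
      then show "f (H (G x)) = f (H (G y))" using G(4)[OF p(1)] p(2) xy by blast
    qed
    then have "Inv (Suc m) (\<lambda>x. H (G x))" using G(3) by (auto simp: Inv_def lvl_Suc)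
    then show ?thesis using G(1,2) by blast
  qed
  have keep: "Inv (Suc m) (\<lambda>x. H (G x))" if "Inv (Suc m) H" "emb G" "stable m G" for m H G
    using that(1,2) by (rule Inv_comp)
  have "?C H0" using emb_id by (intro exI[of _ "\<lambda>x. x"]) simp
  then have Inv0: "Inv 0 H0" by (simp add: Inv_def lvl_def)
  have "\<exists>H. emb H \<and>
    (\<forall>m. \<exists>K. emb K \<and> Inv m K \<and> (\<forall>x. \<exists>y. near m y x \<and> (\<forall>i\<in>I. H x i = K y i)))"
    by (rule fusion[where Inv=Inv]) (fact H0 Inv0 step keep)+
  then obtain H where H: "emb H"
    and K: "\<And>m. \<exists>K. emb K \<and> Inv m K \<and> (\<forall>x. \<exists>y. near m y x \<and> (\<forall>i\<in>I. H x i = K y i))"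
    by blast
  have below: "\<exists>y. \<forall>i\<in>I. H x i = H0 y i" for x
  proof -
    obtain K y where "Inv 0 K" "\<forall>i\<in>I. H x i = K y i" using K[of 0] by blast
    then show ?thesis unfolding Inv_def by metis
  qed
  \<comment> \<open>The points at which \<open>K\<close> takes the values \<open>H x\<close> and
    \<open>H y\<close> still agree on \<open>\<eta> m\<close>, because \<open>H x\<close> and
    \<open>H y\<close> agree there and \<open>K\<close> is injective on initial sets.\<close>
  have dep: "depends_on (\<eta> m) (\<lambda>x. f (H x))" for m
    unfolding depends_on_def
  proof (intro allI impI)
    fix x y :: "'i \<Rightarrow> cantor" assume xy: "\<forall>i\<in>\<eta> m. x i = y i"
    obtain K where KH: "emb K" "Inv m K" "\<And>x. \<exists>y. near m y x \<and> (\<forall>i\<in>I. H x i = K y i)"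
      using K[of m] by blast
    obtain x' where x': "\<And>i. i \<in> I \<Longrightarrow> H x i = K x' i" using KH(3) by blast
    obtain y' where y': "\<And>i. i \<in> I \<Longrightarrow> H y i = K y' i" using KH(3) by blast
    have down: "j' \<in> \<eta> m" if "j \<in> \<eta> m" "j' \<in> I" "j' \<le> j" for j j'
      using that \<eta>_initial[of m] by (auto simp: initial_sets_def)
    have \<eta>I: "\<eta> m \<subseteq> I" by (auto simp: \<eta>_def)
    have Hxy: "H x j = H y j" if "j \<in> \<eta> m" for j
      by (rule emb_cong[OF H]) (use that \<eta>I xy down in blast)+
    have "x' j = y' j" if j: "j \<in> \<eta> m" for j
    proof (rule emb_inj[OF KH(1)])
      show "j \<in> I" using j \<eta>I by blast
      fix j' assume "j' \<in> I" "j' \<le> j"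
      then show "K x' j' = K y' j'" using x'[of j'] y'[of j'] Hxy[OF down[OF j]] by metis
    qed
    have "f (H x) = f (K x')" by (rule separating_cong[OF f x'])
    also have "\<dots> = f (K y')" by (rule depends_onD[OF dep_\<eta>[OF KH(1,2)]]) fact
    also have "\<dots> = f (H y)" by (rule separating_cong[OF f y', symmetric])
    finally show "f (H x) = f (H y)" .
  qed
  have "depends_on \<xi> (\<lambda>x. f (H x))"
    unfolding depends_on_def
  proof (intro allI impI, rule ccontr)
    fix x y :: "'i \<Rightarrow> cantor" assume xy: "\<forall>i\<in>\<xi>. x i = y i" and neq: "f (H x) \<noteq> f (H y)"
    obtain N where N: "\<And>x' y'. near N x' x \<Longrightarrow> near N y' y \<Longrightarrow> f (H x') \<noteq> f (H y')"
      using separating_comp[OF f H] neq unfolding separating_def by blast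
    \<comment> \<open>\<open>w\<close> gives the same value as \<open>x\<close> because only
      \<open>\<eta> N\<close> matters, but is close to \<open>y\<close> because
      \<open>\<eta> N\<close> meets the window only inside \<open>\<xi>\<close>.\<close>
    define w where "w i = (if i \<in> \<eta> N then x i else y i)" for i
    have "f (H x) = f (H w)" by (rule depends_onD[OF dep[of N]]) (simp add: w_def)
    moreover have "near N w y"
    proof (rule agree_onI)
      fix i k assume i: "i \<in> lvl N" "k < N"
      show "w i k = y i k"
      proof (cases "i \<in> \<xi>")
        case False
        then have "i \<notin> \<eta> N" using i by (auto simp: \<eta>_def not_above_def)
        then show ?thesis by (simp add: w_def)
      qed (use xy in \<open>simp add: w_def\<close>)
    qed
    ultimately show False using N[OF agree_on_refl, of w] by simp
  qed
  then show ?thesis using H below by blast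
qed

end

section \<open>Perfect subsets of the Cantor space\<close>

lemma open_cantor_iff:
  fixes U :: "cantor set"
  shows "open U \<longleftrightarrow> (\<forall>a\<in>U. \<exists>n. \<forall>b. (\<forall>k<n. b k = a k) \<longrightarrow> b \<in> U)"
proof (intro iffI ballI)
  fix a assume "open U" "a \<in> U"
  then obtain V where V: "finite {k. V k \<noteq> (UNIV :: bool set)}" "a \<in> Pi\<^sub>E UNIV V" "Pi\<^sub>E UNIV V \<subseteq> U"
    by (auto simp: open_fun_def openin_product_topology_alt)
  obtain n where n: "\<And>k. V k \<noteq> UNIV \<Longrightarrow> k < n"
    using V(1) finite_nat_set_iff_bounded by auto
  have "b \<in> U" if b: "\<forall>k<n. b k = a k" for b
  proof -
    have "b k \<in> V k" for k
    proof (cases "k < n")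
      case True
      then show ?thesis using b V(2) by (auto simp: PiE_iff)
    next
      case False
      then show ?thesis using n[of k] by auto
    qed
    then show ?thesis using V(3) by auto
  qed
  then show "\<exists>n. \<forall>b. (\<forall>k<n. b k = a k) \<longrightarrow> b \<in> U" by blast
next
  assume *: "\<forall>a\<in>U. \<exists>n. \<forall>b. (\<forall>k<n. b k = a k) \<longrightarrow> b \<in> U"
  show "open U"
    unfolding open_fun_def openin_product_topology_alt
  proof
    fix a assume "a \<in> U"
    then obtain n where n: "\<And>b. \<forall>k<n. b k = a k \<Longrightarrow> b \<in> U" using * by blast
    define V where "V k = (if k < n then {a k} else UNIV)" for k
    have "{k. V k \<noteq> UNIV} \<subseteq> {..<n}" by (auto simp: V_def)
    then have "finite {k. V k \<noteq> UNIV}" by (rule finite_subset) simp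
    moreover have "Pi\<^sub>E UNIV V \<subseteq> U" by (auto simp: PiE_iff V_def intro!: n split: if_splits)
    moreover have "a \<in> Pi\<^sub>E UNIV V" by (auto simp: V_def)
    ultimately show "\<exists>V. finite {k \<in> UNIV. V k \<noteq> topspace euclidean} \<and>
        (\<forall>k\<in>UNIV. openin euclidean (V k)) \<and> a \<in> Pi\<^sub>E UNIV V \<and> Pi\<^sub>E UNIV V \<subseteq> U"
      by (intro exI[of _ V]) (auto simp: open_discrete)
  qed
qed

lemma open_cylinder: "open {b :: cantor. \<forall>k<n. b k = a k}"
  unfolding open_cantor_iff by (intro ballI exI[of _ n]) auto

lemma compact_cantor: "compact (UNIV :: cantor set)"
proof -
  have "compact_space (product_topology (\<lambda>_. euclidean :: bool topology) (UNIV :: nat set))"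
    by (subst compact_space_product_topology) (auto simp: compact_space_def finite_imp_compact)
  then show ?thesis by (simp add: euclidean_product_topology compact_space_def)
qed

lemma Hausdorff_cantor: "Hausdorff_space (euclidean :: cantor topology)"
  unfolding Hausdorff_space_def
proof (intro allI impI)
  fix x y :: cantor assume "x \<in> topspace euclidean \<and> y \<in> topspace euclidean \<and> x \<noteq> y"
  then obtain n where n: "x n \<noteq> y n" by auto
  let ?C = "\<lambda>a :: cantor. {b :: cantor. \<forall>k<Suc n. b k = a k}"
  have "disjnt (?C x) (?C y)" using n by (auto simp: disjnt_iff)
  then show "\<exists>U V. openin euclidean U \<and> openin euclidean V \<and> x \<in> U \<and> y \<in> V \<and> disjnt U V"
    using open_cylinder[of "Suc n" x] open_cylinder[of "Suc n" y]
    by (intro exI[of _ "?C x"] exI[of _ "?C y"]) simp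
qed

text \<open>Flipping bit \<open>Suc n\<close> changes nothing up to the level of bit
  \<open>n\<close>, so the levels of successive bits strictly increase and the level of bit
  \<open>n\<close> is at least \<open>n\<close>. This yields the modulus of continuity.\<close>

lemma tree_embedding_level:
  assumes "tree_embedding f"
  shows "\<exists>l\<ge>n. \<forall>s. (\<forall>k<n. s k = t k) \<longrightarrow> (\<forall>k<l. f s k = f t k) \<and> f s l = s n"
proof (induction n)
  case 0
  show ?case using assms unfolding tree_embedding_def by blast
next
  case (Suc n)
  then obtain l1 where l1: "l1 \<ge> n" "\<And>s. \<forall>k<n. s k = t k \<Longrightarrow> (\<forall>k<l1. f s k = f t k) \<and> f s l1 = s n"
    by blast
  obtain l2 where l2: "\<And>s k. \<forall>k<Suc n. s k = t k \<Longrightarrow> k < l2 \<Longrightarrow> f s k = f t k"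
    "\<And>s. \<forall>k<Suc n. s k = t k \<Longrightarrow> f s l2 = s (Suc n)"
    by (rule tree_embeddingE[OF assms, of "Suc n" t]) blast
  define s where "s = t(Suc n := \<not> t (Suc n))"
  have s: "\<forall>k<Suc n. s k = t k" and sn: "s (Suc n) \<noteq> t (Suc n)" by (simp_all add: s_def)
  then have "f s k = f t k" if "k \<le> l1" for k
    using l1(2)[of s] l1(2)[of t] that le_less[of k l1] by auto
  moreover have "f s l2 \<noteq> f t l2"
    using l2(2)[OF s] l2(2)[of t] sn by simp
  ultimately have "l2 \<ge> Suc n" using l1(1) by (meson le_trans not_less_eq_eq)
  then show ?case using l2 by (intro exI[of _ l2] conjI allI impI) blast+
qed

lemma tree_embedding_range_perfect:
  assumes f: "tree_embedding f"
  shows "perfect_set (range f)"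
  unfolding perfect_set_def
proof (intro conjI ballI)
  have near: "f s k = f t k" if "\<forall>k<n. s k = t k" "k < n" for s t k n
  proof -
    obtain l where l: "l \<ge> n" "\<And>s. \<forall>k<n. s k = t k \<Longrightarrow> \<forall>k<l. f s k = f t k"
      using tree_embedding_level[OF f, of n t] by blast
    show ?thesis using l(2)[OF that(1)] l(1) that(2) by simp
  qed
  have "continuous_on UNIV f"
    unfolding continuous_on_open_vimage[OF open_UNIV]
  proof (intro allI impI)
    fix B :: "cantor set" assume B: "open B"
    show "open (f -` B \<inter> UNIV)"
      unfolding open_cantor_iff
    proof
      fix t assume "t \<in> f -` B \<inter> UNIV"
      then obtain n where "\<And>b. \<forall>k<n. b k = f t k \<Longrightarrow> b \<in> B"
        using B unfolding open_cantor_iff by blast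
      then have "\<forall>s. (\<forall>k<n. s k = t k) \<longrightarrow> s \<in> f -` B \<inter> UNIV" using near by auto
      then show "\<exists>n. \<forall>s. (\<forall>k<n. s k = t k) \<longrightarrow> s \<in> f -` B \<inter> UNIV" ..
    qed
  qed
  then have "compact (range f)"
    by (rule compact_continuous_image[OF _ compact_cantor])
  then show "closed (range f)"
    using compactin_imp_closedin[OF Hausdorff_cantor, of "range f"] by simp
  show "range f \<noteq> {}" by simp
  fix a assume "a \<in> range f"
  then obtain t where a: "a = f t" by blast
  show "a islimpt range f"
    unfolding islimpt_def
  proof (intro allI impI)
    fix T assume "a \<in> T" "open T"
    then obtain n where n: "\<And>b. \<forall>k<n. b k = a k \<Longrightarrow> b \<in> T" unfolding open_cantor_iff by blast
    define s where "s = t(n := \<not> t n)"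
    obtain l where l: "\<And>s. \<forall>k<n. s k = t k \<Longrightarrow> f s l = s n"
      using tree_embedding_level[OF f, of n t] by blast
    have s: "\<forall>k<n. s k = t k" and sn: "s n \<noteq> t n" by (simp_all add: s_def)
    have "f s l \<noteq> f t l" using l[OF s] l[of t] sn by simp
    then have "f s \<noteq> a" using a by auto
    moreover have "f s \<in> T" by (rule n) (use near[OF s] a in simp)
    ultimately show "\<exists>y\<in>range f. y \<in> T \<and> y \<noteq> a" by blast
  qed
qed

text \<open>
  For a perfect set, \<open>addr A\<close> is the canonical homeomorphism onto the Cantor space:
  it reads off the bits of a point at the levels at which the tree of the set branches.
\<close>

definition branching :: "cantor set \<Rightarrow> cantor \<Rightarrow> nat set" where
  "branching A a = {n. \<exists>b\<in>A. \<exists>c\<in>A. (\<forall>k<n. b k = a k) \<and> (\<forall>k<n. c k = a k) \<and> b n \<noteq> c n}"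

definition addr :: "cantor set \<Rightarrow> cantor \<Rightarrow> cantor" where
  "addr A a k = a (enumerate (branching A a) k)"

section \<open>Enumerating the branching levels\<close>

lemma card_below_enumerate:
  fixes S :: "nat set"
  assumes "infinite S"
  shows "card {k \<in> S. k < enumerate S n} = n"
proof -
  have "{k \<in> S. k < enumerate S n} = enumerate S ` {..<n}"
    using assms enumerate_Ex[OF assms] by (fastforce simp: enumerate_in_set)
  then show ?thesis
    using card_image[OF inj_on_subset[OF inj_enumerate[OF assms] subset_UNIV], of "{..<n}"] by simp
qed

lemma enumerate_card_below:
  fixes S :: "nat set"
  assumes "infinite S" "l \<in> S"
  shows "enumerate S (card {k \<in> S. k < l}) = l"
  using enumerate_Ex[OF assms] card_below_enumerate[OF assms(1)] by auto

lemma enumerate_cong_below: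
  fixes S T :: "nat set"
  assumes "infinite S" "infinite T" and "\<And>l. l \<le> enumerate S n \<Longrightarrow> l \<in> T \<longleftrightarrow> l \<in> S"
  shows "enumerate T n = enumerate S n"
proof -
  let ?l = "enumerate S n"
  have "{k \<in> T. k < ?l} = {k \<in> S. k < ?l}" using assms(3) by auto
  moreover have "?l \<in> T" using assms(3) enumerate_in_set[OF assms(1)] by simp
  ultimately show ?thesis
    using enumerate_card_below[OF assms(2), of ?l] card_below_enumerate[OF assms(1), of n] by simp
qed

lemma enumerate_range:
  fixes f :: "nat \<Rightarrow> nat"
  assumes f: "strict_mono f"
  shows "enumerate (range f) n = f n"
proof -
  have inj: "inj f" using f by (rule strict_mono_imp_inj_on)
  have "{k \<in> range f. k < f n} = f ` {..<n}"
    using strict_mono_less[OF f] by auto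
  then have "card {k \<in> range f. k < f n} = n"
    using card_image[OF inj_on_subset[OF inj subset_UNIV], of "{..<n}"] by simp
  then show ?thesis
    using enumerate_card_below[of "range f" "f n"] range_inj_infinite[OF inj] by simp
qed

lemma branching_cong: "\<forall>k<l. b k = a k \<Longrightarrow> l' \<le> l \<Longrightarrow> l' \<in> branching A b \<longleftrightarrow> l' \<in> branching A a"
  unfolding branching_def by simp

lemma branching_infinite:
  assumes "perfect_set A" "a \<in> A"
  shows "infinite (branching A a)"
  unfolding infinite_nat_iff_unbounded_le
proof
  fix n
  have "a islimpt A" using assms by (simp add: perfect_set_def)
  from this[unfolded islimpt_def, THEN spec, of "{b. \<forall>k<n. b k = a k}"]
  have "\<exists>b\<in>A. b \<in> {b. \<forall>k<n. b k = a k} \<and> b \<noteq> a"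
    using open_cylinder[of n a] by simp
  then obtain b where b: "b \<in> A" "b \<in> {b. \<forall>k<n. b k = a k}" "b \<noteq> a" by blast
  obtain m where m: "b m \<noteq> a m" "\<forall>k<m. b k = a k" using first_difference[OF b(3)] by blast
  then have "n \<le> m" using b(2) not_le by blast
  moreover have "m \<in> branching A a" using m b(1) assms(2) unfolding branching_def by blast
  ultimately show "\<exists>m\<ge>n. m \<in> branching A a" by blast
qed

context
  fixes A :: "cantor set"
  assumes A: "perfect_set A"
begin

lemma enumerate_branching_cong:
  assumes "a \<in> A" "b \<in> A" "\<forall>k<enumerate (branching A a) n. b k = a k"
  shows "enumerate (branching A b) n = enumerate (branching A a) n"
  by (rule enumerate_cong_below)
    (use assms branching_infinite[OF A] branching_cong[OF assms(3)] in auto)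

lemma addr_prefix:
  assumes a: "a \<in> A" and b: "b \<in> A" and ab: "\<forall>k<enumerate (branching A a) n. b k = a k"
  shows "\<forall>k<n. addr A b k = addr A a k" "addr A b n = b (enumerate (branching A a) n)"
proof -
  have inf: "infinite (branching A a)" using branching_infinite[OF A a] .
  show "\<forall>k<n. addr A b k = addr A a k"
  proof (intro allI impI)
    fix k assume k: "k < n"
    then have less: "enumerate (branching A a) k < enumerate (branching A a) n" using inf by simp
    then have "enumerate (branching A b) k = enumerate (branching A a) k"
      using ab by (intro enumerate_branching_cong[OF a b]) auto
    then show "addr A b k = addr A a k" using ab less by (simp add: addr_def)
  qed
  show "addr A b n = b (enumerate (branching A a) n)"
    using enumerate_branching_cong[OF a b ab] by (simp add: addr_def)
qed

text \<open>Two members of \<open>A\<close> first differ at a branching level, and there their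
  addresses differ as well.\<close>

lemma addr_agree:
  assumes a: "a \<in> A" and b: "b \<in> A" and ab: "\<forall>k<n. addr A b k = addr A a k"
  shows "\<forall>k<enumerate (branching A a) n. b k = a k"
proof (rule ccontr)
  assume not: "\<not> ?thesis"
  then obtain k0 where k0: "k0 < enumerate (branching A a) n" "b k0 \<noteq> a k0" by blast
  then have "b \<noteq> a" by auto
  then obtain l where l: "b l \<noteq> a l" "\<forall>k<l. b k = a k" by (rule first_difference)
  have "\<not> k0 < l" using l(2) k0(2) by blast
  then have "l < enumerate (branching A a) n" using k0(1) by simp
  moreover have "l \<in> branching A a" using l a b unfolding branching_def by blast
  then obtain k where k: "enumerate (branching A a) k = l"
    using enumerate_Ex[OF branching_infinite[OF A a]] by blast
  ultimately have "k < n" using branching_infinite[OF A a] by auto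
  moreover have "addr A b k = b l" "addr A a k = a l"
    using addr_prefix(2)[OF a b, of k] addr_prefix(2)[OF a a, of k] l(2) k by simp_all
  ultimately show False using ab l(1) by simp
qed

lemma addr_flip:
  assumes a: "a \<in> A"
  shows "\<exists>b\<in>A. (\<forall>k<n. addr A b k = addr A a k) \<and> addr A b n = e
    \<and> b (enumerate (branching A a) n) = e"
proof -
  let ?l = "enumerate (branching A a) n"
  have "?l \<in> branching A a" using enumerate_in_set[OF branching_infinite[OF A a]] .
  then obtain b where "b \<in> A" "\<forall>k<?l. b k = a k" "b ?l = e"
    unfolding branching_def by (cases e) auto
  then show ?thesis using addr_prefix[OF a, of b n] by blast
qed

lemma addr_approx: "\<exists>a\<in>A. \<forall>k<n. addr A a k = t k"
proof (induction n)
  case 0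
  then show ?case using A by (auto simp: perfect_set_def)
next
  case (Suc n)
  then obtain a where "a \<in> A" "\<forall>k<n. addr A a k = t k" by blast
  then show ?case using addr_flip[of a n "t n"] by (metis less_Suc_eq)
qed

text \<open>The link between splitting and addresses: once \<open>n\<close> address bits are
  prescribed, the stem ends at the next branching level, so \<open>split_half\<close> decides
  exactly address bit \<open>n\<close>.\<close>

lemma stem_length_addr:
  assumes a: "a \<in> A"
  shows "stem_length {b \<in> A. \<forall>k<n. addr A b k = addr A a k} = enumerate (branching A a) n"
    (is "stem_length ?B = ?l")
  unfolding stem_length_def
proof (rule Greatest_equality)
  have "map b [0..<?l] = map a [0..<?l]" if "b \<in> ?B" for b
    using addr_agree[OF a, of b n] that by simp
  then show "\<exists>s. length s = ?l \<and> (\<forall>b\<in>?B. map b [0..<?l] = s)"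
    by (intro exI[of _ "map a [0..<?l]"]) simp
next
  fix l assume "\<exists>s. length s = l \<and> (\<forall>b\<in>?B. map b [0..<l] = s)"
  then obtain s where s: "\<And>b. b \<in> ?B \<Longrightarrow> map b [0..<l] = s" by blast
  show "l \<le> ?l"
  proof (rule ccontr)
    assume "\<not> l \<le> ?l"
    then have in_l: "?l \<in> set [0..<l]" by simp
    obtain b c where b: "b \<in> ?B" "b ?l = True" and c: "c \<in> ?B" "c ?l = False"
      using addr_flip[OF a, of n True] addr_flip[OF a, of n False] by blast
    have "map b [0..<l] = map c [0..<l]" using s[OF b(1)] s[OF c(1)] by simp
    then have "b ?l = c ?l" using in_l by simp
    then show False using b(2) c(2) by simp
  qed
qed

end

text \<open>If \<open>s\<close> and \<open>t\<close> first differ at bit \<open>n\<close>, then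
  \<open>f s\<close> and \<open>f t\<close> first differ at the level of bit \<open>n\<close>. So
  the branching levels along \<open>f t\<close> are the levels of the bits of \<open>t\<close>, and
  the bits found there are those of \<open>t\<close>.\<close>

lemma addr_range:
  assumes f: "tree_embedding f"
  shows "addr (range f) (f t) = t"
proof -
  define lev where "lev n = (SOME l. \<forall>s. (\<forall>k<n. s k = t k) \<longrightarrow> (\<forall>k<l. f s k = f t k) \<and> f s l = s n)" for n
  have lev: "(\<forall>k<lev n. f s k = f t k) \<and> f s (lev n) = s n" if "\<forall>k<n. s k = t k" for n s
  proof -
    have "\<exists>l. \<forall>s. (\<forall>k<n. s k = t k) \<longrightarrow> (\<forall>k<l. f s k = f t k) \<and> f s l = s n"
      using tree_embedding_level[OF f, of n t] by blast
    from someI_ex[OF this] show ?thesis using that unfolding lev_def by blast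
  qed
  define flip where "flip n = t(n := \<not> t n)" for n
  have flip: "\<forall>k<n. flip n k = t k" "flip n n \<noteq> t n" for n by (simp_all add: flip_def)
  have diff: "f (flip n) (lev n) \<noteq> f t (lev n)" for n
    using lev[OF flip(1)] lev[of n t] flip(2) by simp
  have "lev n < lev (Suc n)" for n
  proof (rule ccontr)
    assume le: "\<not> lev n < lev (Suc n)"
    have *: "\<forall>k<n. flip (Suc n) k = t k" "flip (Suc n) n = t n" by (simp_all add: flip_def)
    have "f (flip (Suc n)) k = f t k" if "k \<le> lev n" for k
      using lev[OF *(1)] lev[of n t] *(2) that le_less[of k "lev n"] by metis
    then show False using diff[of "Suc n"] le by simp
  qed
  then have mono: "strict_mono lev" by (simp add: strict_mono_Suc_iff)
  have "branching (range f) (f t) = range lev"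
  proof (intro subset_antisym subsetI)
    fix l assume "l \<in> range lev"
    then obtain n where "l = lev n" by blast
    then show "l \<in> branching (range f) (f t)"
      using lev[OF flip(1), of n] diff[of n] unfolding branching_def by blast
  next
    fix l assume "l \<in> branching (range f) (f t)"
    then obtain s where s: "\<forall>k<l. f s k = f t k" "f s l \<noteq> f t l"
      unfolding branching_def by blast
    then have "s \<noteq> t" by auto
    then obtain n where n: "s n \<noteq> t n" "\<forall>k<n. s k = t k" by (rule first_difference)
    have "f s (lev n) \<noteq> f t (lev n)" using lev[OF n(2)] lev[of n t] n(1) by simp
    then have "\<not> lev n < l" using s(1) by blast
    moreover have "\<not> l < lev n" using lev[OF n(2)] s(2) by blast
    ultimately show "l \<in> range lev" by auto
  qed
  then show ?thesis
    using lev[of _ t] by (auto simp: addr_def enumerate_range[OF mono])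
qed

section \<open>Images of embeddings are iterated perfect sets\<close>

lemma agree_on_mono: "agree_on J n x y \<Longrightarrow> J' \<subseteq> J \<Longrightarrow> n' \<le> n \<Longrightarrow> agree_on J' n' x y"
  unfolding agree_on_def by (meson less_le_trans subsetD)

text \<open>Reduces branching to the question which cylinders \<open>A\<close> meets, the form in
  which it passes to limits of fibres.\<close>

lemma branching_iff:
  "l \<in> branching A a \<longleftrightarrow> (\<forall>e. \<exists>b\<in>A. \<forall>k<Suc l. b k = (a(l := e)) k)"
proof
  assume "l \<in> branching A a"
  then obtain b c where bc: "b \<in> A" "c \<in> A" "\<forall>k<l. b k = a k" "\<forall>k<l. c k = a k" "b l \<noteq> c l"
    unfolding branching_def by blast
  show "\<forall>e. \<exists>b\<in>A. \<forall>k<Suc l. b k = (a(l := e)) k"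
  proof
    fix e
    show "\<exists>b\<in>A. \<forall>k<Suc l. b k = (a(l := e)) k"
    proof (cases "b l = e")
      case True
      then show ?thesis using bc by (intro bexI[of _ b]) (auto simp: less_Suc_eq)
    next
      case False
      then have "c l = e" using bc(5) by auto
      then show ?thesis using bc by (intro bexI[of _ c]) (auto simp: less_Suc_eq)
    qed
  qed
next
  assume *: "\<forall>e. \<exists>b\<in>A. \<forall>k<Suc l. b k = (a(l := e)) k"
  obtain b where b: "b \<in> A" "\<forall>k<Suc l. b k = (a(l := True)) k" using * by blast
  obtain c where c: "c \<in> A" "\<forall>k<Suc l. c k = (a(l := False)) k" using * by blast
  have "\<forall>k<l. b k = a k" "\<forall>k<l. c k = a k" "b l \<noteq> c l" using b(2) c(2) by auto
  then show "l \<in> branching A a" using b(1) c(1) unfolding branching_def by blast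
qed

text \<open>The \<open>m\<close>-th splitting prescribed by \<open>\<Phi>\<close> decides bit number \<open>prior \<Phi> m\<close> of coordinate \<open>\<Phi> m\<close>.\<close>

definition prior :: "(nat \<Rightarrow> 'i) \<Rightarrow> nat \<Rightarrow> nat" where
  "prior \<Phi> m = card {m'. m' < m \<and> \<Phi> m' = \<Phi> m}"

lemma prior_enumerate:
  assumes "infinite {m. \<Phi> m = i}"
  shows "\<Phi> (enumerate {m. \<Phi> m = i} k) = i" "prior \<Phi> (enumerate {m. \<Phi> m = i} k) = k"
proof -
  let ?m = "enumerate {m. \<Phi> m = i} k"
  show m: "\<Phi> ?m = i" using enumerate_in_set[OF assms, of k] by simp
  have "{m'. m' < ?m \<and> \<Phi> m' = \<Phi> ?m} = {m' \<in> {m. \<Phi> m = i}. m' < ?m}" unfolding m by auto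
  then show "prior \<Phi> ?m = k"
    unfolding prior_def using card_below_enumerate[OF assms, of k] by simp
qed

lemma enumerate_prior:
  assumes "infinite {m'. \<Phi> m' = \<Phi> m}"
  shows "enumerate {m'. \<Phi> m' = \<Phi> m} (prior \<Phi> m) = m"
proof -
  have "{m'. m' < m \<and> \<Phi> m' = \<Phi> m} = {k \<in> {m'. \<Phi> m' = \<Phi> m}. k < m}" by auto
  then show ?thesis
    unfolding prior_def using enumerate_card_below[OF assms, of m] by simp
qed

lemma prior_less:
  assumes inf: "infinite {m'. \<Phi> m' = \<Phi> m}" and k: "k < prior \<Phi> m"
  shows "\<exists>m'<m. \<Phi> m' = \<Phi> m \<and> prior \<Phi> m' = k"
proof -
  have "enumerate {m'. \<Phi> m' = \<Phi> m} k < m"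
    using enumerate_mono[OF k inf] enumerate_prior[OF inf] by simp
  then show ?thesis using prior_enumerate[OF inf, of k] by blast
qed

context countable_order
begin

lemma openin_cantor_power:
  assumes A: "A \<subseteq> I"
  shows "openin (cantor_power A) U \<longleftrightarrow>
    U \<subseteq> extensional A \<and> (\<forall>x\<in>U. \<exists>n. \<forall>y\<in>extensional A. agree_on (A \<inter> lvl n) n y x \<longrightarrow> y \<in> U)"
proof (intro iffI conjI ballI)
  assume U: "openin (cantor_power A) U"
  show "U \<subseteq> extensional A"
    using openin_subset[OF U] by (auto simp: cantor_power_def PiE_def)
  fix x assume "x \<in> U"
  then obtain V where V: "finite {i \<in> A. V i \<noteq> (UNIV :: cantor set)}" "\<forall>i\<in>A. open (V i)"
      "x \<in> Pi\<^sub>E A V" "Pi\<^sub>E A V \<subseteq> U"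
    using U unfolding cantor_power_def openin_product_topology_alt by auto
  let ?J = "{i \<in> A. V i \<noteq> UNIV}"
  have "\<forall>i. \<exists>n. i \<in> A \<longrightarrow> (\<forall>b. (\<forall>k<n. b k = x i k) \<longrightarrow> b \<in> V i)"
    using V(2,3) unfolding open_cantor_iff by (metis PiE_mem)
  then obtain d where d: "\<And>i b. i \<in> A \<Longrightarrow> \<forall>k<d i. b k = x i k \<Longrightarrow> b \<in> V i" by metis
  obtain n1 where n1: "?J \<subseteq> lvl n1" using finite_subset_lvl[OF V(1)] A by blast
  obtain n2 where n2: "\<And>i. i \<in> ?J \<Longrightarrow> d i < n2"
    using V(1) finite_nat_set_iff_bounded[of "d ` ?J"] by auto
  define n where "n = max n1 n2"
  have J: "?J \<subseteq> A \<inter> lvl n" using n1 lvl_mono[of n1 n] by (auto simp: n_def)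
  have "y \<in> U" if y: "y \<in> extensional A" "agree_on (A \<inter> lvl n) n y x" for y
  proof -
    have "y i \<in> V i" if i: "i \<in> A" for i
    proof (cases "V i = UNIV")
      case False
      then have "i \<in> A \<inter> lvl n" "d i < n" using i J n2[of i] by (auto simp: n_def)
      then show ?thesis by (intro d[OF i] allI impI agree_onD[OF y(2)]) auto
    qed simp
    then show ?thesis using y(1) V(4) by (auto simp: PiE_def)
  qed
  then show "\<exists>n. \<forall>y\<in>extensional A. agree_on (A \<inter> lvl n) n y x \<longrightarrow> y \<in> U" by blast
next
  assume U: "U \<subseteq> extensional A \<and> (\<forall>x\<in>U. \<exists>n. \<forall>y\<in>extensional A. agree_on (A \<inter> lvl n) n y x \<longrightarrow> y \<in> U)"
  show "openin (cantor_power A) U"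
    unfolding cantor_power_def openin_product_topology_alt
  proof
    fix x assume x: "x \<in> U"
    then obtain n where n: "\<And>y. y \<in> extensional A \<Longrightarrow> agree_on (A \<inter> lvl n) n y x \<Longrightarrow> y \<in> U"
      using U by blast
    define V where "V i = (if i \<in> lvl n then {b :: cantor. \<forall>k<n. b k = x i k} else UNIV)" for i
    have "finite {i \<in> A. V i \<noteq> UNIV}"
      by (rule finite_subset[OF _ finite_lvl[of n]]) (auto simp: V_def)
    moreover have "open (V i)" for i using open_cylinder by (simp add: V_def)
    moreover have "x \<in> Pi\<^sub>E A V" using x U by (auto simp: PiE_def V_def)
    moreover have "Pi\<^sub>E A V \<subseteq> U"
    proof
      fix y assume y: "y \<in> Pi\<^sub>E A V"
      show "y \<in> U"
      proof (rule n)
        show "y \<in> extensional A" using y by (simp add: PiE_def)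
        show "agree_on (A \<inter> lvl n) n y x"
          using y by (intro agree_onI) (force simp: PiE_iff V_def)
      qed
    qed
    ultimately show "\<exists>V. finite {i \<in> A. V i \<noteq> topspace euclidean} \<and>
        (\<forall>i\<in>A. openin euclidean (V i)) \<and> x \<in> Pi\<^sub>E A V \<and> Pi\<^sub>E A V \<subseteq> U"
      by (intro exI[of _ V]) simp
  qed
qed

lemma openin_box:
  assumes "A \<subseteq> I"
  shows "openin (cantor_power A) {y \<in> extensional A. agree_on (A \<inter> lvl n) n y x}"
  unfolding openin_cantor_power[OF assms]
  by (auto intro: agree_on_trans)

definition img :: "(('i \<Rightarrow> cantor) \<Rightarrow> ('i \<Rightarrow> cantor)) \<Rightarrow> ('i \<Rightarrow> cantor) set" where
  "img H = range (\<lambda>x. restrict (H x) I)"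

lemma below_subset: "below I i \<subseteq> I"
  by (auto simp: below_def)

lemma restrict_eq_iff: "restrict x A = restrict y A \<longleftrightarrow> (\<forall>i\<in>A. x i = y i)"
  by (auto simp: restrict_def fun_eq_iff)

lemma Int_below: "I \<inter> below I i = below I i"
  using below_subset by blast

lemma initial_subset: "\<xi> \<in> initial_sets I \<Longrightarrow> \<xi> \<subseteq> I"
  by (simp add: initial_sets_def)

lemma initial_down: "\<xi> \<in> initial_sets I \<Longrightarrow> i \<in> \<xi> \<Longrightarrow> j \<in> I \<Longrightarrow> j \<le> i \<Longrightarrow> j \<in> \<xi>"
  by (auto simp: initial_sets_def)

lemma emb_cong_initial:
  assumes H: "emb H" and \<xi>: "\<xi> \<in> initial_sets I" and xy: "\<forall>i\<in>\<xi>. x i = y i" and i: "i \<in> \<xi>"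
  shows "H x i = H y i"
  by (rule emb_cong[OF H]) (use xy i initial_subset[OF \<xi>] initial_down[OF \<xi> i] in blast)+

lemma emb_inj_initial:
  assumes H: "emb H" and \<xi>: "\<xi> \<in> initial_sets I" and xy: "\<forall>i\<in>\<xi>. H x i = H y i" and i: "i \<in> \<xi>"
  shows "x i = y i"
  by (rule emb_inj[OF H]) (use xy i initial_subset[OF \<xi>] initial_down[OF \<xi> i] in blast)+

lemma below_initial: "below I i \<in> initial_sets I"
  by (auto simp: initial_sets_def below_def)

lemma upto_initial: "{j \<in> I. j \<le> i} \<in> initial_sets I"
  by (auto simp: initial_sets_def)

lemma I_initial: "I \<in> initial_sets I"
  by (auto simp: initial_sets_def)

lemma convergent_subseq2:
  fixes x y :: "nat \<Rightarrow> 'i \<Rightarrow> cantor"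
  obtains x0 y0 and r :: "nat \<Rightarrow> nat" where "strict_mono r"
    "\<And>m. \<exists>N. \<forall>n\<ge>N. near m (x (r n)) x0" "\<And>m. \<exists>N. \<forall>n\<ge>N. near m (y (r n)) y0"
proof -
  obtain x0 and r1 :: "nat \<Rightarrow> nat" where r1: "strict_mono r1" "\<And>m. \<exists>N. \<forall>n\<ge>N. near m (x (r1 n)) x0"
    using convergent_subseq[of x] by blast
  obtain y0 and r2 :: "nat \<Rightarrow> nat" where r2: "strict_mono r2" "\<And>m. \<exists>N. \<forall>n\<ge>N. near m (y (r1 (r2 n))) y0"
    using convergent_subseq[of "\<lambda>n. y (r1 n)"] by blast
  have "\<exists>N. \<forall>n\<ge>N. near m (x (r1 (r2 n))) x0" for m
    using r1(2)[of m] seq_suble[OF r2(1)] by (meson le_trans)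
  moreover have "strict_mono (\<lambda>n. r1 (r2 n))" using strict_mono_o[OF r1(1) r2(1)] by (simp add: o_def)
  ultimately show thesis using that[of "\<lambda>n. r1 (r2 n)" x0 y0] r2(2) by blast
qed

text \<open>On the coordinates in \<open>\<xi>\<close>, \<open>H\<close> induces a continuous
  injection of a compact space, whose inverse is therefore uniformly continuous.\<close>

lemma emb_inverse:
  assumes H: "emb H" and \<xi>: "\<xi> \<in> initial_sets I"
  shows "\<exists>n. \<forall>x y. agree_on (\<xi> \<inter> lvl n) n (H x) (H y) \<longrightarrow> agree_on (\<xi> \<inter> lvl m) m x y"
proof (rule ccontr)
  assume "\<not> ?thesis"
  then have "\<forall>n. \<exists>x y. agree_on (\<xi> \<inter> lvl n) n (H x) (H y) \<and> \<not> agree_on (\<xi> \<inter> lvl m) m x y" by blast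
  then obtain xs ys where s: "\<And>n. agree_on (\<xi> \<inter> lvl n) n (H (xs n)) (H (ys n))"
      "\<And>n. \<not> agree_on (\<xi> \<inter> lvl m) m (xs n) (ys n)"
    by metis
  obtain x y and r :: "nat \<Rightarrow> nat" where r: "strict_mono r"
    and x: "\<And>m. \<exists>N. \<forall>n\<ge>N. near m (xs (r n)) x" and y: "\<And>m. \<exists>N. \<forall>n\<ge>N. near m (ys (r n)) y"
    by (rule convergent_subseq2[of xs ys]) blast
  have Hxy: "agree_on (\<xi> \<inter> lvl l) l (H x) (H y)" for l
  proof -
    obtain l' where l': "\<And>x y. near l' x y \<Longrightarrow> near l (H x) (H y)"
      using emb_cont[OF H, of l] by blast
    obtain N1 where N1: "\<And>n. n \<ge> N1 \<Longrightarrow> near l' (xs (r n)) x" using x[of l'] by blast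
    obtain N2 where N2: "\<And>n. n \<ge> N2 \<Longrightarrow> near l' (ys (r n)) y" using y[of l'] by blast
    define n where "n = max l (max N1 N2)"
    have "l \<le> r n" using seq_suble[OF r, of n] by (simp add: n_def)
    then have "agree_on (\<xi> \<inter> lvl l) l (H (xs (r n))) (H (ys (r n)))"
      using lvl_mono by (intro agree_on_mono[OF s(1)]) blast+
    moreover have "near l (H (xs (r n))) (H x)" "near l (H (ys (r n))) (H y)"
      using N1[of n] N2[of n] l' by (simp_all add: n_def)
    then have "agree_on (\<xi> \<inter> lvl l) l (H (xs (r n))) (H x)" "agree_on (\<xi> \<inter> lvl l) l (H (ys (r n))) (H y)"
      by (auto intro: agree_on_mono)
    ultimately show ?thesis by (meson agree_on_sym agree_on_trans)
  qed
  have "H x i = H y i" if i: "i \<in> \<xi>" for i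
  proof
    fix k
    have "i \<in> \<xi> \<inter> lvl (Suc (max (to_nat_on I i) k))"
      using i initial_subset[OF \<xi>] by (auto simp: lvl_def)
    then show "H x i k = H y i k" using agree_onD[OF Hxy] by auto
  qed
  then have "\<forall>i\<in>\<xi>. x i = y i" using emb_inj_initial[OF H \<xi>] by blast
  then have xy: "agree_on (\<xi> \<inter> lvl m) m x y" by (simp add: agree_on_def)
  obtain N1 where N1: "\<And>n. n \<ge> N1 \<Longrightarrow> near m (xs (r n)) x" using x[of m] by blast
  obtain N2 where N2: "\<And>n. n \<ge> N2 \<Longrightarrow> near m (ys (r n)) y" using y[of m] by blast
  let ?n = "r (max N1 N2)"
  have "near m (xs ?n) x" "near m (ys ?n) y" using N1 N2 by simp_all
  then have "agree_on (\<xi> \<inter> lvl m) m (xs ?n) x" "agree_on (\<xi> \<inter> lvl m) m (ys ?n) y"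
    by (auto intro: agree_on_mono)
  then have "agree_on (\<xi> \<inter> lvl m) m (xs ?n) (ys ?n)" using xy by (meson agree_on_sym agree_on_trans)
  then show False using s(2) by blast
qed

lemma img_subset: "img H \<subseteq> extensional I"
  by (auto simp: img_def)

lemma closedin_img:
  assumes H: "emb H"
  shows "closedin (cantor_power I) (img H)"
proof -
  have top: "topspace (cantor_power I) = extensional I"
    by (simp add: cantor_power_def PiE_def)
  have "\<exists>n. \<forall>y\<in>extensional I. agree_on (I \<inter> lvl n) n y z \<longrightarrow> y \<in> extensional I - img H"
    if z: "z \<in> extensional I - img H" for z
  proof (rule ccontr)
    assume not: "\<not> ?thesis"
    have "\<forall>n. \<exists>x. near n (H x) z"
    proof
      fix n
      obtain y where y: "agree_on (I \<inter> lvl n) n y z" "y \<in> img H" using not by blast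
      then obtain x where "y = restrict (H x) I" by (auto simp: img_def)
      then have "near n (H x) z" using y(1) lvl_subset by (auto simp: agree_on_def)
      then show "\<exists>x. near n (H x) z" by blast
    qed
    then obtain xs where xs: "\<And>n. near n (H (xs n)) z" by metis
    obtain x and r :: "nat \<Rightarrow> nat" where r: "strict_mono r"
      and x: "\<And>m. \<exists>N. \<forall>n\<ge>N. near m (xs (r n)) x"
      using convergent_subseq[of xs] by blast
    have "near l (H x) z" for l
    proof -
      obtain l' where l': "\<And>x y. near l' x y \<Longrightarrow> near l (H x) (H y)"
        using emb_cont[OF H, of l] by blast
      obtain N where N: "\<And>n. n \<ge> N \<Longrightarrow> near l' (xs (r n)) x" using x[of l'] by blast
      define n where "n = max l N"
      have "near l (H (xs (r n))) (H x)" by (intro l' N) (simp add: n_def)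
      moreover have "near l (H (xs (r n))) z"
        by (rule near_mono[OF _ xs]) (use seq_suble[OF r, of n] in \<open>simp add: n_def\<close>)
      ultimately show ?thesis by (meson agree_on_sym agree_on_trans)
    qed
    then have "H x i = z i" if "i \<in> I" for i using near_all_eq that by blast
    then have "restrict (H x) I = z"
      using z by (intro extensionalityI[of _ I]) auto
    then show False using z by (auto simp: img_def)
  qed
  then have "openin (cantor_power I) (extensional I - img H)"
    unfolding openin_cantor_power[OF subset_refl] by blast
  then show ?thesis using img_subset by (simp add: closedin_def top)
qed

text \<open>By injectivity on initial sets, a value that agrees with \<open>H x\<close> below
  \<open>i\<close> comes from a point that agrees with \<open>x\<close> below \<open>i\<close>; only
  coordinate \<open>i\<close> is free.\<close>

lemma fibre_img:
  assumes H: "emb H" and i: "i \<in> I"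
  shows "fibre I (img H) (restrict (H x) (below I i)) i = range (\<lambda>t. H (x(i := t)) i)"
proof (intro subset_antisym subsetI)
  fix b assume "b \<in> fibre I (img H) (restrict (H x) (below I i)) i"
  then obtain y where b: "b = H y i" and y: "restrict (H y) (below I i) = restrict (H x) (below I i)"
    using i by (auto simp: fibre_def img_def Int_below)
  have "\<forall>j\<in>below I i. H y j = H x j" using y unfolding restrict_eq_iff .
  then have yx: "y j = x j" if "j \<in> below I i" for j
    using emb_inj_initial[OF H below_initial _ that] by blast
  have "H y i = H (x(i := y i)) i"
    by (rule emb_cong[OF H i]) (use yx in \<open>auto simp: below_def\<close>)
  then show "b \<in> range (\<lambda>t. H (x(i := t)) i)" using b by blast
next
  fix b assume "b \<in> range (\<lambda>t. H (x(i := t)) i)"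
  then obtain t where b: "b = H (x(i := t)) i" by blast
  have "H (x(i := t)) j = H x j" if "j \<in> below I i" for j
    by (rule emb_cong_initial[OF H below_initial _ that]) (auto simp: below_def)
  then have "restrict (H (x(i := t))) (below I i) = restrict (H x) (below I i)"
    unfolding restrict_eq_iff by blast
  then show "b \<in> fibre I (img H) (restrict (H x) (below I i)) i"
    unfolding fibre_def b using i
    by (intro CollectI exI[of _ "restrict (H (x(i := t))) I"]) (simp add: Int_below img_def)
qed

lemma img_iter_perfect':
  assumes H: "emb H"
  shows "img H \<in> iter_perfect' I I"
  unfolding iter_perfect'_def mem_Collect_eq
proof (intro conjI ballI allI impI)
  show "closedin (cantor_power I) (img H)" using H by (rule closedin_img)
  show "img H \<noteq> {}" by (simp add: img_def)
next
  fix i z assume i: "i \<in> I" and "z \<in> proj_set (img H) (below I i)"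
  then obtain x where "z = restrict (H x) (below I i)"
    by (auto simp: proj_set_def img_def Int_below)
  then show "perfect_set (fibre I (img H) z i)"
    using tree_embedding_range_perfect[OF emb_tree[OF H i]] by (simp add: fibre_img[OF H i])
next
  fix i and G :: "cantor set" assume i: "i \<in> I" and G: "open G"
  let ?B = "below I i"
  let ?S = "{restrict x ?B |x. x \<in> img H \<and> x i \<in> G}"
  show "openin (subtopology (cantor_power ?B) (proj_set (img H) ?B)) ?S"
  proof (subst openin_subopen, intro ballI)
    fix z assume "z \<in> ?S"
    then obtain x0 where z: "z = restrict (H x0) ?B" and x0: "H x0 i \<in> G"
      using i by (auto simp: img_def Int_below)
    obtain n0 where n0: "\<And>b. \<forall>k<n0. b k = H x0 i k \<Longrightarrow> b \<in> G"
      using G x0 unfolding open_cantor_iff by blast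
    define m0 where "m0 = Suc (max n0 (to_nat_on I i))"
    have m0: "i \<in> lvl m0" "n0 \<le> m0" using i by (auto simp: m0_def lvl_def)
    obtain m where m: "\<And>x y. near m x y \<Longrightarrow> near m0 (H x) (H y)"
      using emb_cont[OF H, of m0] by blast
    obtain n where n: "\<And>x y. agree_on (?B \<inter> lvl n) n (H x) (H y) \<Longrightarrow> agree_on (?B \<inter> lvl m) m x y"
      using emb_inverse[OF H below_initial, of i m] by blast
    define W where "W = proj_set (img H) ?B \<inter> {y \<in> extensional ?B. agree_on (?B \<inter> lvl n) n y z}"
    have "openin (subtopology (cantor_power ?B) (proj_set (img H) ?B)) W"
      unfolding W_def by (intro openin_subtopology_Int2 openin_box below_subset)
    moreover have "z \<in> W"
      unfolding W_def z by (auto simp: proj_set_def img_def Int_below intro: image_eqI[of _ _ "restrict (H x0) I"])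
    moreover have "W \<subseteq> ?S"
    proof
      fix w assume w: "w \<in> W"
      then obtain x where x: "w = restrict (H x) ?B"
        by (auto simp: W_def proj_set_def img_def Int_below)
      have "agree_on (?B \<inter> lvl n) n w z" using w by (simp add: W_def)
      then have "agree_on (?B \<inter> lvl n) n (H x) (H x0)" unfolding x z by (auto simp: agree_on_def)
      then have xx0: "agree_on (?B \<inter> lvl m) m x x0" by (rule n)
      \<comment> \<open>The hybrid keeps the given restriction \<open>w\<close> below
        \<open>i\<close> and returns to \<open>x0\<close> elsewhere, also at \<open>i\<close>; being
        near \<open>x0\<close>, it has its value at \<open>i\<close> in \<open>G\<close>.\<close>
      define x' where "x' j = (if j \<in> ?B then x j else x0 j)" for j
      have "near m x' x0"
        by (rule agree_onI) (use agree_onD[OF xx0] in \<open>auto simp: x'_def\<close>)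
      then have "near m0 (H x') (H x0)" by (rule m)
      then have "H x' i \<in> G" using m0 by (intro n0 allI impI, elim agree_onD) auto
      moreover have "H x' j = H x j" if "j \<in> ?B" for j
        by (rule emb_cong_initial[OF H below_initial _ that]) (simp add: x'_def)
      then have "w = restrict (H x') ?B" unfolding x restrict_eq_iff by simp
      ultimately show "w \<in> ?S"
        using i by (intro CollectI exI[of _ "restrict (H x') I"]) (simp add: Int_below img_def)
    qed
    ultimately show "\<exists>W. openin (subtopology (cantor_power ?B) (proj_set (img H) ?B)) W \<and> z \<in> W \<and> W \<subseteq> ?S"
      by blast
  qed
next
  fix \<xi> \<eta> u v
  assume \<xi>: "\<xi> \<in> initial_sets I" and \<eta>: "\<eta> \<in> initial_sets I"
    and "u \<in> proj_set (img H) \<xi>" "v \<in> proj_set (img H) \<eta>"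
    and eq: "restrict u (\<xi> \<inter> \<eta>) = restrict v (\<xi> \<inter> \<eta>)"
  have sub: "\<xi> \<subseteq> I" "\<eta> \<subseteq> I" using \<xi> \<eta> by (auto dest: initial_subset)
  obtain x y where u: "u = restrict (H x) \<xi>" and v: "v = restrict (H y) \<eta>"
    using \<open>u \<in> _\<close> \<open>v \<in> _\<close> sub by (auto simp: proj_set_def img_def Int_absorb1)
  have inter: "\<xi> \<inter> \<eta> \<in> initial_sets I" using \<xi> \<eta> by (auto simp: initial_sets_def)
  have "\<forall>i\<in>\<xi> \<inter> \<eta>. H x i = H y i" using eq unfolding restrict_eq_iff u v by simp
  then have xy: "\<forall>i\<in>\<xi> \<inter> \<eta>. x i = y i" using emb_inj_initial[OF H inter] by blast
  define w where "w i = (if i \<in> \<xi> then x i else y i)" for i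
  have "H w i = H x i" if "i \<in> \<xi>" for i
    by (rule emb_cong_initial[OF H \<xi> _ that]) (simp add: w_def)
  moreover have "H w i = H y i" if "i \<in> \<eta>" for i
    by (rule emb_cong_initial[OF H \<eta> _ that]) (use xy in \<open>simp add: w_def\<close>)
  ultimately have "merge \<xi> \<eta> (u, v) = restrict (H w) (\<xi> \<union> \<eta>)"
    unfolding u v by (auto simp: merge_def fun_eq_iff)
  also have "\<dots> = (\<lambda>x. restrict x (\<xi> \<union> \<eta>)) (restrict (H w) I)" using sub by (simp add: Int_absorb1)
  finally show "merge \<xi> \<eta> (u, v) \<in> proj_set (img H) (\<xi> \<union> \<eta>)"
    unfolding proj_set_def img_def by (elim ssubst) (intro imageI rangeI)
qed

definition coord :: "('i \<Rightarrow> cantor) set \<Rightarrow> ('i \<Rightarrow> cantor) \<Rightarrow> 'i \<Rightarrow> cantor" where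
  "coord X x i = addr (fibre I X (restrict x (below I i)) i) (x i)"

lemma coord_img:
  assumes H: "emb H" and i: "i \<in> I"
  shows "coord (img H) (restrict (H x) I) i = x i"
  using addr_range[OF emb_tree[OF H i], of x "x i"] i
  by (simp add: coord_def Int_below fibre_img[OF H i])

lemma coord_cong:
  assumes "i \<in> I" "\<And>j. j \<in> I \<Longrightarrow> j \<le> i \<Longrightarrow> x j = y j"
  shows "coord X x i = coord X y i"
proof -
  have "restrict x (below I i) = restrict y (below I i)"
    unfolding restrict_eq_iff using assms(2) by (auto simp: below_def)
  then show ?thesis using assms by (simp add: coord_def)
qed

end

section \<open>Coordinates on an iterated perfect set\<close>

context countable_order
begin

context
  fixes X :: "('i \<Rightarrow> cantor) set"
  assumes X: "X \<in> iter_perfect' I I"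
begin

abbreviation fib :: "('i \<Rightarrow> cantor) \<Rightarrow> 'i \<Rightarrow> cantor set" where
  "fib x i \<equiv> fibre I X (restrict x (below I i)) i"

lemma X_closed: "closedin (cantor_power I) X"
  and X_nonempty: "X \<noteq> {}"
  using X by (auto simp: iter_perfect'_def)

lemma X_extensional: "x \<in> X \<Longrightarrow> x \<in> extensional I"
  using closedin_subset[OF X_closed] by (auto simp: cantor_power_def PiE_def)

lemma X_perfect:
  assumes "i \<in> I" "x \<in> X"
  shows "perfect_set (fib x i)"
  using X assms by (auto simp: iter_perfect'_def proj_set_def)

lemma mem_fib: "x \<in> X \<Longrightarrow> x i \<in> fib x i"
  by (auto simp: fibre_def)

lemma X_open:
  assumes "i \<in> I" "open G"
  shows "openin (subtopology (cantor_power (below I i)) (proj_set X (below I i)))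
    {restrict x (below I i) |x. x \<in> X \<and> x i \<in> G}"
  using X assms by (auto simp: iter_perfect'_def)

lemma X_amalgam:
  assumes \<xi>: "\<xi> \<in> initial_sets I" and \<eta>: "\<eta> \<in> initial_sets I" and x: "x \<in> X" and y: "y \<in> X"
    and eq: "\<And>i. i \<in> \<xi> \<Longrightarrow> i \<in> \<eta> \<Longrightarrow> x i = y i"
  obtains w where "w \<in> X" "\<And>i. i \<in> \<xi> \<Longrightarrow> w i = x i" "\<And>i. i \<in> \<eta> \<Longrightarrow> w i = y i"
proof -
  have sub: "\<xi> \<union> \<eta> \<subseteq> I" using \<xi> \<eta> initial_subset by blast
  have mem: "restrict x \<xi> \<in> proj_set X \<xi>" "restrict y \<eta> \<in> proj_set X \<eta>"
    using x y by (auto simp: proj_set_def)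
  have "restrict (restrict x \<xi>) (\<xi> \<inter> \<eta>) = restrict (restrict y \<eta>) (\<xi> \<inter> \<eta>)"
    unfolding restrict_eq_iff using eq by simp
  then have "merge \<xi> \<eta> (restrict x \<xi>, restrict y \<eta>) \<in> proj_set X (\<xi> \<union> \<eta>)"
    by (rule X[unfolded iter_perfect'_def mem_Collect_eq, THEN conjunct2, THEN conjunct2,
          THEN conjunct2, THEN conjunct2, rule_format, OF \<xi> \<eta> sub mem])
  then obtain w where w: "w \<in> X" "merge \<xi> \<eta> (restrict x \<xi>, restrict y \<eta>) = restrict w (\<xi> \<union> \<eta>)"
    by (auto simp: proj_set_def)
  have wi: "merge \<xi> \<eta> (restrict x \<xi>, restrict y \<eta>) i = restrict w (\<xi> \<union> \<eta>) i" for i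
    using w(2) by simp
  show thesis
  proof (rule that[OF w(1)])
    show "w i = x i" if "i \<in> \<xi>" for i using wi[of i] that by (simp add: merge_def)
    show "w i = y i" if "i \<in> \<eta>" for i
      using wi[of i] that eq[of i] by (cases "i \<in> \<xi>") (simp_all add: merge_def)
  qed
qed

lemma not_above_initial: "not_above i \<in> initial_sets I"
  by (auto simp: initial_sets_def not_above_def intro: order_trans)

text \<open>A witness for \<open>b\<close> in the fibre shares with \<open>x\<close> only the
  coordinates below \<open>i\<close>. Amalgamating its part up to \<open>i\<close> with the part of
  \<open>x\<close> off the cone above \<open>i\<close> keeps everything but that cone; the two parts
  overlap exactly below \<open>i\<close>.\<close>

lemma change_coordinate:
  assumes i: "i \<in> I" and x: "x \<in> X" and b: "b \<in> fib x i"
  obtains w where "w \<in> X" "\<And>j. j \<in> not_above i \<Longrightarrow> w j = x j" "w i = b" "fib w i = fib x i"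
proof -
  obtain x' where x': "x' \<in> X" "x' i = b" "restrict x' (below I i) = restrict x (below I i)"
    using b by (auto simp: fibre_def)
  have x'x: "x' j = x j" if "j \<in> below I i" for j
    using x'(3) that unfolding restrict_eq_iff by blast
  obtain w where w: "w \<in> X" "\<And>j. j \<in> {j \<in> I. j \<le> i} \<Longrightarrow> w j = x' j" "\<And>j. j \<in> not_above i \<Longrightarrow> w j = x j"
    by (rule X_amalgam[OF upto_initial not_above_initial x'(1) x, of i i])
      (use x'x in \<open>auto simp: not_above_def below_def less_le\<close>)
  have "restrict w (below I i) = restrict x (below I i)"
    unfolding restrict_eq_iff using w(2) x'x by (auto simp: below_def)
  then show thesis using that[OF w(1,3)] w(2)[of i] x'(2) i by simp
qed

text \<open>The substitute for recursion along \<open>I\<close>: the coordinates of the finite set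
  \<open>J\<close> are adjusted one by one, a maximal one last. Changing coordinate \<open>i\<close>
  affects only addresses on the cone above \<open>i\<close>, which contains no other element of
  \<open>J\<close> and none of \<open>\<xi>\<close>.\<close>

lemma coord_extension:
  assumes "finite J" "J \<subseteq> I" "\<xi> \<in> initial_sets I" "J \<inter> \<xi> = {}" "x \<in> X"
  shows "\<exists>w\<in>X. (\<forall>i\<in>\<xi>. w i = x i) \<and> (\<forall>i\<in>J. \<forall>k<n. coord X w i k = t i k)"
  using assms(1,2,4)
proof (induction J rule: finite_psubset_induct)
  case (psubset J)
  show ?case
  proof (cases "J = {}")
    case True
    then show ?thesis using assms(5) by blast
  next
    case False
    then obtain i where i: "i \<in> J" and max: "\<And>j. j \<in> J \<Longrightarrow> i \<le> j \<Longrightarrow> i = j"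
      using finite_has_maximal[OF psubset.hyps] by blast
    obtain w where w: "w \<in> X" "\<forall>j\<in>\<xi>. w j = x j" "\<forall>j\<in>J - {i}. \<forall>k<n. coord X w j k = t j k"
      using psubset.IH[of "J - {i}"] i psubset.prems by blast
    have iI: "i \<in> I" using i psubset.prems by blast
    obtain b where b: "b \<in> fib w i" "\<forall>k<n. addr (fib w i) b k = t i k"
      using addr_approx[OF X_perfect[OF iI w(1)]] by blast
    obtain v where v: "v \<in> X" "\<And>j. j \<in> not_above i \<Longrightarrow> v j = w j" "v i = b" "fib v i = fib w i"
      by (rule change_coordinate[OF iI w(1) b(1)]) blast
    have "j \<in> not_above i" if "j \<in> \<xi>" for j
      using that i initial_down[OF assms(3) that iI] initial_subset[OF assms(3)] psubset.prems
      by (auto simp: not_above_def)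
    then have "\<forall>j\<in>\<xi>. v j = x j" using v(2) w(2) by simp
    moreover have "coord X v j k = t j k" if j: "j \<in> J" and k: "k < n" for j k
    proof (cases "j = i")
      case True
      then show ?thesis using b(2) v(3,4) k by (simp add: coord_def)
    next
      case False
      then have jna: "j \<in> not_above i" using j max psubset.prems by (auto simp: not_above_def)
      have "coord X v j = coord X w j"
        by (rule coord_cong) (use jna initial_down[OF not_above_initial jna] v(2) in \<open>auto simp: not_above_def\<close>)
      then show ?thesis using w(3) j k False by simp
    qed
    ultimately show ?thesis using v(1) by blast
  qed
qed

text \<open>The point is that earlier splittings at other coordinates do not shrink the fibre at
  \<open>i\<close>: in a node it consists of all members of the fibre of \<open>X\<close> with the
  \<open>n\<close> address bits already decided at \<open>i\<close>. Then
  \<open>stem_length_addr\<close> shows that the next splitting decides bit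
  \<open>n\<close>.\<close>

lemma split_node_eq:
  assumes \<Phi>: "admissible I \<Phi>"
  shows "split_node I X \<Phi> u = {x \<in> X. \<forall>m<length u. coord X x (\<Phi> m) (prior \<Phi> m) = u ! m}"
proof (induction u rule: rev_induct)
  case Nil
  then show ?case by (simp add: split_node_Nil)
next
  case (snoc e u)
  let ?Y = "split_node I X \<Phi> u"
  define i where "i = \<Phi> (length u)"
  define n where "n = prior \<Phi> (length u)"
  have Y: "?Y = {x \<in> X. \<forall>m<length u. coord X x (\<Phi> m) (prior \<Phi> m) = u ! m}" by (rule snoc.IH)
  have \<Phi>I: "\<Phi> m \<in> I" for m using \<Phi> by (auto simp: admissible_def)
  have inf: "infinite {m'. \<Phi> m' = \<Phi> m}" for m using \<Phi> \<Phi>I by (auto simp: admissible_def)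
  have i: "i \<in> I" by (simp add: i_def \<Phi>I)
  have fib_Y: "fibre I ?Y (restrict x (below I i)) i = {b \<in> fib x i. \<forall>k<n. addr (fib x i) b k = coord X x i k}"
    if x: "x \<in> ?Y" for x
  proof (intro subset_antisym subsetI)
    fix b assume "b \<in> fibre I ?Y (restrict x (below I i)) i"
    then obtain x' where x': "x' \<in> ?Y" "x' i = b" "restrict x' (below I i) = restrict x (below I i)"
      by (auto simp: fibre_def)
    have "addr (fib x i) b = coord X x' i" using x'(2,3) by (simp add: coord_def)
    moreover have "coord X x' i k = coord X x i k" if k: "k < n" for k
    proof -
      obtain m' where "m' < length u" "\<Phi> m' = i" "prior \<Phi> m' = k"
        using prior_less[OF inf, of k "length u"] k by (auto simp: n_def i_def)
      then show ?thesis using x x'(1) unfolding Y by auto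
    qed
    moreover have "b \<in> fib x i" using x' unfolding Y by (auto simp: fibre_def)
    ultimately show "b \<in> {b \<in> fib x i. \<forall>k<n. addr (fib x i) b k = coord X x i k}" by simp
  next
    fix b assume b: "b \<in> {b \<in> fib x i. \<forall>k<n. addr (fib x i) b k = coord X x i k}"
    have xX: "x \<in> X" using x by (simp add: Y)
    obtain v where v: "v \<in> X" "\<And>j. j \<in> not_above i \<Longrightarrow> v j = x j" "v i = b" "fib v i = fib x i"
      using b by (auto intro: change_coordinate[OF i xX])
    \<comment> \<open>Putting \<open>b\<close> at coordinate \<open>i\<close> may spoil address bits
      already decided at coordinates above \<open>i\<close>. These are repaired without touching any
      other coordinate; \<open>length u\<close> bits suffice since every \<open>prior\<close> in
      question is smaller.\<close>
    let ?\<xi> = "{j \<in> I. \<not> i < j}"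
    let ?J = "{j \<in> \<Phi> ` {..<length u}. i < j}"
    have \<xi>: "?\<xi> \<in> initial_sets I" by (auto simp: initial_sets_def)
    have J: "finite ?J" "?J \<subseteq> I" "?J \<inter> ?\<xi> = {}" using \<Phi>I by auto
    obtain w where w: "w \<in> X" "\<And>j. j \<in> ?\<xi> \<Longrightarrow> w j = v j"
        "\<And>j k. j \<in> ?J \<Longrightarrow> k < length u \<Longrightarrow> coord X w j k = coord X x j k"
      using coord_extension[OF J(1,2) \<xi> J(3) v(1), of "length u" "coord X x"] by blast
    have w_na: "w j = x j" if "j \<in> not_above i" for j
      using w(2)[of j] v(2)[OF that] that by (auto simp: not_above_def)
    have w_below: "restrict w (below I i) = restrict x (below I i)"
      unfolding restrict_eq_iff using w_na by (auto simp: below_def not_above_def)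
    have wi: "w i = b" using w(2)[of i] v(3) i by simp
    have "coord X w (\<Phi> m) (prior \<Phi> m) = u ! m" if m: "m < length u" for m
    proof -
      have xm: "coord X x (\<Phi> m) (prior \<Phi> m) = u ! m" using x m by (simp add: Y)
      have "prior \<Phi> m \<le> card {..<m}" unfolding prior_def by (rule card_mono) auto
      then have pm: "prior \<Phi> m < length u" using m by simp
      consider "i < \<Phi> m" | "\<Phi> m = i" | "\<Phi> m \<in> not_above i"
        using \<Phi>I by (auto simp: not_above_def less_le)
      then have "coord X w (\<Phi> m) (prior \<Phi> m) = coord X x (\<Phi> m) (prior \<Phi> m)"
      proof cases
        case 1
        then show ?thesis using w(3)[OF _ pm] m by blast
      next
        case 2
        have "{m'. m' < m \<and> \<Phi> m' = \<Phi> m} \<subset> {m'. m' < length u \<and> \<Phi> m' = \<Phi> (length u)}"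
          using m 2 by (auto simp: i_def)
        then have "prior \<Phi> m < n" unfolding prior_def n_def by (intro psubset_card_mono) simp_all
        moreover have "coord X w i = addr (fib x i) b" using w_below wi by (simp add: coord_def)
        ultimately show ?thesis using b 2 by simp
      next
        case 3
        have "coord X w (\<Phi> m) = coord X x (\<Phi> m)"
          by (rule coord_cong[OF \<Phi>I]) (use w_na initial_down[OF not_above_initial 3] in blast)
        then show ?thesis by simp
      qed
      then show ?thesis using xm by simp
    qed
    then have "w \<in> ?Y" using w(1) by (simp add: Y)
    then show "b \<in> fibre I ?Y (restrict x (below I i)) i"
      unfolding fibre_def using w_below wi by blast
  qed
  have split: "x i \<in> split_half (fibre I ?Y (restrict x (below I i)) i) e \<longleftrightarrow> coord X x i n = e"
    if x: "x \<in> ?Y" for x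
  proof -
    have xX: "x \<in> X" using x by (simp add: Y)
    have "stem_length (fibre I ?Y (restrict x (below I i)) i) = enumerate (branching (fib x i) (x i)) n"
      unfolding fib_Y[OF x] using stem_length_addr[OF X_perfect[OF i xX] mem_fib[OF xX], of n]
      by (simp add: coord_def)
    moreover have "x i \<in> fibre I ?Y (restrict x (below I i)) i" using x by (auto simp: fibre_def)
    ultimately show ?thesis by (simp add: split_half_def coord_def addr_def)
  qed
  have "split_node I X \<Phi> (u @ [e]) = split_at I ?Y i e"
    by (simp add: split_node_snoc i_def)
  also have "\<dots> = {x \<in> ?Y. coord X x i n = e}"
    unfolding split_at_def using split by blast
  also have "\<dots> = {x \<in> X. \<forall>m<length (u @ [e]). coord X x (\<Phi> m) (prior \<Phi> m) = (u @ [e]) ! m}"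
    unfolding Y by (auto simp: nth_append less_Suc_eq i_def n_def)
  finally show ?case .
qed

lemma split_branch_eq:
  assumes \<Phi>: "admissible I \<Phi>"
  shows "split_branch I X \<Phi> a = {x \<in> X. \<forall>m. coord X x (\<Phi> m) (prior \<Phi> m) = a m}"
  unfolding split_branch_def split_node_eq[OF \<Phi>] by (auto simp: less_Suc_eq)

lemma split_branch_coord:
  assumes \<Phi>: "admissible I \<Phi>"
  shows "split_branch I X \<Phi> (\<lambda>m. y (\<Phi> m) (prior \<Phi> m)) = {x \<in> X. \<forall>i\<in>I. coord X x i = y i}"
  unfolding split_branch_eq[OF \<Phi>]
proof (rule Collect_cong, rule conj_cong[OF refl], rule iffI)
  fix x assume *: "\<forall>i\<in>I. coord X x i = y i"
  have "\<Phi> m \<in> I" for m using \<Phi> by (auto simp: admissible_def)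
  then show "\<forall>m. coord X x (\<Phi> m) (prior \<Phi> m) = y (\<Phi> m) (prior \<Phi> m)"
    using * by simp
next
  fix x assume *: "\<forall>m. coord X x (\<Phi> m) (prior \<Phi> m) = y (\<Phi> m) (prior \<Phi> m)"
  show "\<forall>i\<in>I. coord X x i = y i"
  proof
    fix i assume "i \<in> I"
    then have inf: "infinite {m. \<Phi> m = i}" using \<Phi> by (simp add: admissible_def)
    show "coord X x i = y i"
    proof
      fix k
      show "coord X x i k = y i k"
        using *[rule_format, of "enumerate {m. \<Phi> m = i} k"] by (simp add: prior_enumerate[OF inf])
    qed
  qed
qed

text \<open>An admissible \<open>\<Phi>\<close> meets every pair of a coordinate and a bit number
  exactly once, as \<open>(\<Phi> m, prior \<Phi> m)\<close>, so branches \<open>a\<close>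
  correspond to points \<open>y\<close> on \<open>I\<close>, whatever \<open>\<Phi>\<close>
  is.\<close>

lemma shrinkable_iff: "shrinkable I I X \<longleftrightarrow> (\<forall>y. \<exists>x. {x \<in> X. \<forall>i\<in>I. coord X x i = y i} = {x})"
proof
  assume shr: "shrinkable I I X"
  show "\<forall>y. \<exists>x. {x \<in> X. \<forall>i\<in>I. coord X x i = y i} = {x}"
  proof (cases "I = {}")
    \<comment> \<open>Without coordinates there is no admissible function, so shrinkability says
      nothing; but then \<open>X\<close> has just one point.\<close>
    case True
    then have "X \<subseteq> {\<lambda>_. undefined}" using X_extensional by auto
    then show ?thesis using X_nonempty True by auto
  next
    case False
    \<comment> \<open>Reading \<open>m\<close> as a pair and using its first component makes every
      element occur infinitely often.\<close>
    define \<Phi> where "\<Phi> m = from_nat_into I (fst (prod_decode m))" for m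
    have "infinite {m. \<Phi> m = i}" if i: "i \<in> I" for i
    proof
      assume "finite {m. \<Phi> m = i}"
      moreover have "range (\<lambda>k. prod_encode (to_nat_on I i, k)) \<subseteq> {m. \<Phi> m = i}"
        using i countable_I by (auto simp: \<Phi>_def)
      ultimately have "finite (range (\<lambda>k. prod_encode (to_nat_on I i, k)))" by (rule finite_subset[rotated])
      moreover have "inj (\<lambda>k. prod_encode (to_nat_on I i, k))" by (simp add: inj_on_def)
      ultimately show False using range_inj_infinite by blast
    qed
    then have \<Phi>: "admissible I \<Phi>"
      using from_nat_into[OF False] by (auto simp: admissible_def \<Phi>_def)
    show ?thesis
    proof
      fix y
      show "\<exists>x. {x \<in> X. \<forall>i\<in>I. coord X x i = y i} = {x}"
        using shr \<Phi> unfolding shrinkable_def split_branch_coord[OF \<Phi>, symmetric] by blast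
    qed
  qed
next
  assume *: "\<forall>y. \<exists>x. {x \<in> X. \<forall>i\<in>I. coord X x i = y i} = {x}"
  show "shrinkable I I X"
    unfolding shrinkable_def
  proof (intro allI impI)
    fix \<Phi> and a :: cantor assume \<Phi>: "admissible I \<Phi>"
    define y where "y i k = a (enumerate {m. \<Phi> m = i} k)" for i k
    have "infinite {m'. \<Phi> m' = \<Phi> m}" for m using \<Phi> by (auto simp: admissible_def)
    then have "(\<lambda>m. y (\<Phi> m) (prior \<Phi> m)) = a" by (simp add: y_def enumerate_prior)
    then show "\<exists>x. split_branch I X \<Phi> a = {x}"
      using split_branch_coord[OF \<Phi>, of y] * by metis
  qed
qed

section \<open>Limits of points, fibres and coordinates\<close>

lemma X_limit:
  assumes xs: "\<And>n. xs n \<in> X" and x: "x \<in> extensional I" and lim: "\<And>m. \<exists>n. near m (xs n) x"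
  shows "x \<in> X"
proof (rule ccontr)
  assume "x \<notin> X"
  then have x: "x \<in> extensional I - X" using x by simp
  have "topspace (cantor_power I) = extensional I" by (simp add: cantor_power_def PiE_def)
  then have "openin (cantor_power I) (extensional I - X)" using X_closed by (simp add: closedin_def)
  then obtain n where n: "\<And>y. y \<in> extensional I \<Longrightarrow> agree_on (I \<inter> lvl n) n y x \<Longrightarrow> y \<notin> X"
    unfolding openin_cantor_power[OF subset_refl] using x by blast
  obtain k where "near n (xs k) x" using lim by blast
  then have "agree_on (I \<inter> lvl n) n (xs k) x" by (auto intro: agree_on_mono)
  then show False using n[OF X_extensional[OF xs]] xs by blast
qed

text \<open>Fibres vary continuously: meeting a cylinder persists by the openness condition on
  \<open>X\<close>, and missing it persists because \<open>X\<close> is closed in a compact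
  space.\<close>

lemma fibre_meets_limit:
  assumes xs: "\<And>n. xs n \<in> X" and x: "x \<in> X" and lim: "\<And>m. \<exists>N. \<forall>n\<ge>N. near m (xs n) x" and i: "i \<in> I"
  shows "\<forall>\<^sub>F n in sequentially. (\<exists>b\<in>fib (xs n) i. \<forall>k<l. b k = a k) \<longleftrightarrow> (\<exists>b\<in>fib x i. \<forall>k<l. b k = a k)"
proof (cases "\<exists>b\<in>fib x i. \<forall>k<l. b k = a k")
  case True
  let ?B = "below I i"
  let ?S = "{restrict x ?B |x. x \<in> X \<and> x i \<in> {b. \<forall>k<l. b k = a k}}"
  obtain x' where x': "x' \<in> X" "restrict x' ?B = restrict x ?B" "\<forall>k<l. x' i k = a k"
    using True by (auto simp: fibre_def)
  then have "restrict x' ?B \<in> ?S" by blast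
  then have "restrict x ?B \<in> ?S" unfolding x'(2) .
  moreover obtain V where V: "openin (cantor_power ?B) V" "?S = V \<inter> proj_set X ?B"
    using X_open[OF i open_cylinder[of l a]] unfolding openin_subtopology by blast
  ultimately obtain m where m: "\<And>y. y \<in> extensional ?B \<Longrightarrow> agree_on (?B \<inter> lvl m) m y (restrict x ?B) \<Longrightarrow> y \<in> V"
    unfolding openin_cantor_power[OF below_subset] by blast
  have "\<exists>b\<in>fib (xs n) i. \<forall>k<l. b k = a k" if "near m (xs n) x" for n
  proof -
    have "restrict (xs n) ?B \<in> V"
      by (rule m) (use that in \<open>auto simp: agree_on_def\<close>)
    moreover have "restrict (xs n) ?B \<in> proj_set X ?B" using xs by (auto simp: proj_set_def)
    ultimately have "restrict (xs n) ?B \<in> ?S" using V(2) by blast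
    then show ?thesis by (force simp: fibre_def)
  qed
  then show ?thesis
    using lim[of m] True unfolding eventually_sequentially by blast
next
  case False
  have "\<exists>N. \<forall>n\<ge>N. \<not> (\<exists>b\<in>fib (xs n) i. \<forall>k<l. b k = a k)"
  proof (rule ccontr)
    assume "\<not> ?thesis"
    then have "\<forall>N. \<exists>n w. n \<ge> N \<and> w \<in> X \<and> restrict w (below I i) = restrict (xs n) (below I i) \<and> (\<forall>k<l. w i k = a k)"
      by (fastforce simp: fibre_def)
    then obtain g ws where g: "\<And>N. g N \<ge> N" and ws: "\<And>N. ws N \<in> X"
        "\<And>N. restrict (ws N) (below I i) = restrict (xs (g N)) (below I i)" "\<And>N. \<forall>k<l. ws N i k = a k"
      by metis
    obtain w0 and r :: "nat \<Rightarrow> nat" where r: "strict_mono r" and w0: "\<And>m. \<exists>N. \<forall>n\<ge>N. near m (ws (r n)) w0"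
      using convergent_subseq[of ws] by blast
    define w where "w = restrict w0 I"
    have lim_w: "\<exists>N. \<forall>n\<ge>N. near m (ws (r n)) w" for m
      using w0[of m] lvl_subset[of m] by (auto simp: agree_on_def w_def subset_iff)
    have "w \<in> X"
    proof (rule X_limit[of "\<lambda>n. ws (r n)"])
      show "\<exists>n. near m (ws (r n)) w" for m using lim_w[of m] by blast
    qed (simp_all add: ws w_def)
    have w_below: "w j = x j" if j: "j \<in> below I i" for j
    proof
      fix k
      define m where "m = Suc (max (to_nat_on I j) k)"
      have m: "j \<in> lvl m" "k < m" using j by (auto simp: m_def lvl_def below_def)
      obtain N1 where N1: "\<And>n. n \<ge> N1 \<Longrightarrow> near m (ws (r n)) w" using lim_w by blast
      obtain N2 where N2: "\<And>n. n \<ge> N2 \<Longrightarrow> near m (xs n) x" using lim by blast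
      define n where "n = max N1 N2"
      have "N2 \<le> g (r n)" using g[of "r n"] seq_suble[OF r, of n] by (simp add: n_def)
      then have "xs (g (r n)) j k = x j k" using agree_onD[OF N2 m] by blast
      moreover have "ws (r n) j k = w j k" using agree_onD[OF N1 m, of n] by (simp add: n_def)
      moreover have "ws (r n) j = xs (g (r n)) j" using ws(2)[of "r n"] j unfolding restrict_eq_iff by blast
      ultimately show "w j k = x j k" by simp
    qed
    have "w i k = a k" if k: "k < l" for k
    proof -
      define m where "m = Suc (max (to_nat_on I i) k)"
      have m: "i \<in> lvl m" "k < m" using i by (auto simp: m_def lvl_def)
      obtain N where "near m (ws (r N)) w" using lim_w by blast
      from agree_onD[OF this m] show ?thesis using ws(3) k by simp
    qed
    moreover have "w i \<in> fib x i"
      using \<open>w \<in> X\<close> w_below unfolding fibre_def restrict_eq_iff by blast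
    ultimately show False using False by blast
  qed
  then have "\<forall>\<^sub>F n in sequentially. \<not> (\<exists>b\<in>fib (xs n) i. \<forall>k<l. b k = a k)"
    unfolding eventually_sequentially .
  then show ?thesis by (rule eventually_mono) (simp only: False)
qed

lemma coord_limit:
  assumes xs: "\<And>n. xs n \<in> X" and x: "x \<in> X" and lim: "\<And>m. \<exists>N. \<forall>n\<ge>N. near m (xs n) x" and i: "i \<in> I"
  shows "\<forall>\<^sub>F n in sequentially. coord X (xs n) i k = coord X x i k"
proof -
  \<comment> \<open>Address bit \<open>k\<close> is determined by the bits of \<open>x i\<close> up
    to level \<open>L\<close> and by which of finitely many cylinders reaching at most one bit
    further the fibre meets.\<close>
  define L where "L = enumerate (branching (fib x i) (x i)) k"
  have "\<forall>\<^sub>F n in sequentially. \<forall>l\<in>{..L}. \<forall>e\<in>UNIV.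
      (\<exists>b\<in>fib (xs n) i. \<forall>k<Suc l. b k = ((x i)(l := e)) k) \<longleftrightarrow> (\<exists>b\<in>fib x i. \<forall>k<Suc l. b k = ((x i)(l := e)) k)"
    by (intro eventually_ball_finite ballI fibre_meets_limit[OF xs x lim i]) simp_all
  moreover define m where "m = Suc (max (to_nat_on I i) L)"
  have "\<forall>\<^sub>F n in sequentially. near m (xs n) x" using lim[of m] by (simp add: eventually_sequentially)
  ultimately show ?thesis
  proof eventually_elim
    case (elim n)
    have m: "i \<in> lvl m" using i by (simp add: m_def lvl_def)
    have eq: "xs n i k = x i k" if "k \<le> L" for k
      by (rule agree_onD[OF elim(2) m]) (use that in \<open>simp add: m_def\<close>)
    have "enumerate (branching (fib (xs n) i) (xs n i)) k = enumerate (branching (fib x i) (x i)) k"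
    proof (rule enumerate_cong_below)
      show "infinite (branching (fib x i) (x i))" "infinite (branching (fib (xs n) i) (xs n i))"
        using branching_infinite X_perfect[OF i] mem_fib xs x by blast+
      fix l assume "l \<le> enumerate (branching (fib x i) (x i)) k"
      then have l: "l \<le> L" by (simp add: L_def)
      have "l \<in> branching (fib (xs n) i) (xs n i) \<longleftrightarrow> l \<in> branching (fib (xs n) i) (x i)"
        by (rule branching_cong[of l]) (use eq l in auto)
      also have "\<dots> \<longleftrightarrow> l \<in> branching (fib x i) (x i)"
        unfolding branching_iff using elim(1) l by simp
      finally show "l \<in> branching (fib (xs n) i) (xs n i) \<longleftrightarrow> l \<in> branching (fib x i) (x i)" .
    qed
    then show "coord X (xs n) i k = coord X x i k"
      unfolding coord_def addr_def using eq[of L] by (simp add: L_def)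
  qed
qed

lemma X_convergent_subseq:
  assumes xs: "\<And>n. xs n \<in> X"
  obtains x and r :: "nat \<Rightarrow> nat" where "strict_mono r" "x \<in> X" "\<And>m. \<exists>N. \<forall>n\<ge>N. near m (xs (r n)) x"
proof -
  obtain x0 and r :: "nat \<Rightarrow> nat" where r: "strict_mono r" and x0: "\<And>m. \<exists>N. \<forall>n\<ge>N. near m (xs (r n)) x0"
    using convergent_subseq[of xs] by blast
  have lim: "\<exists>N. \<forall>n\<ge>N. near m (xs (r n)) (restrict x0 I)" for m
    using x0[of m] lvl_subset[of m] by (auto simp: agree_on_def subset_iff)
  moreover have "restrict x0 I \<in> X"
  proof (rule X_limit[of "\<lambda>n. xs (r n)"])
    show "\<exists>n. near m (xs (r n)) (restrict x0 I)" for m using lim[of m] by blast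
  qed (simp_all add: xs)
  ultimately show thesis using that r by blast
qed

lemma emb_if_shrinkable:
  assumes "shrinkable I I X"
  shows "\<exists>H. emb H \<and> X = img H"
proof -
  have unique: "\<exists>x. {x \<in> X. \<forall>i\<in>I. coord X x i = y i} = {x}" for y
    using assms unfolding shrinkable_iff by blast
  define H where "H y = (THE x. x \<in> X \<and> (\<forall>i\<in>I. coord X x i = y i))" for y
  have ex1: "\<exists>!x. x \<in> X \<and> (\<forall>i\<in>I. coord X x i = y i)" for y
  proof -
    obtain x where x: "{x \<in> X. \<forall>i\<in>I. coord X x i = y i} = {x}" using unique by blast
    show ?thesis by (rule ex1I[of _ x]) (use x in blast)+
  qed
  have HX: "H y \<in> X" and coord_H: "i \<in> I \<Longrightarrow> coord X (H y) i = y i" for y i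
    using theI'[OF ex1[of y]] unfolding H_def by blast+
  have eqI: "x = x'" if "x \<in> X" "x' \<in> X" "\<And>i. i \<in> I \<Longrightarrow> coord X x i = coord X x' i" for x x'
    using ex1[of "coord X x'"] that by metis
  have H_coord: "H (coord X x) = x" if "x \<in> X" for x
    by (rule eqI) (simp_all add: HX coord_H that)
  have "X = img H"
  proof (intro subset_antisym subsetI)
    fix x assume x: "x \<in> X"
    then have "x = restrict (H (coord X x)) I"
      using H_coord[OF x] extensional_restrict[OF X_extensional[OF x]] by simp
    then show "x \<in> img H" unfolding img_def by blast
  next
    fix x assume "x \<in> img H"
    then obtain y where "x = restrict (H y) I" by (auto simp: img_def)
    then show "x \<in> X" using HX extensional_restrict[OF X_extensional[OF HX]] by metis
  qed
  \<comment> \<open>Not evident, as \<open>H\<close> is defined by all coordinates at once. The part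
    of \<open>H y\<close> up to \<open>i\<close> is extended by longer and longer approximations to
    \<open>y'\<close> elsewhere; a limit point has the coordinates \<open>y'\<close>, so it is
    \<open>H y'\<close> by uniqueness.\<close>
  have cong: "H y i = H y' i" if i: "i \<in> I" and yy': "\<And>j. j \<in> I \<Longrightarrow> j \<le> i \<Longrightarrow> y j = y' j" for i y y'
  proof -
    let ?\<xi> = "{j \<in> I. j \<le> i}"
    have "\<exists>w\<in>X. (\<forall>j\<in>?\<xi>. w j = H y j) \<and> (\<forall>j\<in>lvl n - ?\<xi>. \<forall>k<n. coord X w j k = y' j k)" for n
      by (rule coord_extension[OF _ _ upto_initial _ HX]) (use finite_lvl lvl_subset in auto)
    then have "\<forall>n. \<exists>w. w \<in> X \<and> (\<forall>j\<in>?\<xi>. w j = H y j) \<and> (\<forall>j\<in>lvl n - ?\<xi>. \<forall>k<n. coord X w j k = y' j k)"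
      by blast
    from choice[OF this] obtain ws where ws: "\<And>n. ws n \<in> X" "\<And>n j. j \<in> ?\<xi> \<Longrightarrow> ws n j = H y j"
        "\<And>n j k. j \<in> lvl n - ?\<xi> \<Longrightarrow> k < n \<Longrightarrow> coord X (ws n) j k = y' j k"
      by blast
    obtain w and r :: "nat \<Rightarrow> nat" where r: "strict_mono r" and w: "w \<in> X"
      and lim: "\<And>m. \<exists>N. \<forall>n\<ge>N. near m (ws (r n)) w"
      by (rule X_convergent_subseq[of ws, OF ws(1)], rule that)
    have w_\<xi>: "w j = H y j" if j: "j \<in> ?\<xi>" for j
    proof
      fix k
      define m where "m = Suc (max (to_nat_on I j) k)"
      have m: "j \<in> lvl m" "k < m" using j by (auto simp: m_def lvl_def)
      obtain N where "near m (ws (r N)) w" using lim by blast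
      from agree_onD[OF this m] show "w j k = H y j k" using ws(2)[OF j] by simp
    qed
    have "coord X w j = y' j" if j: "j \<in> I" for j
    proof (cases "j \<in> ?\<xi>")
      case True
      have "coord X w j = coord X (H y) j"
        by (rule coord_cong[OF j]) (use w_\<xi> True in auto)
      then show ?thesis using coord_H[OF j] yy'[OF j] True by simp
    next
      case False
      show ?thesis
      proof
        fix k
        have "\<forall>\<^sub>F n in sequentially. coord X (ws (r n)) j k = coord X w j k"
          using coord_limit[of "\<lambda>n. ws (r n)" w j k] ws(1) w lim j by blast
        then obtain N where N: "\<And>n. n \<ge> N \<Longrightarrow> coord X (ws (r n)) j k = coord X w j k"
          unfolding eventually_sequentially by blast
        define n where "n = max N (Suc (max (to_nat_on I j) k))"
        have "r n \<ge> n" using r by (rule seq_suble)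
        then have "j \<in> lvl (r n) - ?\<xi>" "k < r n" using j False by (auto simp: lvl_def n_def)
        then show "coord X w j k = y' j k" using ws(3) N[of n] by (simp add: n_def)
      qed
    qed
    then have "w = H y'" by (intro eqI w HX) (simp add: coord_H)
    then show ?thesis using w_\<xi>[of i] i by simp
  qed
  have "emb H"
  proof (rule embI)
    fix m
    \<comment> \<open>By compactness: limit points of two violating sequences have the same
      coordinates, because coordinates are continuous, and so they are equal.\<close>
    show "\<exists>n. \<forall>x y. near n x y \<longrightarrow> near m (H x) (H y)"
    proof (rule ccontr)
      assume "\<not> ?thesis"
      then have "\<forall>n. \<exists>y y'. near n y y' \<and> \<not> near m (H y) (H y')" by blast
      then obtain ys ys' where ys: "\<And>n. near n (ys n) (ys' n)" "\<And>n. \<not> near m (H (ys n)) (H (ys' n))"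
        by metis
      obtain x and r :: "nat \<Rightarrow> nat" where r: "strict_mono r" and x: "x \<in> X"
        and x_lim: "\<And>m. \<exists>N. \<forall>n\<ge>N. near m (H (ys (r n))) x"
        by (rule X_convergent_subseq[of "\<lambda>n. H (ys n)", OF HX], rule that)
      obtain x' and r' :: "nat \<Rightarrow> nat" where r': "strict_mono r'" and x': "x' \<in> X"
        and x'_lim: "\<And>m. \<exists>N. \<forall>n\<ge>N. near m (H (ys' (r (r' n)))) x'"
        by (rule X_convergent_subseq[of "\<lambda>n. H (ys' (r n))", OF HX], rule that)
      define s where "s n = r (r' n)" for n
      have s: "n \<le> s n" for n
        using seq_suble[OF r, of "r' n"] seq_suble[OF r', of n] by (simp add: s_def)
      have lim: "\<exists>N. \<forall>n\<ge>N. near m (H (ys (s n))) x" for m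
        using x_lim[of m] seq_suble[OF r'] unfolding s_def by (meson le_trans)
      have lim': "\<exists>N. \<forall>n\<ge>N. near m (H (ys' (s n))) x'" for m
        using x'_lim[of m] by (simp add: s_def)
      have "coord X x i = coord X x' i" if i: "i \<in> I" for i
      proof
        fix k
        have "\<forall>\<^sub>F n in sequentially. coord X (H (ys (s n))) i k = coord X x i k"
          by (rule coord_limit[OF HX x lim i])
        moreover have "\<forall>\<^sub>F n in sequentially. coord X (H (ys' (s n))) i k = coord X x' i k"
          by (rule coord_limit[OF HX x' lim' i])
        moreover have "\<forall>\<^sub>F n in sequentially. n \<ge> Suc (max (to_nat_on I i) k)"
          by (rule eventually_ge_at_top)
        ultimately have "\<forall>\<^sub>F n in sequentially. coord X x i k = coord X x' i k"
        proof eventually_elim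
          case (elim n)
          have "i \<in> lvl (s n)" "k < s n" using elim(3) s[of n] i by (auto simp: lvl_def)
          from agree_onD[OF ys(1) this] show ?case using elim(1,2) coord_H[OF i] by simp
        qed
        then show "coord X x i k = coord X x' i k" by simp
      qed
      then have "x = x'" by (rule eqI[OF x x'])
      obtain N where N: "\<And>n. n \<ge> N \<Longrightarrow> near m (H (ys (s n))) x" using lim by blast
      obtain N' where N': "\<And>n. n \<ge> N' \<Longrightarrow> near m (H (ys' (s n))) x'" using lim' by blast
      have "near m (H (ys (s (max N N')))) (H (ys' (s (max N N'))))"
        using N[of "max N N'"] N'[of "max N N'"] \<open>x = x'\<close> by (meson agree_on_sym agree_on_trans max.cobounded1 max.cobounded2)
      then show False using ys(2) by blast
    qed
  next
    fix i and x y :: "'i \<Rightarrow> cantor"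
    assume i: "i \<in> I" and xy: "\<And>j. j \<in> I \<Longrightarrow> j \<le> i \<Longrightarrow> x j = y j"
    then show "H x i = H y i" by (rule cong)
  next
    fix i and x y :: "'i \<Rightarrow> cantor"
    assume i: "i \<in> I" and Hxy: "\<And>j. j \<in> I \<Longrightarrow> j \<le> i \<Longrightarrow> H x j = H y j"
    have "coord X (H x) i = coord X (H y) i" by (rule coord_cong[OF i Hxy])
    then show "x i = y i" using coord_H[OF i] by simp
  next
    fix i and y :: "'i \<Rightarrow> cantor" assume i: "i \<in> I"
    show "tree_embedding (\<lambda>t. H (y(i := t)) i)"
    proof (rule tree_embeddingI)
      fix t :: cantor and n
      let ?x = "H (y(i := t))"
      let ?A = "fib ?x i"
      \<comment> \<open>All points \<open>H (y(i := s))\<close> have the same fibre at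
        \<open>i\<close>, in which their addresses are the \<open>s\<close>. So the level of bit
        \<open>n\<close> is the branching level number \<open>n\<close>.\<close>
      let ?l = "enumerate (branching ?A (?x i)) n"
      have A: "perfect_set ?A" by (rule X_perfect[OF i HX])
      have "(\<forall>k<?l. H (y(i := s)) i k = ?x i k) \<and> H (y(i := s)) i ?l = s n" if s: "\<forall>k<n. s k = t k" for s
      proof -
        let ?z = "H (y(i := s))"
        have "?z j = ?x j" if "j \<in> below I i" for j
          by (rule cong) (use that in \<open>auto simp: below_def\<close>)
        then have zx: "restrict ?z (below I i) = restrict ?x (below I i)" unfolding restrict_eq_iff by blast
        have mem: "?x i \<in> ?A" "?z i \<in> ?A" using mem_fib[OF HX, of _ i] zx by metis+
        have addr: "addr ?A (?x i) = t" "addr ?A (?z i) = s"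
          using coord_H[OF i, of "y(i := t)"] coord_H[OF i, of "y(i := s)"] zx by (simp_all add: coord_def)
        have "\<forall>k<?l. ?z i k = ?x i k" by (rule addr_agree[OF A mem]) (use s addr in simp)
        moreover from this have "addr ?A (?z i) n = ?z i ?l" by (rule addr_prefix(2)[OF A mem])
        ultimately show ?thesis using addr(2) by simp
      qed
      then show "\<exists>l. \<forall>s. (\<forall>k<n. s k = t k) \<longrightarrow> (\<forall>k<l. H (y(i := s)) i k = ?x i k) \<and> H (y(i := s)) i l = s n"
        by blast
    qed
  qed
  then show ?thesis using \<open>X = img H\<close> by blast
qed

end

lemma iter_perfect_iff: "X \<in> iter_perfect I I \<longleftrightarrow> (\<exists>H. emb H \<and> X = img H)"
proof
  assume "X \<in> iter_perfect I I"
  then show "\<exists>H. emb H \<and> X = img H"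
    using emb_if_shrinkable by (auto simp: iter_perfect_def)
next
  assume "\<exists>H. emb H \<and> X = img H"
  then obtain H where H: "emb H" "X = img H" by blast
  have X: "X \<in> iter_perfect' I I" using img_iter_perfect'[OF H(1)] H(2) by simp
  have "{x \<in> X. \<forall>i\<in>I. coord X x i = y i} = {restrict (H y) I}" for y
  proof (intro subset_antisym subsetI)
    fix x assume "x \<in> {x \<in> X. \<forall>i\<in>I. coord X x i = y i}"
    then obtain y' where x: "x = restrict (H y') I" and y': "\<forall>i\<in>I. coord X x i = y i"
      unfolding H(2) by (auto simp: img_def)
    have "\<forall>i\<in>I. y' i = y i" using y' coord_img[OF H(1)] unfolding x H(2) by simp
    then have "\<forall>i\<in>I. H y' i = H y i" using emb_cong_initial[OF H(1) I_initial] by blast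
    then show "x \<in> {restrict (H y) I}" unfolding x singleton_iff restrict_eq_iff .
  next
    fix x assume "x \<in> {restrict (H y) I}"
    then show "x \<in> {x \<in> X. \<forall>i\<in>I. coord X x i = y i}"
      using coord_img[OF H(1)] unfolding H(2) by (auto simp: img_def)
  qed
  then have "shrinkable I I X" unfolding shrinkable_iff[OF X] by blast
  then show "X \<in> iter_perfect I I" using X by (simp add: iter_perfect_def)
qed

end

section \<open>Capturing and reducibility\<close>

context countable_order
begin

lemma separating_continuous:
  fixes F :: "('i \<Rightarrow> cantor) \<Rightarrow> (nat \<Rightarrow> nat)"
  assumes F: "continuous_map (cantor_power I) euclidean F"
  shows "separating (\<lambda>x. F (restrict x I))"
  unfolding separating_def
proof (intro allI impI)
  fix x y :: "'i \<Rightarrow> cantor" assume "F (restrict x I) \<noteq> F (restrict y I)"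
  then obtain k where k: "F (restrict x I) k \<noteq> F (restrict y I) k" by auto
  have top: "topspace (cantor_power I) = extensional I" by (simp add: cantor_power_def PiE_def)
  have "\<exists>N. \<forall>z. near N z w \<longrightarrow> F (restrict z I) k = F (restrict w I) k" for w
  proof -
    let ?U = "{g :: nat \<Rightarrow> nat. g k = F (restrict w I) k}"
    have "open {g :: nat \<Rightarrow> nat. \<forall>i\<in>{k}. g i \<in> {F (restrict w I) k}}"
      by (rule product_topology_basis') (simp_all add: open_discrete)
    then have "openin (cantor_power I) {z \<in> topspace (cantor_power I). F z \<in> ?U}"
      by (intro openin_continuous_map_preimage[OF F]) simp
    then have S: "openin (cantor_power I) {z \<in> extensional I. F z k = F (restrict w I) k}" (is "openin _ ?S")
      by (simp add: top)
    have "restrict w I \<in> ?S" by simp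
    with S obtain N where N: "\<And>z. z \<in> extensional I \<Longrightarrow> agree_on (I \<inter> lvl N) N z (restrict w I) \<Longrightarrow> z \<in> ?S"
      unfolding openin_cantor_power[OF subset_refl] by blast
    have "restrict z I \<in> ?S" if "near N z w" for z
      by (rule N) (use that in \<open>simp_all add: agree_on_def\<close>)
    then show ?thesis by blast
  qed
  then obtain d where d: "\<And>z w. near (d w) z w \<Longrightarrow> F (restrict z I) k = F (restrict w I) k" by metis
  have "F (restrict x' I) \<noteq> F (restrict y' I)" if "near (max (d x) (d y)) x' x" "near (max (d x) (d y)) y' y" for x' y'
    using d[of x x'] d[of y y'] near_mono[OF _ that(1), of "d x"] near_mono[OF _ that(2), of "d y"] k by auto
  then show "\<exists>N. \<forall>x' y'. near N x' x \<longrightarrow> near N y' y \<longrightarrow> F (restrict x' I) \<noteq> F (restrict y' I)"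
    by blast
qed

lemma separating_coordinate:
  assumes "j \<in> I"
  shows "separating (\<lambda>x. x j)"
  unfolding separating_def
proof (intro allI impI)
  fix x y :: "'i \<Rightarrow> cantor" assume "x j \<noteq> y j"
  then obtain k where k: "x j k \<noteq> y j k" by auto
  define N where "N = Suc (max (to_nat_on I j) k)"
  have N: "j \<in> lvl N" "k < N" using assms by (auto simp: N_def lvl_def)
  have "x' j \<noteq> y' j" if "near N x' x" "near N y' y" for x' y'
    using agree_onD[OF that(1) N] agree_onD[OF that(2) N] k by auto
  then show "\<exists>N. \<forall>x' y'. near N x' x \<longrightarrow> near N y' y \<longrightarrow> x' j \<noteq> y' j" by blast
qed

lemma emb_update_neq:
  assumes H: "emb H" and i: "i \<in> I" and "s \<noteq> t"
  shows "H (x(i := s)) i \<noteq> H (x(i := t)) i"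
proof
  assume eq: "H (x(i := s)) i = H (x(i := t)) i"
  have "H (x(i := s)) j = H (x(i := t)) j" if "j \<in> I" "j \<le> i" for j
  proof (cases "j = i")
    case False
    then show ?thesis using that by (intro emb_cong[OF H]) auto
  qed (simp add: eq)
  from emb_inj[OF H i this] show False using \<open>s \<noteq> t\<close> by simp
qed

lemma img_subset_img: "(\<And>x. \<exists>y. \<forall>i\<in>I. H x i = K y i) \<Longrightarrow> img H \<subseteq> img K"
  unfolding img_def by (force simp: restrict_eq_iff image_iff)

lemma reducible_img:
  assumes H: "emb H" and \<xi>: "\<xi> \<in> initial_sets I"
  shows "reducible_to F \<xi> (img H) \<longleftrightarrow> depends_on \<xi> (\<lambda>x. F (restrict (H x) I))"
proof -
  have "restrict (restrict (H x) I) \<xi> = restrict (restrict (H y) I) \<xi> \<longleftrightarrow> (\<forall>i\<in>\<xi>. x i = y i)" for x y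
    unfolding restrict_eq_iff
    using initial_subset[OF \<xi>] emb_cong_initial[OF H \<xi>, of x y] emb_inj_initial[OF H \<xi>, of x y]
    by (auto simp: subset_iff)
  then show ?thesis unfolding reducible_to_def depends_on_def img_def by simp
qed

text \<open>\<open>H x i\<close> depends on all coordinates of \<open>x\<close> up to
  \<open>i\<close>, so \<open>F\<close> has to determine all of these.\<close>

lemma captures_img:
  assumes H: "emb H" and i: "i \<in> I"
    and determined: "\<And>x y j. F (restrict (H x) I) = F (restrict (H y) I) \<Longrightarrow> j \<in> I \<Longrightarrow> j \<le> i \<Longrightarrow> x j = y j"
  shows "captures F i (img H)"
  unfolding captures_def img_def
proof (intro ballI impI, elim rangeE)
  fix u v x y assume F: "F u = F v" and uv: "u = restrict (H x) I" "v = restrict (H y) I"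
  have "H x i = H y i" by (rule emb_cong[OF H i]) (use determined F uv in blast)
  then show "u i = v i" using i uv by simp
qed

text \<open>Parameters that differ only at \<open>i\<close> have images that agree on
  \<open>\<xi>\<close> but differ at \<open>i\<close>.\<close>

lemma reducible_imp_not_captures:
  assumes X: "X \<in> iter_perfect I I" and \<xi>: "\<xi> \<in> initial_sets I" and i: "i \<in> I - \<xi>"
    and red: "reducible_to F \<xi> X"
  shows "\<not> captures F i X"
proof
  assume cap: "captures F i X"
  obtain H where H: "emb H" "X = img H" using X iter_perfect_iff by blast
  let ?x = "(\<lambda>_ _. False) :: 'i \<Rightarrow> cantor"
  let ?u = "?x(i := \<lambda>_. True)" and ?v = "?x(i := \<lambda>_. False)"
  have "depends_on \<xi> (\<lambda>x. F (restrict (H x) I))" using red H \<xi> reducible_img by blast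
  then have "F (restrict (H ?u) I) = F (restrict (H ?v) I)" by (rule depends_onD) (use i in auto)
  then have "restrict (H ?u) I i = restrict (H ?v) I i"
    using cap unfolding captures_def H(2) img_def by blast
  moreover have "(\<lambda>_. True) \<noteq> ((\<lambda>_. False) :: cantor)" by (simp add: fun_eq_iff)
  from emb_update_neq[OF H(1) _ this, of i ?x] i have "H ?u i \<noteq> H ?v i" by blast
  ultimately show False using i by simp
qed

text \<open>For \<open>capturing\<close> at any \<open>k \<le> j\<close>, two parameters differing
  only at \<open>j\<close> will do: \<open>j\<close> lies in the cone above \<open>k\<close>, and
  the images differ at \<open>j\<close>.\<close>

lemma coordinate_captures_below:
  assumes X: "X \<in> iter_perfect I I" and i: "i \<in> I" and j: "j \<in> I" and "i \<le> j"
  shows "\<exists>X'\<in>iter_perfect I I. X' \<subseteq> X \<and> captures (\<lambda>x. x j) i X'"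
proof -
  obtain H0 where H0: "emb H0" "X = img H0" using X iter_perfect_iff by blast
  have "\<exists>H. emb H \<and> (\<forall>x. \<exists>y. \<forall>i\<in>I. H x i = H0 y i) \<and>
    (\<forall>x y. H x j = H y j \<longrightarrow> (\<forall>k\<in>{k \<in> I. k \<le> j}. x k = y k))"
  proof (rule capturing[OF H0(1) separating_coordinate[OF j], of "{k \<in> I. k \<le> j}"])
    fix G k assume G: "emb G" and k: "k \<in> {k \<in> I. k \<le> j}"
    let ?x = "(\<lambda>_ _. False) :: 'i \<Rightarrow> cantor"
    have "(\<lambda>_. True) \<noteq> ((\<lambda>_. False) :: cantor)" by (simp add: fun_eq_iff)
    from emb_update_neq[OF emb_comp[OF H0(1) G] j this, of ?x]
    show "\<exists>x y. (\<forall>l\<in>I. \<not> k \<le> l \<longrightarrow> x l = y l) \<and> H0 (G x) j \<noteq> H0 (G y) j"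
      using k by (intro exI[of _ "?x(j := \<lambda>_. True)"] exI[of _ "?x(j := \<lambda>_. False)"]) auto
  qed blast
  then obtain H where H: "emb H" "\<And>x. \<exists>y. \<forall>i\<in>I. H x i = H0 y i"
    "\<And>x y k. H x j = H y j \<Longrightarrow> k \<in> I \<Longrightarrow> k \<le> j \<Longrightarrow> x k = y k"
    by blast
  have "captures (\<lambda>x. x j) i (img H)"
  proof (rule captures_img[OF H(1) i])
    fix x y k assume "restrict (H x) I j = restrict (H y) I j" "k \<in> I" "k \<le> i"
    then show "x k = y k" using H(3)[of x y k] j \<open>i \<le> j\<close> by simp
  qed
  moreover have "img H \<subseteq> X" using img_subset_img[OF H(2)] H0(2) by simp
  ultimately show ?thesis using H(1) iter_perfect_iff by blast
qed

text \<open>Inside a set on which \<open>F\<close> captures \<open>i\<close>, two points whose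
  parameters differ only at \<open>i\<close> have different values of \<open>F\<close>. Pulled back
  to the parameters of the larger set they agree off the cone above \<open>i\<close>, as
  \<open>capturing\<close> requires.\<close>

lemma captures_all:
  fixes F :: "('i \<Rightarrow> cantor) \<Rightarrow> (nat \<Rightarrow> nat)"
  assumes X: "X \<in> iter_perfect I I" and \<xi>: "\<xi> \<in> initial_sets I"
    and F: "continuous_map (cantor_power I) euclidean F"
    and cap: "\<And>X' i. X' \<in> iter_perfect I I \<Longrightarrow> X' \<subseteq> X \<Longrightarrow> i \<in> \<xi> \<Longrightarrow>
      \<exists>X''\<in>iter_perfect I I. X'' \<subseteq> X' \<and> captures F i X''"
  shows "\<exists>Y\<in>iter_perfect I I. Y \<subseteq> X \<and> (\<forall>i\<in>\<xi>. captures F i Y)"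
proof -
  let ?f = "\<lambda>x. F (restrict x I)"
  obtain H0 where H0: "emb H0" "X = img H0" using X iter_perfect_iff by blast
  have "\<exists>H. emb H \<and> (\<forall>x. \<exists>y. \<forall>i\<in>I. H x i = H0 y i) \<and>
    (\<forall>x y. ?f (H x) = ?f (H y) \<longrightarrow> (\<forall>i\<in>\<xi>. x i = y i))"
  proof (rule capturing[OF H0(1) separating_continuous[OF F] initial_subset[OF \<xi>]])
    fix G i assume G: "emb G" and i: "i \<in> \<xi>"
    let ?K = "\<lambda>x. H0 (G x)"
    have K: "emb ?K" using H0(1) G by (rule emb_comp)
    have iI: "i \<in> I" using i initial_subset[OF \<xi>] by blast
    have "img ?K \<subseteq> X" unfolding H0(2) by (rule img_subset_img) blast
    moreover have "img ?K \<in> iter_perfect I I" using K iter_perfect_iff by blast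
    ultimately obtain H'' where H'': "emb H''" "img H'' \<subseteq> img ?K" "captures F i (img H'')"
      using cap[OF _ _ i] iter_perfect_iff by metis
    let ?x = "(\<lambda>_ _. False) :: 'i \<Rightarrow> cantor"
    let ?u = "?x(i := \<lambda>_. True)" and ?v = "?x(i := \<lambda>_. False)"
    have mem: "restrict (H'' w) I \<in> img H''" for w by (auto simp: img_def)
    have "\<exists>x. restrict (H'' w) I = restrict (?K x) I" for w
      using subsetD[OF H''(2) mem] by (auto simp: img_def)
    then obtain x y where xy: "restrict (H'' ?u) I = restrict (?K x) I" "restrict (H'' ?v) I = restrict (?K y) I"
      by meson
    have "(\<lambda>_. True) \<noteq> ((\<lambda>_. False) :: cantor)" by (simp add: fun_eq_iff)
    from emb_update_neq[OF H''(1) iI this, of ?x]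
    have "restrict (H'' ?u) I i \<noteq> restrict (H'' ?v) I i" using iI by simp
    then have "F (restrict (H'' ?u) I) \<noteq> F (restrict (H'' ?v) I)"
      using H''(3) mem unfolding captures_def by blast
    then have "?f (?K x) \<noteq> ?f (?K y)" unfolding xy .
    moreover have "x j = y j" if j: "j \<in> I" "\<not> i \<le> j" for j
    proof (rule emb_inj[OF K j(1)])
      fix k assume k: "k \<in> I" "k \<le> j"
      have "H'' ?u k = H'' ?v k"
        by (rule emb_cong[OF H''(1) k(1)]) (use j k order_trans in auto)
      then show "?K x k = ?K y k" using xy k(1) unfolding restrict_eq_iff by metis
    qed
    ultimately show "\<exists>x y. (\<forall>j\<in>I. \<not> i \<le> j \<longrightarrow> x j = y j) \<and> ?f (?K x) \<noteq> ?f (?K y)" by blast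
  qed
  then obtain H where H: "emb H" "\<And>x. \<exists>y. \<forall>i\<in>I. H x i = H0 y i"
    "\<And>x y i. ?f (H x) = ?f (H y) \<Longrightarrow> i \<in> \<xi> \<Longrightarrow> x i = y i"
    by blast
  have "captures F i (img H)" if i: "i \<in> \<xi>" for i
    by (rule captures_img[OF H(1)]) (use i initial_subset[OF \<xi>] initial_down[OF \<xi> i] H(3) in blast)+
  moreover have "img H \<subseteq> X" using img_subset_img[OF H(2)] H0(2) by simp
  ultimately show ?thesis using H(1) iter_perfect_iff by blast
qed

lemma reducible_or_captures:
  fixes F :: "('i \<Rightarrow> cantor) \<Rightarrow> (nat \<Rightarrow> nat)"
  assumes X: "X \<in> iter_perfect I I" and \<xi>: "\<xi> \<in> initial_sets I"
    and F: "continuous_map (cantor_power I) euclidean F"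
  shows "\<exists>X'\<in>iter_perfect I I. X' \<subseteq> X \<and> (reducible_to F \<xi> X' \<or> (\<exists>i\<in>I - \<xi>. captures F i X'))"
proof -
  let ?f = "\<lambda>x. F (restrict x I)"
  have f: "separating ?f" using F by (rule separating_continuous)
  obtain H0 where H0: "emb H0" "X = img H0" using X iter_perfect_iff by blast
  show ?thesis
  proof (cases "\<forall>G i. emb G \<longrightarrow> i \<in> I - \<xi> \<longrightarrow>
      (\<exists>G'. emb G' \<and> depends_on (not_above i) (\<lambda>x. ?f (H0 (G (G' x)))))")
    case True
    then obtain H where H: "emb H" "\<And>x. \<exists>y. \<forall>i\<in>I. H x i = H0 y i" "depends_on \<xi> (\<lambda>x. ?f (H x))"
      using reducing[OF H0(1) f \<xi>] by metis
    then have "reducible_to F \<xi> (img H)" using reducible_img[OF H(1) \<xi>] by blast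
    moreover have "img H \<subseteq> X" using img_subset_img[OF H(2)] H0(2) by simp
    ultimately show ?thesis using H(1) iter_perfect_iff by blast
  next
    \<comment> \<open>If reducing fails for \<open>i\<close> behind \<open>G\<close>, then any
      further map leaves two points that agree off the cone above \<open>i\<close> and have
      different values. That cone lies in the cone above each \<open>k \<le> i\<close>, so
      \<open>capturing\<close> determines all coordinates up to \<open>i\<close>.\<close>
    case False
    then obtain G i where G: "emb G" and i: "i \<in> I - \<xi>"
      and irreducible: "\<And>G'. emb G' \<Longrightarrow> \<not> depends_on (not_above i) (\<lambda>x. ?f (H0 (G (G' x))))"
      by blast
    let ?K = "\<lambda>x. H0 (G x)"
    have K: "emb ?K" using H0(1) G by (rule emb_comp)
    have "\<exists>H. emb H \<and> (\<forall>x. \<exists>y. \<forall>i\<in>I. H x i = ?K y i) \<and>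
      (\<forall>x y. ?f (H x) = ?f (H y) \<longrightarrow> (\<forall>k\<in>{k \<in> I. k \<le> i}. x k = y k))"
    proof (rule capturing[OF K f, of "{k \<in> I. k \<le> i}"])
      fix G' k assume "emb G'" and k: "k \<in> {k \<in> I. k \<le> i}"
      then obtain x y where "\<forall>j\<in>not_above i. x j = y j" "?f (?K (G' x)) \<noteq> ?f (?K (G' y))"
        using irreducible unfolding depends_on_def by blast
      moreover have "j \<in> not_above i" if "j \<in> I" "\<not> k \<le> j" for j
        using that k by (auto simp: not_above_def)
      ultimately show "\<exists>x y. (\<forall>j\<in>I. \<not> k \<le> j \<longrightarrow> x j = y j) \<and> ?f (?K (G' x)) \<noteq> ?f (?K (G' y))"
        by blast
    qed blast
    then obtain H where H: "emb H" "\<And>x. \<exists>y. \<forall>i\<in>I. H x i = ?K y i"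
      "\<And>x y k. ?f (H x) = ?f (H y) \<Longrightarrow> k \<in> I \<Longrightarrow> k \<le> i \<Longrightarrow> x k = y k"
      by blast
    have "captures F i (img H)"
      by (rule captures_img[OF H(1)]) (use i H(3) in blast)+
    moreover have "img H \<subseteq> img ?K" using H(2) by (rule img_subset_img)
    moreover have "img ?K \<subseteq> X" unfolding H0(2) by (rule img_subset_img) blast
    ultimately show ?thesis using H(1) i iter_perfect_iff by blast
  qed
qed

end

theorem theorem5:
  fixes I :: "'i::order set"
    and \<xi> :: "'i set"
    and X :: "('i \<Rightarrow> cantor) set"
    and F :: "('i \<Rightarrow> cantor) \<Rightarrow> (nat \<Rightarrow> nat)"
  assumes "countable I"
    and "\<xi> \<in> initial_sets I"
    and "X \<in> iter_perfect I I"
    and "continuous_map (cantor_power I) euclidean F"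
  shows "(\<forall>i\<in>I. \<forall>j\<in>I. i < j \<longrightarrow>
            (\<exists>X'\<in>iter_perfect I I. X' \<subseteq> X \<and> captures (\<lambda>x. x j) i X')) \<and>
         (\<forall>i\<in>I - \<xi>. reducible_to F \<xi> X \<longrightarrow> \<not> captures F i X) \<and>
         ((\<forall>X'\<in>iter_perfect I I. X' \<subseteq> X \<longrightarrow>
             (\<forall>i\<in>\<xi>. \<exists>X''\<in>iter_perfect I I. X'' \<subseteq> X' \<and> captures F i X'')) \<longrightarrow>
          (\<exists>Y\<in>iter_perfect I I. Y \<subseteq> X \<and> (\<forall>i\<in>\<xi>. captures F i Y))) \<and>
         (\<exists>X'\<in>iter_perfect I I. X' \<subseteq> X \<and>
            ((reducible_to F \<xi> X' \<and> \<not> (\<exists>i\<in>I - \<xi>. captures F i X')) \<or>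
             (\<not> reducible_to F \<xi> X' \<and> (\<exists>i\<in>I - \<xi>. captures F i X'))))"
proof -
  interpret countable_order I by unfold_locales fact
  show ?thesis
  proof (intro conjI ballI impI)
    show "\<exists>X'\<in>iter_perfect I I. X' \<subseteq> X \<and> captures (\<lambda>x. x j) i X'" if "i \<in> I" "j \<in> I" "i < j" for i j
      using coordinate_captures_below[OF assms(3) that(1,2)] that(3) by simp
    show "\<not> captures F i X" if "i \<in> I - \<xi>" "reducible_to F \<xi> X" for i
      using reducible_imp_not_captures[OF assms(3,2) that] .
    show "\<exists>Y\<in>iter_perfect I I. Y \<subseteq> X \<and> (\<forall>i\<in>\<xi>. captures F i Y)"
      if "\<forall>X'\<in>iter_perfect I I. X' \<subseteq> X \<longrightarrow>
             (\<forall>i\<in>\<xi>. \<exists>X''\<in>iter_perfect I I. X'' \<subseteq> X' \<and> captures F i X'')"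
      by (rule captures_all[OF assms(3,2,4)]) (use that in blast)
    \<comment> \<open>The two alternatives exclude each other by
      \<open>reducible_imp_not_captures\<close>, applied to \<open>X'\<close>.\<close>
    show "\<exists>X'\<in>iter_perfect I I. X' \<subseteq> X \<and>
            ((reducible_to F \<xi> X' \<and> \<not> (\<exists>i\<in>I - \<xi>. captures F i X')) \<or>
             (\<not> reducible_to F \<xi> X' \<and> (\<exists>i\<in>I - \<xi>. captures F i X')))"
      using reducible_or_captures[OF assms(3,2,4)] reducible_imp_not_captures[OF _ assms(2)] by blast
  qed
qed

end
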